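(* We have $$\lim_{n\to\infty}\max\{p(T_5^7;T_n) : |T_n|=n\}=\frac{5}{16},\qquad \lim_{n\to\infty}\max\{p(T_5^{12};T_n) : |T_n|=n\}=\frac{1}{16},$$ where the maxima are over all tournaments $T_n$ of size $n$. Furthermore, for each $S\in\{T_5^7,T_5^{12}\}$, a sequence of tournaments $(T_n)_{n\in\mathbb{N}}$ of increasing sizes is extremal for $S$ if and only if it is quasi-carousel, i.e., if and only if $\lim_{n\to\infty}p(T;T_n)=\phi_{\mathrm{R}}(T)$ for every finite tournament $T$.
   Context: A tournament is a finite directed graph without loops having exactly one arc between each pair of distinct vertices; $|T|=|V(T)|$ is its size. For tournaments $T,T'$ with $|T|\le|T'|$, $p(T;T')\in[0,1]$ is the probability that a uniformly random $|T|$-element subset of $V(T')$ induces a subtournament isomorphic to $T$. A sequence $(T_n)$ has increasing sizes if $|T_n|<|T_{n+1}|$ for all $n$. Such a sequence is extremal for $S$ if $\lim_{n\to\infty}p(S;T_n)$ exists and equals $\lim_{n\to\infty}\max\{p(S;T):|T|=n\}$. $T_5^7$ is the tournament on vertices $1,\dots,5$ in which $i\to j$ for all $i<j$ except that the arc between $1$ and $5$ is $5\to1$. $T_5^{12}$ is the tournament on $\mathbb{Z}_5$ with arcs $i\to i+1$ and $i\to i+2$ for all $i$ (so $T_5^{12}=R_5$). The carousel tournament $R_{2m+1}$ has vertex set $\mathbb{Z}_{2m+1}$ and arcs $(v,v+i)$ (mod $2m+1$) for all $v$ and $1\le i\le m$. The sequence $(R_{2m+1})_m$ is convergent (a known fact),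 and the carousel homomorphism $\phi_{\mathrm{R}}$ is its limit: $\phi_{\mathrm{R}}(T)=\lim_{m\to\infty}p(T;R_{2m+1})$ for every finite tournament $T$. *)

theory Defs
  imports Complex_Main "Graph_Theory.Pair_Digraph" "Graph_Theory.Digraph_Isomorphism"
begin

locale tournament = pair_digraph T for T :: "'a pair_pre_digraph" +
  assumes exactly_one_arc:
    "\<lbrakk>u \<in> pverts T; v \<in> pverts T; u \<noteq> v\<rbrakk> \<Longrightarrow> (u, v) \<in> parcs T \<longleftrightarrow> (v, u) \<notin> parcs T"

abbreviation tsize :: "'a pair_pre_digraph \<Rightarrow> nat" where
  "tsize T \<equiv> card (pverts T)"

text \<open>\<open>tdensity S T\<close> is the probability $p(S;T)$. It is only meaningful if
  \<open>tsize S \<le> tsize T\<close>; otherwise it is \<open>0 / 0 = 0\<close>.\<close>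

definition tdensity :: "'a pair_pre_digraph \<Rightarrow> 'b pair_pre_digraph \<Rightarrow> real" where
  "tdensity S T =
     card {X. X \<subseteq> pverts T \<and> card X = tsize S \<and> digraph_iso (with_proj S) (with_proj T \<restriction> X)} /
     card {X. X \<subseteq> pverts T \<and> card X = tsize S}"

text \<open>Every finite tournament is isomorphic to one with vertices of type \<^typ>\<open>nat\<close>, so the maximum
  below ranges over all tournaments of size \<open>n\<close>; it is a maximum of a finite nonempty set of reals
  (see \<open>finite_tdensities\<close> and \<open>tdensities_nonempty\<close>).\<close>

definition max_tdensity :: "'a pair_pre_digraph \<Rightarrow> nat \<Rightarrow> real" where
  "max_tdensity S n =
     Max {tdensity S T | T :: nat pair_pre_digraph. tournament T \<and> tsize T = n}"

definition increasing_sizes :: "(nat \<Rightarrow> 'a pair_pre_digraph) \<Rightarrow> bool" where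
  "increasing_sizes T \<longleftrightarrow> (\<forall>n. tsize (T n) < tsize (T (Suc n)))"

definition extremal :: "'a pair_pre_digraph \<Rightarrow> (nat \<Rightarrow> 'b pair_pre_digraph) \<Rightarrow> bool" where
  "extremal S T \<longleftrightarrow>
     (\<exists>L. (\<lambda>n. tdensity S (T n)) \<longlonglongrightarrow> L \<and> (\<lambda>n. max_tdensity S n) \<longlonglongrightarrow> L)"

definition T5_7 :: "nat pair_pre_digraph" where
  "T5_7 = \<lparr>pverts = {1..5},
     parcs = {(i, j). i \<in> {1..5} \<and> j \<in> {1..5} \<and> i < j} - {(1, 5)} \<union> {(5, 1)}\<rparr>"

definition T5_12 :: "nat pair_pre_digraph" where
  "T5_12 = \<lparr>pverts = {0..<5},
     parcs = {(i, (i + 1) mod 5) | i. i < 5} \<union> {(i, (i + 2) mod 5) | i. i < 5}\<rparr>"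

text \<open>\<open>carousel m\<close> is $R_{2m+1}$, with the residues modulo $2m+1$ represented by
  \<open>{0..<2 * m + 1}\<close>.\<close>

definition carousel :: "nat \<Rightarrow> nat pair_pre_digraph" where
  "carousel m = \<lparr>pverts = {0..<2 * m + 1},
     parcs = {(v, (v + i) mod (2 * m + 1)) | v i. v < 2 * m + 1 \<and> 1 \<le> i \<and> i \<le> m}\<rparr>"

definition carousel_hom :: "'a pair_pre_digraph \<Rightarrow> real" where
  "carousel_hom S = lim (\<lambda>m. tdensity S (carousel m))"

definition quasi_carousel :: "(nat \<Rightarrow> 'a pair_pre_digraph) \<Rightarrow> bool" where
  "quasi_carousel T \<longleftrightarrow>
     (\<forall>S :: nat pair_pre_digraph. tournament S \<longrightarrow>
        (\<lambda>n. tdensity S (T n)) \<longlonglongrightarrow> carousel_hom S)"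

lemma tournamentI:
  assumes "finite V" "A \<subseteq> V \<times> V" "\<And>v. (v, v) \<notin> A"
    and "\<And>u v. \<lbrakk>u \<in> V; v \<in> V; u \<noteq> v\<rbrakk> \<Longrightarrow> (u, v) \<in> A \<longleftrightarrow> (v, u) \<notin> A"
  shows "tournament \<lparr>pverts = V, parcs = A\<rparr>"
proof -
  have "finite A" using assms(1,2) by (meson finite_SigmaI finite_subset)
  show ?thesis
  proof unfold_locales
    show "(u, v) \<in> parcs \<lparr>pverts = V, parcs = A\<rparr> \<longleftrightarrow> (v, u) \<notin> parcs \<lparr>pverts = V, parcs = A\<rparr>"
      if "u \<in> pverts \<lparr>pverts = V, parcs = A\<rparr>" "v \<in> pverts \<lparr>pverts = V, parcs = A\<rparr>" "u \<noteq> v" for u v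
      using assms(4)[of u v] that by simp
  qed (use assms(1-3) \<open>finite A\<close> in auto)
qed

lemma tournament_T5_7: "tournament T5_7"
  unfolding T5_7_def by (rule tournamentI) auto

lemma T5_12_eq_carousel: "T5_12 = carousel 2"
proof -
  have "{(v, (v + i) mod 5) | v i :: nat. v < 5 \<and> 1 \<le> i \<and> i \<le> 2}
      = {(i, (i + 1) mod 5) | i. i < 5} \<union> {(i, (i + 2) mod 5) | i. i < 5}" (is "?A = ?B")
  proof (intro equalityI subsetI)
    fix e assume "e \<in> ?A"
    then obtain v i where "e = (v, (v + i) mod 5)" "v < 5" "i = 1 \<or> i = 2"
      by force
    then show "e \<in> ?B" by (elim disjE) simp_all
  next
    fix e assume "e \<in> ?B"
    then obtain v i :: nat where "e = (v, (v + i) mod 5)" "v < 5" "1 \<le> i" "i \<le> 2"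
      by (elim UnE CollectE exE conjE) fastforce+
    then show "e \<in> ?A" by blast
  qed
  then show ?thesis by (simp add: T5_12_def carousel_def)
qed

lemma carousel_arc_iff:
  "(u, v) \<in> parcs (carousel m) \<longleftrightarrow>
     u < 2 * m + 1 \<and> v < 2 * m + 1 \<and> (u < v \<and> v \<le> u + m \<or> v < u \<and> u > v + m)"
proof
  assume "(u, v) \<in> parcs (carousel m)"
  then obtain i where i: "v = (u + i) mod (2 * m + 1)" "u < 2 * m + 1" "1 \<le> i" "i \<le> m"
    by (auto simp: carousel_def)
  show "u < 2 * m + 1 \<and> v < 2 * m + 1 \<and> (u < v \<and> v \<le> u + m \<or> v < u \<and> u > v + m)"
  proof (cases "u + i < 2 * m + 1")
    case False
    then have "v = u + i - (2 * m + 1)"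
      using i by (simp add: mod_if)
    then show ?thesis using i False by auto
  qed (use i in auto)
next
  assume *: "u < 2 * m + 1 \<and> v < 2 * m + 1 \<and> (u < v \<and> v \<le> u + m \<or> v < u \<and> u > v + m)"
  define i where "i = (if u < v then v - u else 2 * m + 1 + v - u)"
  have "u + i = v \<or> u + i = v + (2 * m + 1)" and i: "u < 2 * m + 1" "1 \<le> i" "i \<le> m"
    using * by (auto simp: i_def)
  then have "v = (u + i) mod (2 * m + 1)"
    using * by (elim disjE) (simp_all only: mod_add_self2 mod_less)
  with i show "(u, v) \<in> parcs (carousel m)"
    by (auto simp: carousel_def)
qed

lemma tournament_carousel: "tournament (carousel m)"
proof -
  have "tournament \<lparr>pverts = {0..<2 * m + 1}, parcs = parcs (carousel m)\<rparr>"
    by (rule tournamentI) (auto simp: carousel_arc_iff)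
  then show ?thesis by (simp add: carousel_def)
qed

lemma finite_tdensities:
  "finite {tdensity S T | T :: nat pair_pre_digraph. tournament T \<and> tsize T = n}"
proof (rule finite_subset)
  let ?N = "n choose tsize S"
  show "{tdensity S T | T :: nat pair_pre_digraph. tournament T \<and> tsize T = n}
      \<subseteq> (\<lambda>k. real k / real ?N) ` {..?N}"
  proof clarify
    fix T :: "nat pair_pre_digraph"
    assume T: "tournament T" "n = tsize T"
    then have fin: "finite (pverts T)"
      by (simp add: tournament_def pair_digraph_def pair_fin_digraph.pair_finite_verts)
    let ?A = "{X. X \<subseteq> pverts T \<and> card X = tsize S \<and> digraph_iso (with_proj S) (with_proj T \<restriction> X)}"
    let ?B = "{X. X \<subseteq> pverts T \<and> card X = tsize S}"
    have "card ?A \<le> card ?B" using fin by (intro card_mono) auto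
    moreover have "card ?B = tsize T choose tsize S" using fin by (rule n_subsets)
    ultimately show "tdensity S T \<in> (\<lambda>k. real k / real (tsize T choose tsize S)) ` {..tsize T choose tsize S}"
      by (auto simp: tdensity_def)
  qed
qed simp

lemma tdensities_nonempty:
  "{tdensity S T | T :: nat pair_pre_digraph. tournament T \<and> tsize T = n} \<noteq> {}"
proof -
  have "tournament \<lparr>pverts = {0..<n}, parcs = {(i, j). i < j \<and> j < n}\<rparr>"
    by (rule tournamentI) auto
  then show ?thesis by force
qed

end

theory Submission
  imports Defs "HOL-Real_Asymp.Real_Asymp" "HOL-Analysis.Convex"
begin

text \<open>
  Write $e(u, v) \in \{1, -1\}$ for the orientation of the pair $uv$, and average products of these signs
  over random 5-tuples $(a, b, c, x, y)$ of vertices. Let $D(v)$ be the average of $e(v, \cdot)$ and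
  $Q(a, b, c)$ the average of $e(a, x)\, e(b, x)\, e(c, x)$ over $x$. Comparing both sides on every
  tournament with five vertices gives, up to $O(1/n)$, inequalities of the form
  $p(S; T) \le r - (\text{sum of squares})$, where the squares involve $D^2$, $Q$ and the number of
  vertices that dominate, or are dominated by, a cyclic triple. On a locally transitive
  tournament, where no vertex dominates or is dominated by a cyclic triple, $p(S; T)$ differs from
  $r$ only by averages that vanish if $D = 0$; the carousel has both properties, so the bounds are attained by it.

  Conversely, in an extremal sequence $D$ tends to $0$ in mean and almost no cyclic triple
  dominates or is dominated by a vertex. A random set of $2m + 1$ vertices, with $m$ fixed, is then locally transitive and
  nearly regular with high probability. Listing such a tournament as $v$, the out-neighbours of $v$ in their
  transitive order, the in-neighbours of $v$ in theirs, every vertex beats an initial segment of its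
  successors, of length about $m$; so it differs from $R_{2m+1}$ in few arcs, and all subtournament
  densities agree with those of the carousel in the limit.
\<close>

section \<open>Averages over subsets of a fixed size\<close>

text \<open>Two obstacles shape the converse. A large T may still contain bad four-sets, so its
  vertices need not have a global carousel order; but in a sample of N = 2 m + 1 vertices the
  expected number of bad four-sets is (N choose 4) times a quantity that tends to 0. And a sample is
  never exactly regular: even if D = 0, random fluctuation makes the squared imbalances inside the
  sample sum to about N^2. A typical imbalance is then of order sqrt N, which costs about N^(3/2) of
  the N^2 arcs, an error of order 1 / sqrt m. This vanishes only as m grows, whereas the factor in
  front of the global deficit blows up with m; hence n tends to infinity first and m afterwards.
  Applied to a large carousel, whose deficit is 0, the same estimate shows that the carousel
  densities form Cauchy sequences. Carousels have odd order only; averaging over the n-subsets of a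
  large one gives the lower bound r on the maximum for every n >= 5.\<close>

definition subsets_of_size :: "nat \<Rightarrow> 'a set \<Rightarrow> 'a set set" where
  "subsets_of_size k V = {X. X \<subseteq> V \<and> card X = k}"

definition avg_subsets :: "nat \<Rightarrow> ('a set \<Rightarrow> real) \<Rightarrow> 'a set \<Rightarrow> real" where
  "avg_subsets k g V = (\<Sum>X\<in>subsets_of_size k V. g X) / real (card V choose k)"

lemma finite_subsets_of_size [simp]: "finite V \<Longrightarrow> finite (subsets_of_size k V)"
  by (rule finite_subset[of _ "Pow V"]) (auto simp: subsets_of_size_def)

lemma card_subsets_of_size: "finite V \<Longrightarrow> card (subsets_of_size k V) = card V choose k"
  by (simp add: subsets_of_size_def n_subsets)

lemma card_supersets_of_size:
  assumes "finite V" "X \<subseteq> V" "card X = k" "k \<le> N"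
  shows "card {Y \<in> subsets_of_size N V. X \<subseteq> Y} = (card V - k) choose (N - k)"
proof -
  have fX: "finite X" using assms finite_subset by blast
  have "bij_betw (\<lambda>Z. Z \<union> X) (subsets_of_size (N - k) (V - X)) {Y \<in> subsets_of_size N V. X \<subseteq> Y}"
  proof (rule bij_betwI[where g = "\<lambda>Y. Y - X"])
    show "(\<lambda>Z. Z \<union> X) \<in> subsets_of_size (N - k) (V - X) \<rightarrow> {Y \<in> subsets_of_size N V. X \<subseteq> Y}"
    proof
      fix Z assume "Z \<in> subsets_of_size (N - k) (V - X)"
      then have Z: "Z \<subseteq> V - X" "card Z = N - k" by (auto simp: subsets_of_size_def)
      then have "finite Z" using assms(1) finite_subset by blast
      then have "card (Z \<union> X) = N - k + k"
        using Z fX assms(3) by (subst card_Un_disjoint) auto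
      then show "Z \<union> X \<in> {Y \<in> subsets_of_size N V. X \<subseteq> Y}"
        using Z assms by (auto simp: subsets_of_size_def)
    qed
    show "(\<lambda>Y. Y - X) \<in> {Y \<in> subsets_of_size N V. X \<subseteq> Y} \<rightarrow> subsets_of_size (N - k) (V - X)"
      using fX assms(3) by (auto simp: subsets_of_size_def card_Diff_subset)
  qed (auto simp: subsets_of_size_def)
  then have "card {Y \<in> subsets_of_size N V. X \<subseteq> Y} = card (subsets_of_size (N - k) (V - X))"
    by (rule bij_betw_same_card[symmetric])
  also have "\<dots> = (card V - k) choose (N - k)"
    using assms fX by (simp add: card_subsets_of_size card_Diff_subset)
  finally show ?thesis .
qed

text \<open>A random k-subset of a random N-subset is a uniform k-subset, because every k-set lies
  in the same number of N-sets. All later sampling arguments rest on this.\<close>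

lemma avg_subsets_chain:
  assumes "finite V" "k \<le> N" "N \<le> card V"
  shows "avg_subsets k g V = avg_subsets N (avg_subsets k g) V"
proof -
  let ?n = "card V"
  have "(\<Sum>Y\<in>subsets_of_size N V. \<Sum>X\<in>subsets_of_size k Y. g X)
      = (\<Sum>Y\<in>subsets_of_size N V. \<Sum>X | X \<in> subsets_of_size k V \<and> X \<subseteq> Y. g X)"
    by (intro sum.cong refl) (auto simp: subsets_of_size_def)
  also have "\<dots> = (\<Sum>X\<in>subsets_of_size k V. \<Sum>Y | Y \<in> subsets_of_size N V \<and> X \<subseteq> Y. g X)"
    using assms(1) by (intro sum.swap_restrict) auto
  also have "\<dots> = (\<Sum>X\<in>subsets_of_size k V. real ((?n - k) choose (N - k)) * g X)"
  proof (intro sum.cong refl)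
    fix X assume "X \<in> subsets_of_size k V"
    then have "card {Y \<in> subsets_of_size N V. X \<subseteq> Y} = (?n - k) choose (N - k)"
      using assms by (intro card_supersets_of_size) (auto simp: subsets_of_size_def)
    then show "(\<Sum>Y | Y \<in> subsets_of_size N V \<and> X \<subseteq> Y. g X) = real ((?n - k) choose (N - k)) * g X"
      by simp
  qed
  finally have *: "(\<Sum>Y\<in>subsets_of_size N V. \<Sum>X\<in>subsets_of_size k Y. g X)
      = real ((?n - k) choose (N - k)) * (\<Sum>X\<in>subsets_of_size k V. g X)"
    by (simp add: sum_distrib_left)
  have "avg_subsets N (avg_subsets k g) V
      = (\<Sum>Y\<in>subsets_of_size N V. (\<Sum>X\<in>subsets_of_size k Y. g X) / real (N choose k)) / real (?n choose N)"
    unfolding avg_subsets_def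
    by (intro arg_cong2[where f = "(/)"] sum.cong refl) (auto simp: subsets_of_size_def)
  also have "\<dots> = (\<Sum>Y\<in>subsets_of_size N V. \<Sum>X\<in>subsets_of_size k Y. g X)
      / (real (?n choose N) * real (N choose k))"
    by (simp add: sum_divide_distrib[symmetric])
  also have "real (?n choose N) * real (N choose k) = real (?n choose k) * real ((?n - k) choose (N - k))"
    using choose_mult[OF assms(2,3)] by (metis of_nat_mult)
  also have "(\<Sum>Y\<in>subsets_of_size N V. \<Sum>X\<in>subsets_of_size k Y. g X) / \<dots> = avg_subsets k g V"
    using assms unfolding * avg_subsets_def by (simp add: field_simps)
  finally show ?thesis by simp
qed

lemma avg_subsets_mono:
  assumes "\<And>X. X \<subseteq> V \<Longrightarrow> card X = k \<Longrightarrow> g X \<le> h X"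
  shows "avg_subsets k g V \<le> avg_subsets k h V"
  unfolding avg_subsets_def
  by (intro divide_right_mono sum_mono) (auto simp: subsets_of_size_def assms)

lemma avg_subsets_cong:
  assumes "\<And>X. X \<subseteq> V \<Longrightarrow> card X = k \<Longrightarrow> g X = h X"
  shows "avg_subsets k g V = avg_subsets k h V"
  using assms by (intro antisym avg_subsets_mono) auto

lemma avg_subsets_add: "avg_subsets k (\<lambda>X. g X + h X) V = avg_subsets k g V + avg_subsets k h V"
  by (simp add: avg_subsets_def sum.distrib add_divide_distrib)

lemma avg_subsets_cmult: "avg_subsets k (\<lambda>X. c * g X) V = c * avg_subsets k g V"
  by (simp add: avg_subsets_def sum_distrib_left)

lemma avg_subsets_diff: "avg_subsets k (\<lambda>X. g X - h X) V = avg_subsets k g V - avg_subsets k h V"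
  by (simp add: avg_subsets_def sum_subtractf diff_divide_distrib)

lemma avg_subsets_const: "finite V \<Longrightarrow> k \<le> card V \<Longrightarrow> avg_subsets k (\<lambda>X. c) V = c"
  by (simp add: avg_subsets_def card_subsets_of_size)

lemma avg_subsets_abs: "\<bar>avg_subsets k g V\<bar> \<le> avg_subsets k (\<lambda>X. \<bar>g X\<bar>) V"
  unfolding avg_subsets_def by (simp add: divide_right_mono)

lemma avg_subsets_le_Max:
  assumes "finite V" "k \<le> card V"
  shows "\<exists>X. X \<subseteq> V \<and> card X = k \<and> avg_subsets k g V \<le> g X"
proof (rule ccontr)
  assume "\<nexists>X. X \<subseteq> V \<and> card X = k \<and> avg_subsets k g V \<le> g X"
  then have less: "g X < avg_subsets k g V" if "X \<in> subsets_of_size k V" for X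
    using that by (auto simp: subsets_of_size_def not_le)
  have pos: "0 < card V choose k" using assms(2) by simp
  then have ne: "subsets_of_size k V \<noteq> {}"
    using card_subsets_of_size[OF assms(1), of k] by auto
  have "(\<Sum>X\<in>subsets_of_size k V. g X) < (\<Sum>X\<in>subsets_of_size k V. avg_subsets k g V)"
    using less ne assms(1) by (intro sum_strict_mono) auto
  also have "\<dots> = (\<Sum>X\<in>subsets_of_size k V. g X)"
    using pos assms(1) by (simp add: card_subsets_of_size avg_subsets_def)
  finally show False by simp
qed

section \<open>Sums over lists of distinct elements\<close>

definition distinct_lists :: "nat \<Rightarrow> 'a set \<Rightarrow> 'a list set" where
  "distinct_lists k V = {xs. length xs = k \<and> distinct xs \<and> set xs \<subseteq> V}"

lemma finite_distinct_lists [simp]: "finite V \<Longrightarrow> finite (distinct_lists k V)"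
  by (rule finite_subset[OF _ finite_lists_length_eq[of V k]]) (auto simp: distinct_lists_def)

lemma distinct_lists_0 [simp]: "distinct_lists 0 V = {[]}"
  by (auto simp: distinct_lists_def)

lemma distinct_lists_Suc:
  "distinct_lists (Suc k) V = (\<Union>x\<in>V. (#) x ` distinct_lists k (V - {x}))"
  by (auto simp: distinct_lists_def length_Suc_conv image_iff)

lemma sum_distinct_lists_Suc:
  assumes "finite V"
  shows "(\<Sum>xs\<in>distinct_lists (Suc k) V. h xs) = (\<Sum>x\<in>V. \<Sum>xs\<in>distinct_lists k (V - {x}). h (x # xs))"
proof -
  have "(\<Sum>xs\<in>distinct_lists (Suc k) V. h xs)
      = (\<Sum>x\<in>V. \<Sum>xs\<in>(#) x ` distinct_lists k (V - {x}). h xs)"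
    unfolding distinct_lists_Suc using assms by (subst sum.UNION_disjoint) auto
  also have "\<dots> = (\<Sum>x\<in>V. \<Sum>xs\<in>distinct_lists k (V - {x}). h (x # xs))"
    by (simp add: sum.reindex)
  finally show ?thesis .
qed

lemma card_distinct_lists:
  assumes "finite V" "k \<le> card V"
  shows "card (distinct_lists k V) = fact k * (card V choose k)"
  using assms
proof (induction k arbitrary: V)
  case (Suc k)
  then obtain n where n: "card V = Suc n" by (cases "card V") auto
  have "card (distinct_lists (Suc k) V) = (\<Sum>x\<in>V. card (distinct_lists k (V - {x})))"
    using sum_distinct_lists_Suc[OF Suc.prems(1), of "\<lambda>_. 1::nat" k] by simp
  also have "\<dots> = (\<Sum>x\<in>V. fact k * (n choose k))"
  proof (intro sum.cong refl)
    fix x assume "x \<in> V"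
    then have "card (V - {x}) = n" using n Suc.prems(1) by simp
    then show "card (distinct_lists k (V - {x})) = fact k * (n choose k)"
      using Suc n by (subst Suc.IH) auto
  qed
  also have "\<dots> = fact k * (Suc n * (n choose k))" by (simp add: n algebra_simps)
  also have "Suc n * (n choose k) = (Suc n choose Suc k) * Suc k" by (rule Suc_times_binomial_eq)
  finally show ?case using n by (simp add: algebra_simps)
qed simp

text \<open>An injective list determines its underlying set. This is how inequalities checked on
  single five-sets become inequalities for the whole tournament.\<close>

lemma sum_distinct_lists_by_set:
  assumes "finite V"
  shows "(\<Sum>xs\<in>distinct_lists k V. h xs) = (\<Sum>X\<in>subsets_of_size k V. \<Sum>xs\<in>distinct_lists k X. h xs)"
proof -
  have "(\<Sum>X\<in>subsets_of_size k V. \<Sum>xs\<in>distinct_lists k X. h xs)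
      = (\<Sum>X\<in>subsets_of_size k V. \<Sum>xs | xs \<in> distinct_lists k V \<and> set xs = X. h xs)"
  proof (intro sum.cong refl)
    fix X assume "X \<in> subsets_of_size k V"
    then have X: "X \<subseteq> V" "card X = k" by (auto simp: subsets_of_size_def)
    then have "finite X" using assms finite_subset by blast
    then have "set xs = X" if "length xs = k" "distinct xs" "set xs \<subseteq> X" for xs
      using that X by (metis card_subset_eq distinct_card)
    then show "distinct_lists k X = {xs \<in> distinct_lists k V. set xs = X}"
      using X by (auto simp: distinct_lists_def)
  qed
  also have "\<dots> = (\<Sum>xs\<in>distinct_lists k V. h xs)"
    using finite_distinct_lists[OF assms] finite_subsets_of_size[OF assms]
    by (intro sum.group) (auto simp: distinct_lists_def subsets_of_size_def distinct_card)
  finally show ?thesis by simp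
qed

lemma sum_lists_Suc:
  assumes "finite V"
  shows "(\<Sum>xs | set xs \<subseteq> V \<and> length xs = Suc k. h xs)
    = (\<Sum>x\<in>V. \<Sum>xs | set xs \<subseteq> V \<and> length xs = k. h (x # xs))"
proof -
  have "{xs. set xs \<subseteq> V \<and> length xs = Suc k} = (\<Union>x\<in>V. (#) x ` {xs. set xs \<subseteq> V \<and> length xs = k})"
    by (auto simp: length_Suc_conv image_iff)
  then have "(\<Sum>xs | set xs \<subseteq> V \<and> length xs = Suc k. h xs)
      = (\<Sum>x\<in>V. \<Sum>xs\<in>(#) x ` {xs. set xs \<subseteq> V \<and> length xs = k}. h xs)"
    using assms finite_lists_length_eq[OF assms] by (simp, subst sum.UNION_disjoint) auto
  also have "\<dots> = (\<Sum>x\<in>V. \<Sum>xs | set xs \<subseteq> V \<and> length xs = k. h (x # xs))"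
    by (simp add: sum.reindex)
  finally show ?thesis .
qed

fun app5 :: "('a \<Rightarrow> 'a \<Rightarrow> 'a \<Rightarrow> 'a \<Rightarrow> 'a \<Rightarrow> 'b) \<Rightarrow> 'a list \<Rightarrow> 'b" where
  "app5 f [a, b, c, x, y] = f a b c x y" |
  "app5 f _ = undefined"

text \<open>Free sums over five-tuples factor into powers and squares, whereas five-sets only see
  injective tuples. The two sums differ by at most B for each tuple with a repeated entry, and there
  are O(n^4) of those.\<close>

lemma sum_distinct_lists_5:
  fixes f :: "'a \<Rightarrow> 'a \<Rightarrow> 'a \<Rightarrow> 'a \<Rightarrow> 'a \<Rightarrow> int"
  assumes V: "finite V" and B: "\<And>a b c x y. \<bar>f a b c x y\<bar> \<le> B"
  shows "\<bar>(\<Sum>a\<in>V. \<Sum>b\<in>V. \<Sum>c\<in>V. \<Sum>x\<in>V. \<Sum>y\<in>V. f a b c x y) - (\<Sum>xs\<in>distinct_lists 5 V. app5 f xs)\<bar>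
    \<le> B * (int (card V) ^ 5 - int (card (distinct_lists 5 V)))"
proof -
  let ?L = "{xs. set xs \<subseteq> V \<and> length xs = 5}"
  have fin: "finite ?L" using V by (rule finite_lists_length_eq)
  have sub: "distinct_lists 5 V \<subseteq> ?L" by (auto simp: distinct_lists_def)
  have five: "5 = Suc (Suc (Suc (Suc (Suc 0))))" by simp
  have nil: "{xs. xs = [] \<and> set xs \<subseteq> V} = {[]}" by auto
  have "(\<Sum>a\<in>V. \<Sum>b\<in>V. \<Sum>c\<in>V. \<Sum>x\<in>V. \<Sum>y\<in>V. f a b c x y) = (\<Sum>xs\<in>?L. app5 f xs)"
    unfolding five using V by (simp add: sum_lists_Suc nil)
  also have "\<dots> = (\<Sum>xs\<in>?L - distinct_lists 5 V. app5 f xs) + (\<Sum>xs\<in>distinct_lists 5 V. app5 f xs)"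
    by (rule sum.subset_diff[OF sub fin])
  finally have "\<bar>(\<Sum>a\<in>V. \<Sum>b\<in>V. \<Sum>c\<in>V. \<Sum>x\<in>V. \<Sum>y\<in>V. f a b c x y) - (\<Sum>xs\<in>distinct_lists 5 V. app5 f xs)\<bar>
      = \<bar>\<Sum>xs\<in>?L - distinct_lists 5 V. app5 f xs\<bar>" by simp
  also have "\<dots> \<le> (\<Sum>xs\<in>?L - distinct_lists 5 V. \<bar>app5 f xs\<bar>)" by (rule sum_abs)
  also have "\<dots> \<le> (\<Sum>xs\<in>?L - distinct_lists 5 V. B)"
  proof (rule sum_mono)
    fix xs assume "xs \<in> ?L - distinct_lists 5 V"
    then have "length xs = 5" by simp
    then obtain a b c x y where "xs = [a, b, c, x, y]"
      unfolding five by (auto simp: length_Suc_conv)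
    then show "\<bar>app5 f xs\<bar> \<le> B" using B by simp
  qed
  also have "\<dots> = B * int (card (?L - distinct_lists 5 V))" by simp
  also have "int (card (?L - distinct_lists 5 V)) = int (card V) ^ 5 - int (card (distinct_lists 5 V))"
    using V sub fin card_mono[OF fin sub]
    by (simp add: card_Diff_subset card_lists_length_eq of_nat_diff)
  finally show ?thesis .
qed

section \<open>Induced copies\<close>

text \<open>Isomorphism as a vertex map alone, phrased inside T so that no subtournament has to be
  formed.\<close>

definition induces :: "'a pair_pre_digraph \<Rightarrow> 'b pair_pre_digraph \<Rightarrow> 'b set \<Rightarrow> bool" where
  "induces S T X \<longleftrightarrow> (\<exists>f. bij_betw f (pverts S) X \<and>
     (\<forall>u\<in>pverts S. \<forall>v\<in>pverts S. (u, v) \<in> parcs S \<longleftrightarrow> (f u, f v) \<in> parcs T))"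

lemma tournament_finite: "tournament T \<Longrightarrow> finite (pverts T)"
  by (simp add: tournament_def pair_digraph_def pair_fin_digraph.pair_finite_verts)

lemma tournament_arc_in:
  assumes "tournament T" "(u, v) \<in> parcs T"
  shows "u \<in> pverts T" "v \<in> pverts T" "u \<noteq> v" "(v, u) \<notin> parcs T"
proof -
  interpret tournament T by fact
  show *: "u \<in> pverts T" "v \<in> pverts T" "u \<noteq> v" 
    using in_arcsD1[OF assms(2)] in_arcsD2[OF assms(2)] no_loops[OF assms(2)] by auto
  then show "(v, u) \<notin> parcs T" using exactly_one_arc assms(2) by blast
qed

lemma tournament_total:
  "tournament T \<Longrightarrow> u \<in> pverts T \<Longrightarrow> v \<in> pverts T \<Longrightarrow> u \<noteq> v \<Longrightarrow> (u, v) \<in> parcs T \<or> (v, u) \<in> parcs T"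
  using tournament.exactly_one_arc by metis

text \<open>An isomorphism in the sense of \<open>digraph_iso\<close> also carries maps for arcs,
  tails and heads. Equality of the two digraphs forces tail and head to be \<open>fst\<close> and
  \<open>snd\<close>, after which the arc map is determined by the vertex map.\<close>

lemma digraph_iso_restrict_iff:
  assumes S: "tournament S" and X: "X \<subseteq> pverts T"
  shows "digraph_iso (with_proj S) (with_proj T \<restriction> X) \<longleftrightarrow> induces S T X"
proof
  assume "digraph_iso (with_proj S) (with_proj T \<restriction> X)"
  then obtain h where h: "pre_digraph.digraph_isomorphism (with_proj S) h"
    and eq: "with_proj T \<restriction> X = app_iso h (with_proj S)"
    by (auto simp: digraph_iso_def)
  let ?f = "iso_verts h"
  have inj: "inj_on ?f (pverts S)"
    using h by (simp add: pre_digraph.digraph_isomorphism_def)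
  have img: "?f ` pverts S = X"
    using arg_cong[OF eq, of verts] by (simp add: induce_subgraph_def)
  have arcs: "iso_arcs h ` parcs S = {e \<in> parcs T. fst e \<in> X \<and> snd e \<in> X}"
    using arg_cong[OF eq, of arcs] by (simp add: induce_subgraph_def)
  have tl: "iso_tail h = fst" and hd: "iso_head h = snd"
    using arg_cong[OF eq, of tail] arg_cong[OF eq, of head] by (simp_all add: induce_subgraph_def)
  have val: "iso_arcs h (u, v) = (?f u, ?f v)" if "(u, v) \<in> parcs S" for u v
    using h that unfolding pre_digraph.digraph_isomorphism_def tl hd
    by (simp add: prod_eq_iff) (metis fst_conv snd_conv)
  have "(u, v) \<in> parcs S \<longleftrightarrow> (?f u, ?f v) \<in> parcs T" if uv: "u \<in> pverts S" "v \<in> pverts S" for u v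
  proof
    assume "(u, v) \<in> parcs S"
    then show "(?f u, ?f v) \<in> parcs T" using val arcs by force
  next
    assume "(?f u, ?f v) \<in> parcs T"
    then have "(?f u, ?f v) \<in> iso_arcs h ` parcs S" using arcs img uv by auto
    then obtain u' v' where *: "(u', v') \<in> parcs S" "(?f u, ?f v) = iso_arcs h (u', v')" by auto
    then have "?f u' = ?f u" "?f v' = ?f v" using val by auto
    then have "u' = u" "v' = v"
      using inj uv tournament_arc_in[OF S *(1)] by (auto dest: inj_onD)
    then show "(u, v) \<in> parcs S" using * by simp
  qed
  then show "induces S T X" using inj img unfolding induces_def bij_betw_def by blast
next
  assume "induces S T X"
  then obtain f where f: "bij_betw f (pverts S) X"
    and arc: "\<And>u v. u \<in> pverts S \<Longrightarrow> v \<in> pverts S \<Longrightarrow> (u, v) \<in> parcs S \<longleftrightarrow> (f u, f v) \<in> parcs T"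
    by (auto simp: induces_def)
  let ?h = "\<lparr>iso_verts = f, iso_arcs = (\<lambda>(u, v). (f u, f v)), iso_head = snd, iso_tail = fst\<rparr>"
  interpret S: tournament S by fact
  have inj: "inj_on f (pverts S)" using f by (simp add: bij_betw_def)
  have "pre_digraph.digraph_isomorphism (with_proj S) ?h"
    unfolding pre_digraph.digraph_isomorphism_def
    using inj S.wf_digraph_axioms tournament_arc_in[OF S]
    by (auto simp: inj_on_def)
  moreover have "with_proj T \<restriction> X = app_iso ?h (with_proj S)"
  proof -
    have "{e \<in> parcs T. fst e \<in> X \<and> snd e \<in> X} = (\<lambda>(u, v). (f u, f v)) ` parcs S" (is "?A = ?B")
    proof (intro equalityI subsetI)
      fix e assume e: "e \<in> ?A"
      then obtain u v where "u \<in> pverts S" "v \<in> pverts S" "fst e = f u" "snd e = f v"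
        using f by (auto simp: bij_betw_def)
      moreover have "e = (f u, f v)" using calculation by (simp add: prod_eq_iff)
      ultimately have "(u, v) \<in> parcs S" "e = (\<lambda>(u, v). (f u, f v)) (u, v)" using arc[of u v] e by simp_all
      then show "e \<in> ?B" by (rule rev_image_eqI)
    next
      fix e assume "e \<in> ?B"
      then obtain u v where uv: "(u, v) \<in> parcs S" "e = (f u, f v)" by auto
      then show "e \<in> ?A" using arc[of u v] tournament_arc_in[OF S uv(1)] f by (auto simp: bij_betw_def)
    qed
    then show ?thesis
      using f by (simp add: induce_subgraph_def app_iso_def bij_betw_def)
  qed
  ultimately show "digraph_iso (with_proj S) (with_proj T \<restriction> X)"
    unfolding digraph_iso_def by blast
qed

lemma tdensity_eq_avg_subsets:
  assumes "tournament S" "finite (pverts T)"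
  shows "tdensity S T = avg_subsets (tsize S) (\<lambda>X. of_bool (induces S T X)) (pverts T)"
proof -
  have "{X. X \<subseteq> pverts T \<and> card X = tsize S \<and> digraph_iso (with_proj S) (with_proj T \<restriction> X)}
    = subsets_of_size (tsize S) (pverts T) \<inter> {X. induces S T X}"
    using digraph_iso_restrict_iff[OF assms(1)] by (auto simp: subsets_of_size_def)
  then show ?thesis using assms(2)
    by (simp add: tdensity_def avg_subsets_def n_subsets of_bool_def sum.If_cases)
qed

section \<open>Sums over all orders of a small set, collapsed by the symmetries of the
  summand\<close>

lemma sum_distinct_lists_2:
  fixes h :: "'a list \<Rightarrow> int"
  assumes "x \<noteq> y" "\<And>x y. h [y, x] = h [x, y]"
  shows "(\<Sum>xs\<in>distinct_lists (Suc (Suc 0)) {x, y}. h xs) = 2 * h [x, y]"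
  using assms(1) by (simp add: sum_distinct_lists_Suc insert_Diff_if assms(2)[of y x])

lemma sum_distinct_lists_3:
  fixes h :: "'a list \<Rightarrow> int"
  assumes "distinct [p, q, r]" "\<And>a x y. h [a, y, x] = h [a, x, y]"
  shows "(\<Sum>xs\<in>distinct_lists (Suc (Suc (Suc 0))) {p, q, r}. h xs) = 2 * (h [p, q, r] + h [q, p, r] + h [r, p, q])"
proof -
  have ne: "p \<noteq> q" "p \<noteq> r" "q \<noteq> p" "q \<noteq> r" "r \<noteq> p" "r \<noteq> q"
    using assms(1) by auto
  show ?thesis
    unfolding sum_distinct_lists_Suc[of "{p, q, r}", simplified]
    by (simp add: ne insert_Diff_if sum_distinct_lists_2 assms(2))
qed

lemma sum_distinct_lists_4:
  fixes h :: "'a list \<Rightarrow> int"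
  assumes "distinct [p, q, r, s]" "\<And>a b x y. h [a, b, y, x] = h [a, b, x, y]" "\<And>a b x y. h [b, a, x, y] = h [a, b, x, y]"
  shows "(\<Sum>xs\<in>distinct_lists (Suc (Suc (Suc (Suc 0)))) {p, q, r, s}. h xs) =
    4 * (h [p, q, r, s] + h [p, r, q, s] + h [p, s, q, r] + h [q, r, p, s] + h [q, s, p, r] + h [r, s, p, q])"
proof -
  have ne: "p \<noteq> q" "p \<noteq> r" "p \<noteq> s" "q \<noteq> p" "q \<noteq> r" "q \<noteq> s" "r \<noteq> p" "r \<noteq> q" "r \<noteq> s" "s \<noteq> p" "s \<noteq> q" "s \<noteq> r"
    using assms(1) by auto
  show ?thesis
    unfolding sum_distinct_lists_Suc[of "{p, q, r, s}", simplified]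
    by (simp add: ne insert_Diff_if sum_distinct_lists_3 assms(2) assms(3)[of q p] assms(3)[of r p] assms(3)[of s p]
   assms(3)[of r q] assms(3)[of s q] assms(3)[of s r])
qed

text \<open>A summand symmetric in its first three and in its last two entries takes each value 3! *
  2! = 12 times; one term remains for each of the 10 splits into a triple and a pair.\<close>

lemma sum_distinct_lists_triple_pair:
  fixes h :: "'a list \<Rightarrow> int"
  assumes "distinct [p, q, r, s, t]"
    and "\<And>a b c x y. h [b, a, c, x, y] = h [a, b, c, x, y]" "\<And>a b c x y. h [a, c, b, x, y] = h [a, b, c, x, y]"
      "\<And>a b c x y. h [a, b, c, y, x] = h [a, b, c, x, y]"
  shows "(\<Sum>xs\<in>distinct_lists 5 {p, q, r, s, t}. h xs) =
    12 * (h [p, q, r, s, t] + h [p, q, s, r, t] + h [p, q, t, r, s] + h [p, r, s, q, t] + h [p, r, t, q, s]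
      + h [p, s, t, q, r] + h [q, r, s, p, t] + h [q, r, t, p, s] + h [q, s, t, p, r] + h [r, s, t, p, q])"
proof -
  have five: "5 = Suc (Suc (Suc (Suc (Suc 0))))" by simp
  \<comment> \<open>The swaps are instantiated so that each rewrites towards the order p, q, r, s,
    t; this gives every triple one normal form.\<close>
  have b: "h [q, p, c, x, y] = h [p, q, c, x, y]" "h [r, p, c, x, y] = h [p, r, c, x, y]"
    "h [s, p, c, x, y] = h [p, s, c, x, y]" "h [t, p, c, x, y] = h [p, t, c, x, y]"
    "h [r, q, c, x, y] = h [q, r, c, x, y]" "h [s, q, c, x, y] = h [q, s, c, x, y]" "h [t, q, c, x, y] = h [q, t, c, x, y]"
    "h [s, r, c, x, y] = h [r, s, c, x, y]" "h [t, r, c, x, y] = h [r, t, c, x, y]" "h [t, s, c, x, y] = h [s, t, c, x, y]" for c x y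
    by (rule assms(2))+
  have c: "h [z, q, p, x, y] = h [z, p, q, x, y]" "h [z, r, p, x, y] = h [z, p, r, x, y]"
    "h [z, s, p, x, y] = h [z, p, s, x, y]" "h [z, t, p, x, y] = h [z, p, t, x, y]"
    "h [z, r, q, x, y] = h [z, q, r, x, y]" "h [z, s, q, x, y] = h [z, q, s, x, y]" "h [z, t, q, x, y] = h [z, q, t, x, y]"
    "h [z, s, r, x, y] = h [z, r, s, x, y]" "h [z, t, r, x, y] = h [z, r, t, x, y]" "h [z, t, s, x, y] = h [z, s, t, x, y]" for z x y
    by (rule assms(3))+
  have ne: "p \<noteq> q" "p \<noteq> r" "p \<noteq> s" "p \<noteq> t" "q \<noteq> p" "q \<noteq> r" "q \<noteq> s" "q \<noteq> t" "r \<noteq> p" "r \<noteq> q" "r \<noteq> s" "r \<noteq> t" "s \<noteq> p" "s \<noteq> q" "s \<noteq> r" "s \<noteq> t" "t \<noteq> p" "t \<noteq> q" "t \<noteq> r" "t \<noteq> s"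
    using assms(1) by auto
  show ?thesis
    unfolding five sum_distinct_lists_Suc[of "{p, q, r, s, t}", simplified]
    by (simp add: ne insert_Diff_if sum_distinct_lists_4 assms(3,4) b c)
qed

text \<open>Symmetry in the last three entries gives the factor 3! = 6; what remains is the choice
  of an ordered pair, in 5 * 4 = 20 ways.\<close>

lemma sum_distinct_lists_2_triple:
  fixes h :: "'a list \<Rightarrow> int"
  assumes "distinct [p, q, r, s, t]"
    and sym: "\<And>a y b c x. h [a, y, c, b, x] = h [a, y, b, c, x]" "\<And>a y b c x. h [a, y, b, x, c] = h [a, y, b, c, x]"
  shows "(\<Sum>xs\<in>distinct_lists 5 {p, q, r, s, t}. h xs) =
    6 * (h [p, q, r, s, t] + h [p, r, q, s, t] + h [p, s, q, r, t] + h [p, t, q, r, s]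
      + h [q, p, r, s, t] + h [q, r, p, s, t] + h [q, s, p, r, t] + h [q, t, p, r, s]
      + h [r, p, q, s, t] + h [r, q, p, s, t] + h [r, s, p, q, t] + h [r, t, p, q, s]
      + h [s, p, q, r, t] + h [s, q, p, r, t] + h [s, r, p, q, t] + h [s, t, p, q, r]
      + h [t, p, q, r, s] + h [t, q, p, r, s] + h [t, r, p, q, s] + h [t, s, p, q, r])"
proof -
  have five: "5 = Suc (Suc (Suc (Suc (Suc 0))))" by simp
  have 3: "(\<Sum>xs\<in>distinct_lists (Suc (Suc (Suc 0))) {u, v, w}. h (a # y # xs)) = 6 * h [a, y, u, v, w]"
    if "distinct [u, v, w]" for a y u v w
    using that sym(1)[of a y v u w] sym(1)[of a y w u v] sym(2)[of a y u w v] 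
    by (simp add: sum_distinct_lists_3[of u v w "\<lambda>xs. h (a # y # xs)"] sym(2))
  have 4: "(\<Sum>xs\<in>distinct_lists (Suc (Suc (Suc (Suc 0)))) {u, v, w, z}. h (a # xs)) =
    6 * (h [a, u, v, w, z] + h [a, v, u, w, z] + h [a, w, u, v, z] + h [a, z, u, v, w])"
    if "distinct [u, v, w, z]" for a u v w z
  proof -
    have ne: "u \<noteq> v" "u \<noteq> w" "u \<noteq> z" "v \<noteq> u" "v \<noteq> w" "v \<noteq> z" "w \<noteq> u" "w \<noteq> v" "w \<noteq> z" "z \<noteq> u" "z \<noteq> v" "z \<noteq> w"
      using that by auto
    then show ?thesis
      unfolding sum_distinct_lists_Suc[of "{u, v, w, z}", simplified]
      by (simp add: ne insert_Diff_if 3)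
  qed
  have ne: "p \<noteq> q" "p \<noteq> r" "p \<noteq> s" "p \<noteq> t" "q \<noteq> p" "q \<noteq> r" "q \<noteq> s" "q \<noteq> t" "r \<noteq> p" "r \<noteq> q" "r \<noteq> s" "r \<noteq> t" "s \<noteq> p" "s \<noteq> q" "s \<noteq> r" "s \<noteq> t" "t \<noteq> p" "t \<noteq> q" "t \<noteq> r" "t \<noteq> s"
    using assms(1) by auto
  show ?thesis
    unfolding five sum_distinct_lists_Suc[of "{p, q, r, s, t}", simplified]
    by (simp add: ne insert_Diff_if 4)
qed

section \<open>Pointwise inequalities on five vertices\<close>

definition cyc :: "('a \<Rightarrow> 'a \<Rightarrow> int) \<Rightarrow> 'a \<Rightarrow> 'a \<Rightarrow> 'a \<Rightarrow> bool" where
  "cyc e a b c \<longleftrightarrow> e a b \<noteq> 0 \<and> e a b = e b c \<and> e b c = e c a"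

definition beats :: "('a \<Rightarrow> 'a \<Rightarrow> int) \<Rightarrow> 'a \<Rightarrow> 'a \<Rightarrow> 'a \<Rightarrow> 'a \<Rightarrow> int" where
  "beats e a b c x = of_bool (e x a = 1 \<and> e x b = 1 \<and> e x c = 1)"

definition loses :: "('a \<Rightarrow> 'a \<Rightarrow> int) \<Rightarrow> 'a \<Rightarrow> 'a \<Rightarrow> 'a \<Rightarrow> 'a \<Rightarrow> int" where
  "loses e a b c x = of_bool (e x a = -1 \<and> e x b = -1 \<and> e x c = -1)"

definition prod3 :: "('a \<Rightarrow> 'a \<Rightarrow> int) \<Rightarrow> 'a \<Rightarrow> 'a \<Rightarrow> 'a \<Rightarrow> 'a \<Rightarrow> int" where
  "prod3 e a b c x = e a x * e b x * e c x"

text \<open>For antisymmetric signs and x outside {a, b, c} this is twice the majority sign among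
  \<open>e x a\<close>, \<open>e x b\<close>, \<open>e x c\<close>; at a vertex of a cyclic triple
  it is 0.\<close>

definition imb3 :: "('a \<Rightarrow> 'a \<Rightarrow> int) \<Rightarrow> 'a \<Rightarrow> 'a \<Rightarrow> 'a \<Rightarrow> 'a \<Rightarrow> int" where
  "imb3 e a b c x = prod3 e a b c x - (e a x + e b x + e c x)"

definition star4 :: "('a \<Rightarrow> 'a \<Rightarrow> int) \<Rightarrow> 'a \<Rightarrow> 'a \<Rightarrow> 'a \<Rightarrow> 'a \<Rightarrow> 'a \<Rightarrow> int" where
  "star4 e a b c x y = e a b * e a c * e a x * e a y"

definition star_path :: "('a \<Rightarrow> 'a \<Rightarrow> int) \<Rightarrow> 'a \<Rightarrow> 'a \<Rightarrow> 'a \<Rightarrow> 'a \<Rightarrow> 'a \<Rightarrow> int" where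
  "star_path e a b c x y = star4 e a b c x y * (e c x * e c y + e x c * e x y + e y c * e y x)"

text \<open>The coefficients below are those of a flag algebra certificate, found by linear programming. Summed
  over all orders of five vertices, \<open>5 - slack7 - 15 star4\<close> is 1920 times an indicator that
  covers the copies of $T_5^7$, and \<open>2 - slack12 - 5 star4\<close> is nonnegative and equal to 3840 on
  $T_5^{12}$. Summed over all vertices \<open>x\<close> and \<open>y\<close>, both slacks turn into squares and products
  of nonnegative numbers.

  On a locally transitive five-set the product of \<open>prod3\<close> at \<open>x\<close> and \<open>y\<close> has the same sum as
  \<open>star_path\<close>. There and in \<open>star4\<close> the vertex \<open>b\<close> only meets \<open>a\<close>, so that both vanish on
  regular tournaments.\<close>

definition slack7 :: "('a \<Rightarrow> 'a \<Rightarrow> int) \<Rightarrow> 'a \<Rightarrow> 'a \<Rightarrow> 'a \<Rightarrow> 'a \<Rightarrow> 'a \<Rightarrow> int" where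
  "slack7 e a b c x y = 10 * (prod3 e a b c x * prod3 e a b c y) +
     (if cyc e a b c then 160 * (beats e a b c x * beats e a b c y + loses e a b c x * loses e a b c y) else 0)"

definition slack12 :: "('a \<Rightarrow> 'a \<Rightarrow> int) \<Rightarrow> 'a \<Rightarrow> 'a \<Rightarrow> 'a \<Rightarrow> 'a \<Rightarrow> 'a \<Rightarrow> int" where
  "slack12 e a b c x y = 5 * (prod3 e a b c x * prod3 e a b c y) +
     (if cyc e a b c then 15 * (imb3 e a b c x * imb3 e a b c y)
        + 80 * (beats e a b c x * loses e a b c y + loses e a b c x * beats e a b c y) else 0)"

lemma cyc_sym:
  assumes "\<And>u v. e v u = - e u v"
  shows "cyc e b a c = cyc e a b c" "cyc e a c b = cyc e a b c"
  using assms[of a b] assms[of b c] assms[of c a] by (auto simp: cyc_def)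

lemma sum_slack:
  fixes f :: "'a \<Rightarrow> 'a \<Rightarrow> 'a \<Rightarrow> 'a \<Rightarrow> 'a \<Rightarrow> int"
  assumes "distinct [p, q, r, s, t]" "\<And>u v. e v u = - e u v" "f = slack7 e \<or> f = slack12 e"
  shows "(\<Sum>xs\<in>distinct_lists 5 {p, q, r, s, t}. app5 f xs) =
    12 * (f p q r s t + f p q s r t + f p q t r s + f p r s q t + f p r t q s
      + f p s t q r + f q r s p t + f q r t p s + f q s t p r + f r s t p q)"
proof -
  have "f b a c x y = f a b c x y" "f a c b x y = f a b c x y" "f a b c y x = f a b c x y" for a b c x y
    using assms(3) 
    by (auto simp: slack7_def slack12_def prod3_def imb3_def beats_def loses_def
      cyc_sym[OF assms(2)] mult_ac conj_ac add_ac)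
  then show ?thesis
    using sum_distinct_lists_triple_pair[OF assms(1), of "app5 f"] by simp
qed

lemma sum_star:
  fixes f :: "'a \<Rightarrow> 'a \<Rightarrow> 'a \<Rightarrow> 'a \<Rightarrow> 'a \<Rightarrow> int"
  assumes "distinct [p, q, r, s, t]" "f = star4 e \<or> f = star_path e"
  shows "(\<Sum>xs\<in>distinct_lists 5 {p, q, r, s, t}. app5 f xs) =
    6 * (f p q r s t + f p r q s t + f p s q r t + f p t q r s
      + f q p r s t + f q r p s t + f q s p r t + f q t p r s
      + f r p q s t + f r q p s t + f r s p q t + f r t p q s
      + f s p q r t + f s q p r t + f s r p q t + f s t p q r
      + f t p q r s + f t q p r s + f t r p q s + f t s p q r)"
proof -
  have "f a y c b x = f a y b c x" "f a y b x c = f a y b c x" for a b c x y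
    using assms(2) 
    by (auto simp: star4_def star_path_def mult_ac add_ac)
  then show ?thesis
    using sum_distinct_lists_2_triple[OF assms(1), of "app5 f"] by simp
qed

definition labels_T5_7 :: "('a \<Rightarrow> 'a \<Rightarrow> int) \<Rightarrow> 'a \<Rightarrow> 'a \<Rightarrow> 'a \<Rightarrow> 'a \<Rightarrow> 'a \<Rightarrow> bool" where
  "labels_T5_7 e a b c d g \<longleftrightarrow> e a b = 1 \<and> e a c = 1 \<and> e a d = 1 \<and> e g a = 1 \<and> e b c = 1 \<and> e b d = 1
     \<and> e b g = 1 \<and> e c d = 1 \<and> e c g = 1 \<and> e d g = 1"

definition labels_T5_12 :: "('a \<Rightarrow> 'a \<Rightarrow> int) \<Rightarrow> 'a \<Rightarrow> 'a \<Rightarrow> 'a \<Rightarrow> 'a \<Rightarrow> 'a \<Rightarrow> bool" where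
  "labels_T5_12 e a b c d g \<longleftrightarrow> e a b = 1 \<and> e a c = 1 \<and> e b c = 1 \<and> e b d = 1 \<and> e c d = 1 \<and> e c g = 1
     \<and> e d g = 1 \<and> e d a = 1 \<and> e g a = 1 \<and> e g b = 1"

definition loc_trans :: "('a \<Rightarrow> 'a \<Rightarrow> int) \<Rightarrow> 'a set \<Rightarrow> bool" where
  "loc_trans e X \<longleftrightarrow> (\<forall>a\<in>X. \<forall>b\<in>X. \<forall>c\<in>X. \<forall>x\<in>X. cyc e a b c \<longrightarrow> beats e a b c x = 0 \<and> loses e a b c x = 0)"

text \<open>Every tournament has a Hamiltonian path, so only six arcs are left to a case distinction.\<close>

lemma five_vertices_cases:
  assumes d: "distinct [p, q, r, s, t]" and anti: "\<And>u v. e v u = - e u v"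
    and path: "e p q = 1" "e q r = 1" "e r s = 1" "e s t = (1::int)"
    and arcs: "e p r = 1 \<or> e p r = -1" "e p s = 1 \<or> e p s = -1" "e p t = 1 \<or> e p t = -1"
      "e q s = 1 \<or> e q s = -1" "e q t = 1 \<or> e q t = -1" "e r t = 1 \<or> e r t = -1"
  defines "X \<equiv> {p, q, r, s, t}"
  defines "s5 \<equiv> \<lambda>f. \<Sum>xs\<in>distinct_lists 5 X. app5 f xs"
  shows sum_slack7_le: "s5 (slack7 e) + 15 * s5 (star4 e) \<le> 600"
    and sum_slack7_le_iso: "labels_T5_7 e p q r s t \<Longrightarrow> s5 (slack7 e) + 15 * s5 (star4 e) \<le> -1320"
    and sum_slack12_le: "s5 (slack12 e) + 5 * s5 (star4 e) \<le> 240"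
    and sum_slack12_le_iso: "labels_T5_12 e p q r s t \<Longrightarrow> s5 (slack12 e) + 5 * s5 (star4 e) \<le> -3600"
    and loc_trans_sum7: "loc_trans e X \<Longrightarrow> 10 * s5 (star_path e) + 15 * s5 (star4 e) \<ge> 600 \<or>
      10 * s5 (star_path e) + 15 * s5 (star4 e) \<ge> -1320 \<and> (labels_T5_7 e p q r s t \<or> labels_T5_7 e q r s t p \<or> labels_T5_7 e r p s t q \<or> labels_T5_7 e r s p t q \<or> labels_T5_7 e r s t p q \<or> labels_T5_7 e s p q t r \<or> labels_T5_7 e s p t q r \<or> labels_T5_7 e s t p q r \<or> labels_T5_7 e t p q r s)"
    and loc_trans_sum12: "loc_trans e X \<Longrightarrow> 10 * s5 (star_path e) - 5 * s5 (star4 e) \<ge> 120 \<or>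
      10 * s5 (star_path e) - 5 * s5 (star4 e) \<ge> -1800 \<and> (labels_T5_12 e p q r s t \<or> labels_T5_12 e p s q t r \<or> labels_T5_12 e p t q r s)"
proof -
  have rev_path: "e q p = -1" "e r q = -1" "e s r = -1" "e t s = -1"
    using anti[of p q] anti[of q r] anti[of r s] anti[of s t] path by simp_all
  note rev = anti[of p r] anti[of p s] anti[of p t] anti[of q s] anti[of q t] anti[of r t] rev_path path
  note slacks = sum_slack[OF d anti disjI1[OF refl]] sum_slack[OF d anti disjI2[OF refl]]
    sum_star[OF d disjI1[OF refl]] sum_star[OF d disjI2[OF refl]]
  note defs = slack7_def slack12_def prod3_def imb3_def beats_def loses_def cyc_def
  show "s5 (slack7 e) + 15 * s5 (star4 e) \<le> 600" "s5 (slack12 e) + 5 * s5 (star4 e) \<le> 240"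
    unfolding s5_def X_def slacks using arcs
    by (elim disjE; simp add: rev star4_def defs)+
  show "s5 (slack7 e) + 15 * s5 (star4 e) \<le> -1320" if "labels_T5_7 e p q r s t"
  proof -
    have "e p t = -1" using that anti[of t p] by (simp add: labels_T5_7_def)
    then show ?thesis
      using that unfolding s5_def X_def slacks
      by (simp add: labels_T5_7_def star4_def defs rev)
  qed
  show "s5 (slack12 e) + 5 * s5 (star4 e) \<le> -3600" if "labels_T5_12 e p q r s t"
  proof -
    have "e p s = -1" "e p t = -1" "e q t = -1"
      using that anti[of s p] anti[of t p] anti[of t q] by (simp_all add: labels_T5_12_def)
    then show ?thesis
      using that unfolding s5_def X_def slacks
      by (simp add: labels_T5_12_def star4_def defs rev)
  qed
  assume "loc_trans e X"
  then have lt: "cyc e a b c \<longrightarrow> beats e a b c x = 0 \<and> loses e a b c x = 0"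
    if "a \<in> X" "b \<in> X" "c \<in> X" "x \<in> X" for a b c x
    using that by (simp add: loc_trans_def)
  \<comment> \<open>Ten triples with two outer vertices each: by the symmetry of \<open>cyc\<close>,
    one order per triple is enough.\<close>
  have lt_cases: "(cyc e p q r \<longrightarrow> beats e p q r s = 0 \<and> loses e p q r s = 0)
      \<and> (cyc e p q r \<longrightarrow> beats e p q r t = 0 \<and> loses e p q r t = 0)
      \<and> (cyc e p q s \<longrightarrow> beats e p q s r = 0 \<and> loses e p q s r = 0)
      \<and> (cyc e p q s \<longrightarrow> beats e p q s t = 0 \<and> loses e p q s t = 0)
      \<and> (cyc e p q t \<longrightarrow> beats e p q t r = 0 \<and> loses e p q t r = 0)
      \<and> (cyc e p q t \<longrightarrow> beats e p q t s = 0 \<and> loses e p q t s = 0)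
      \<and> (cyc e p r s \<longrightarrow> beats e p r s q = 0 \<and> loses e p r s q = 0)
      \<and> (cyc e p r s \<longrightarrow> beats e p r s t = 0 \<and> loses e p r s t = 0)
      \<and> (cyc e p r t \<longrightarrow> beats e p r t q = 0 \<and> loses e p r t q = 0)
      \<and> (cyc e p r t \<longrightarrow> beats e p r t s = 0 \<and> loses e p r t s = 0)
      \<and> (cyc e p s t \<longrightarrow> beats e p s t q = 0 \<and> loses e p s t q = 0)
      \<and> (cyc e p s t \<longrightarrow> beats e p s t r = 0 \<and> loses e p s t r = 0)
      \<and> (cyc e q r s \<longrightarrow> beats e q r s p = 0 \<and> loses e q r s p = 0)
      \<and> (cyc e q r s \<longrightarrow> beats e q r s t = 0 \<and> loses e q r s t = 0)
      \<and> (cyc e q r t \<longrightarrow> beats e q r t p = 0 \<and> loses e q r t p = 0)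
      \<and> (cyc e q r t \<longrightarrow> beats e q r t s = 0 \<and> loses e q r t s = 0)
      \<and> (cyc e q s t \<longrightarrow> beats e q s t p = 0 \<and> loses e q s t p = 0)
      \<and> (cyc e q s t \<longrightarrow> beats e q s t r = 0 \<and> loses e q s t r = 0)
      \<and> (cyc e r s t \<longrightarrow> beats e r s t p = 0 \<and> loses e r s t p = 0)
      \<and> (cyc e r s t \<longrightarrow> beats e r s t q = 0 \<and> loses e r s t q = 0)"
    by (intro conjI; rule lt; simp add: X_def)
  \<comment> \<open>The conditions stay as a premise of the goal, so that each of the 64 cases
    evaluates them itself. The nine labellings are the nine Hamiltonian paths of
    \<open>T5_7\<close>, one for each way in which p, q, r, s, t can traverse it.\<close>
  have "(cyc e p q r \<longrightarrow> beats e p q r s = 0 \<and> loses e p q r s = 0)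
      \<and> (cyc e p q r \<longrightarrow> beats e p q r t = 0 \<and> loses e p q r t = 0)
      \<and> (cyc e p q s \<longrightarrow> beats e p q s r = 0 \<and> loses e p q s r = 0)
      \<and> (cyc e p q s \<longrightarrow> beats e p q s t = 0 \<and> loses e p q s t = 0)
      \<and> (cyc e p q t \<longrightarrow> beats e p q t r = 0 \<and> loses e p q t r = 0)
      \<and> (cyc e p q t \<longrightarrow> beats e p q t s = 0 \<and> loses e p q t s = 0)
      \<and> (cyc e p r s \<longrightarrow> beats e p r s q = 0 \<and> loses e p r s q = 0)
      \<and> (cyc e p r s \<longrightarrow> beats e p r s t = 0 \<and> loses e p r s t = 0)
      \<and> (cyc e p r t \<longrightarrow> beats e p r t q = 0 \<and> loses e p r t q = 0)
      \<and> (cyc e p r t \<longrightarrow> beats e p r t s = 0 \<and> loses e p r t s = 0)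
      \<and> (cyc e p s t \<longrightarrow> beats e p s t q = 0 \<and> loses e p s t q = 0)
      \<and> (cyc e p s t \<longrightarrow> beats e p s t r = 0 \<and> loses e p s t r = 0)
      \<and> (cyc e q r s \<longrightarrow> beats e q r s p = 0 \<and> loses e q r s p = 0)
      \<and> (cyc e q r s \<longrightarrow> beats e q r s t = 0 \<and> loses e q r s t = 0)
      \<and> (cyc e q r t \<longrightarrow> beats e q r t p = 0 \<and> loses e q r t p = 0)
      \<and> (cyc e q r t \<longrightarrow> beats e q r t s = 0 \<and> loses e q r t s = 0)
      \<and> (cyc e q s t \<longrightarrow> beats e q s t p = 0 \<and> loses e q s t p = 0)
      \<and> (cyc e q s t \<longrightarrow> beats e q s t r = 0 \<and> loses e q s t r = 0)
      \<and> (cyc e r s t \<longrightarrow> beats e r s t p = 0 \<and> loses e r s t p = 0)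
      \<and> (cyc e r s t \<longrightarrow> beats e r s t q = 0 \<and> loses e r s t q = 0) \<longrightarrow>
      (10 * s5 (star_path e) + 15 * s5 (star4 e) \<ge> 600 \<or>
      10 * s5 (star_path e) + 15 * s5 (star4 e) \<ge> -1320 \<and> (labels_T5_7 e p q r s t \<or> labels_T5_7 e q r s t p \<or> labels_T5_7 e r p s t q \<or> labels_T5_7 e r s p t q \<or> labels_T5_7 e r s t p q \<or> labels_T5_7 e s p q t r \<or> labels_T5_7 e s p t q r \<or> labels_T5_7 e s t p q r \<or> labels_T5_7 e t p q r s))"
    unfolding s5_def X_def slacks using arcs
    by (elim disjE; simp add: rev star4_def star_path_def labels_T5_7_def defs)
  then show "10 * s5 (star_path e) + 15 * s5 (star4 e) \<ge> 600 \<or>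
      10 * s5 (star_path e) + 15 * s5 (star4 e) \<ge> -1320 \<and> (labels_T5_7 e p q r s t \<or> labels_T5_7 e q r s t p \<or> labels_T5_7 e r p s t q \<or> labels_T5_7 e r s p t q \<or> labels_T5_7 e r s t p q \<or> labels_T5_7 e s p q t r \<or> labels_T5_7 e s p t q r \<or> labels_T5_7 e s t p q r \<or> labels_T5_7 e t p q r s)"
    using lt_cases by blast
  \<comment> \<open>\<open>T5_12\<close> has 15 Hamiltonian paths and 5 rotations, hence three
    labellings up to rotation.\<close>
  have "(cyc e p q r \<longrightarrow> beats e p q r s = 0 \<and> loses e p q r s = 0)
      \<and> (cyc e p q r \<longrightarrow> beats e p q r t = 0 \<and> loses e p q r t = 0)
      \<and> (cyc e p q s \<longrightarrow> beats e p q s r = 0 \<and> loses e p q s r = 0)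
      \<and> (cyc e p q s \<longrightarrow> beats e p q s t = 0 \<and> loses e p q s t = 0)
      \<and> (cyc e p q t \<longrightarrow> beats e p q t r = 0 \<and> loses e p q t r = 0)
      \<and> (cyc e p q t \<longrightarrow> beats e p q t s = 0 \<and> loses e p q t s = 0)
      \<and> (cyc e p r s \<longrightarrow> beats e p r s q = 0 \<and> loses e p r s q = 0)
      \<and> (cyc e p r s \<longrightarrow> beats e p r s t = 0 \<and> loses e p r s t = 0)
      \<and> (cyc e p r t \<longrightarrow> beats e p r t q = 0 \<and> loses e p r t q = 0)
      \<and> (cyc e p r t \<longrightarrow> beats e p r t s = 0 \<and> loses e p r t s = 0)
      \<and> (cyc e p s t \<longrightarrow> beats e p s t q = 0 \<and> loses e p s t q = 0)
      \<and> (cyc e p s t \<longrightarrow> beats e p s t r = 0 \<and> loses e p s t r = 0)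
      \<and> (cyc e q r s \<longrightarrow> beats e q r s p = 0 \<and> loses e q r s p = 0)
      \<and> (cyc e q r s \<longrightarrow> beats e q r s t = 0 \<and> loses e q r s t = 0)
      \<and> (cyc e q r t \<longrightarrow> beats e q r t p = 0 \<and> loses e q r t p = 0)
      \<and> (cyc e q r t \<longrightarrow> beats e q r t s = 0 \<and> loses e q r t s = 0)
      \<and> (cyc e q s t \<longrightarrow> beats e q s t p = 0 \<and> loses e q s t p = 0)
      \<and> (cyc e q s t \<longrightarrow> beats e q s t r = 0 \<and> loses e q s t r = 0)
      \<and> (cyc e r s t \<longrightarrow> beats e r s t p = 0 \<and> loses e r s t p = 0)
      \<and> (cyc e r s t \<longrightarrow> beats e r s t q = 0 \<and> loses e r s t q = 0) \<longrightarrow>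
      (10 * s5 (star_path e) - 5 * s5 (star4 e) \<ge> 120 \<or>
      10 * s5 (star_path e) - 5 * s5 (star4 e) \<ge> -1800 \<and> (labels_T5_12 e p q r s t \<or> labels_T5_12 e p s q t r \<or> labels_T5_12 e p t q r s))"
    unfolding s5_def X_def slacks using arcs
    by (elim disjE; simp add: rev star4_def star_path_def labels_T5_12_def defs)
  then show "10 * s5 (star_path e) - 5 * s5 (star4 e) \<ge> 120 \<or>
      10 * s5 (star_path e) - 5 * s5 (star4 e) \<ge> -1800 \<and> (labels_T5_12 e p q r s t \<or> labels_T5_12 e p s q t r \<or> labels_T5_12 e p t q r s)"
    using lt_cases by blast
qed

section \<open>Signs of arcs and Hamiltonian paths\<close>

definition arc_sign :: "'a pair_pre_digraph \<Rightarrow> 'a \<Rightarrow> 'a \<Rightarrow> int" where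
  "arc_sign T u v = (if (u, v) \<in> parcs T then 1 else if (v, u) \<in> parcs T then -1 else 0)"

lemma arc_sign_antisym: "tournament T \<Longrightarrow> arc_sign T v u = - arc_sign T u v"
  by (auto simp: arc_sign_def dest: tournament_arc_in)

lemma arc_sign_cases:
  "tournament T \<Longrightarrow> u \<in> pverts T \<Longrightarrow> v \<in> pverts T \<Longrightarrow> u \<noteq> v \<Longrightarrow> arc_sign T u v = 1 \<or> arc_sign T u v = -1"
  using tournament_total[of T u v] by (auto simp: arc_sign_def)

lemma arc_sign_eq_1_iff [simp]: "arc_sign T u v = 1 \<longleftrightarrow> (u, v) \<in> parcs T"
  by (simp add: arc_sign_def)

lemma arc_sign_eq_m1_iff: "tournament T \<Longrightarrow> arc_sign T u v = -1 \<longleftrightarrow> (v, u) \<in> parcs T"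
  by (auto simp: arc_sign_def dest: tournament_arc_in)

text \<open>The value 0 on the diagonal lets sums of signs range over all vertices.\<close>

lemma arc_sign_self: "tournament T \<Longrightarrow> arc_sign T u u = 0"
  by (auto simp: arc_sign_def dest: tournament_arc_in)

lemma abs_arc_sign_le: "\<bar>arc_sign T u v\<bar> \<le> 1"
  by (simp add: arc_sign_def)

text \<open>x is inserted before the first vertex that it beats. The clause about
  \<open>hd ys\<close> strengthens the induction: to put y back in front of the new path, y has to
  beat its head, which is either x or the old successor of y.\<close>

lemma hamiltonian_path_insert:
  assumes "successively E xs" "\<And>y. y \<in> set xs \<Longrightarrow> E x y \<or> E y x"
  shows "\<exists>ys. successively E ys \<and> mset ys = mset (x # xs) \<and> (hd ys = x \<or> xs \<noteq> [] \<and> hd ys = hd xs)"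
  using assms
proof (induction xs)
  case Nil
  then show ?case by (intro exI[of _ "[x]"]) auto
next
  case (Cons y xs)
  show ?case
  proof (cases "E x y")
    case True
    then show ?thesis using Cons.prems by (intro exI[of _ "x # y # xs"]) auto
  next
    case False
    then have yx: "E y x" using Cons.prems by auto
    obtain zs where zs: "successively E zs" "mset zs = mset (x # xs)" "hd zs = x \<or> xs \<noteq> [] \<and> hd zs = hd xs"
      using Cons by (auto simp: successively_Cons)
    then have "E y (hd zs)" using yx Cons.prems(1) by (auto simp: successively_Cons)
    moreover have "zs \<noteq> []" using zs(2) by auto
    ultimately show ?thesis using zs
      by (intro exI[of _ "y # zs"]) (auto simp: successively_Cons)
  qed
qed

lemma hamiltonian_path_exists:
  assumes "finite X" "\<And>u v. u \<in> X \<Longrightarrow> v \<in> X \<Longrightarrow> u \<noteq> v \<Longrightarrow> E u v \<or> E v u"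
  shows "\<exists>xs. successively E xs \<and> distinct xs \<and> set xs = X"
  using assms
proof (induction X rule: finite_induct)
  case (insert x X)
  then obtain xs where xs: "successively E xs" "distinct xs" "set xs = X" by auto
  then obtain ys where ys: "successively E ys" "mset ys = mset (x # xs)"
    using hamiltonian_path_insert[of E xs x] insert by (metis insertCI)
  then have "set ys = insert x X" "distinct ys"
    using xs insert(2) mset_eq_setD[OF ys(2)] mset_eq_imp_distinct_iff[OF ys(2)] by auto
  then show ?case using ys(1) by blast
qed auto

lemma five_vertices_path:
  assumes T: "tournament T" and X: "X \<subseteq> pverts T" "card X = 5"
  obtains p q r s t where "X = {p, q, r, s, t}" "distinct [p, q, r, s, t]"
    "(p, q) \<in> parcs T" "(q, r) \<in> parcs T" "(r, s) \<in> parcs T" "(s, t) \<in> parcs T"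
proof -
  have "finite X" using X(2) by (simp add: card_ge_0_finite)
  then obtain xs where xs: "successively (\<lambda>u v. (u, v) \<in> parcs T) xs" "distinct xs" "set xs = X"
    using hamiltonian_path_exists[of X "\<lambda>u v. (u, v) \<in> parcs T"] tournament_total[OF T] X(1) by blast
  then have "length xs = 5" using X(2) distinct_card by fastforce
  then obtain p q r s t where "xs = [p, q, r, s, t]"
    by (auto simp: length_Suc_conv eval_nat_numeral)
  with xs that show ?thesis by auto
qed

text \<open>Between tournaments a bijection that preserves arcs also reflects them: if an arc in the
  image came from a non-arc, the reversed pair would be an arc of S and would be mapped to the
  opposite arc.\<close>

lemma inducesI:
  assumes "tournament S" "tournament T" "bij_betw f (pverts S) X"
    and hom: "\<And>u v. (u, v) \<in> parcs S \<Longrightarrow> (f u, f v) \<in> parcs T"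
  shows "induces S T X"
  unfolding induces_def
proof (intro exI[of _ f] conjI ballI)
  fix u v assume uv: "u \<in> pverts S" "v \<in> pverts S"
  show "(u, v) \<in> parcs S \<longleftrightarrow> (f u, f v) \<in> parcs T"
  proof
    assume arc: "(f u, f v) \<in> parcs T"
    then have "u \<noteq> v" using tournament_arc_in(3)[OF assms(2)] by auto
    moreover have "(v, u) \<notin> parcs S" using hom arc tournament_arc_in(4)[OF assms(2)] by blast
    ultimately show "(u, v) \<in> parcs S" using tournament_total[OF assms(1) uv] by blast
  qed (rule hom)
qed (rule assms(3))

section \<open>The two five-vertex tournaments and their labelled copies\<close>

lemma pverts_T5_7: "pverts T5_7 = {1, 2, 3, 4, 5}"
  unfolding T5_7_def pair_pre_digraph.simps by (intro set_eqI, unfold atLeastAtMost_iff insert_iff empty_iff) arith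

lemma parcs_T5_7_cases:
  assumes "(u, v) \<in> parcs T5_7"
  shows "(u, v) \<in> {(1, 2), (1, 3), (1, 4), (5, 1), (2, 3), (2, 4), (2, 5), (3, 4), (3, 5), (4, 5)}"
proof -
  have "u \<in> {1, 2, 3, 4, 5}" "v \<in> {1, 2, 3, 4, 5}"
    using tournament_arc_in(1,2)[OF tournament_T5_7 assms] by (simp_all only: pverts_T5_7)
  then show ?thesis using assms by (elim insertE emptyE; simp add: T5_7_def)
qed

lemma pverts_T5_12: "pverts T5_12 = {0, 1, 2, 3, 4}"
  unfolding T5_12_def pair_pre_digraph.simps by (intro set_eqI, unfold atLeastLessThan_iff insert_iff empty_iff) arith

lemma tournament_T5_12: "tournament T5_12"
  by (simp add: T5_12_eq_carousel tournament_carousel)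

lemma parcs_T5_12_iff: "(u, v) \<in> parcs T5_12 \<longleftrightarrow> u < 5 \<and> v < 5 \<and> (u < v \<and> v \<le> u + 2 \<or> v < u \<and> u > v + 2)"
  by (simp add: T5_12_eq_carousel carousel_arc_iff)

lemma parcs_T5_12_cases:
  assumes "(u, v) \<in> parcs T5_12"
  shows "(u, v) \<in> {(0, 1), (0, 2), (1, 2), (1, 3), (2, 3), (2, 4), (3, 4), (3, 0), (4, 0), (4, 1)}"
proof -
  have "u \<in> {0, 1, 2, 3, 4}" "v \<in> {0, 1, 2, 3, 4}"
    using tournament_arc_in(1,2)[OF tournament_T5_12 assms] by (simp_all only: pverts_T5_12)
  then show ?thesis using assms by (elim insertE emptyE; simp add: parcs_T5_12_iff)
qed

lemma induces_T5_7I: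
  assumes "tournament T" "distinct [p, q, r, s, t]" "labels_T5_7 (arc_sign T) p q r s t"
  shows "induces T5_7 T {p, q, r, s, t}"
proof (rule inducesI[OF tournament_T5_7 assms(1)])
  let ?f = "\<lambda>i. [p, q, r, s, t] ! (i - 1)"
  show "bij_betw ?f (pverts T5_7) {p, q, r, s, t}"
    using assms(2) by (auto simp: bij_betw_def pverts_T5_7 inj_on_def)
  show "(?f u, ?f v) \<in> parcs T" if "(u, v) \<in> parcs T5_7" for u v
    using parcs_T5_7_cases[OF that] assms(3) by (elim insertE emptyE; simp add: labels_T5_7_def)
qed

lemma induces_T5_12I:
  assumes "tournament T" "distinct [p, q, r, s, t]" "labels_T5_12 (arc_sign T) p q r s t"
  shows "induces T5_12 T {p, q, r, s, t}"
proof (rule inducesI[OF tournament_T5_12 assms(1)])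
  let ?f = "\<lambda>i. [p, q, r, s, t] ! i"
  show "bij_betw ?f (pverts T5_12) {p, q, r, s, t}"
    using assms(2) by (auto simp: bij_betw_def pverts_T5_12 inj_on_def)
  show "(?f u, ?f v) \<in> parcs T" if "(u, v) \<in> parcs T5_12" for u v
    using parcs_T5_12_cases[OF that] assms(3) by (elim insertE emptyE; simp add: labels_T5_12_def)
qed

lemma induces_T5_7E:
  assumes "induces T5_7 T X"
  obtains p q r s t where "X = {p, q, r, s, t}" "distinct [p, q, r, s, t]" "labels_T5_7 (arc_sign T) p q r s t"
proof -
  obtain f where f: "bij_betw f {1, 2, 3, 4, 5} X"
    and arc: "\<forall>u\<in>{1, 2, 3, 4, 5}. \<forall>v\<in>{1, 2, 3, 4, 5}. (u, v) \<in> parcs T5_7 \<longleftrightarrow> (f u, f v) \<in> parcs T"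
    using assms unfolding induces_def pverts_T5_7 by blast
  have "labels_T5_7 (arc_sign T) (f 1) (f 2) (f 3) (f 4) (f 5)"
    using arc by (simp add: T5_7_def labels_T5_7_def)
  moreover have "X = {f 1, f 2, f 3, f 4, f 5}" "distinct [f 1, f 2, f 3, f 4, f 5]"
    using f by (auto simp: bij_betw_def inj_on_def)
  ultimately show ?thesis using that by blast
qed

lemma induces_T5_12E:
  assumes "induces T5_12 T X"
  obtains p q r s t where "X = {p, q, r, s, t}" "distinct [p, q, r, s, t]" "labels_T5_12 (arc_sign T) p q r s t"
proof -
  obtain f where f: "bij_betw f {0, 1, 2, 3, 4} X"
    and arc: "\<forall>u\<in>{0, 1, 2, 3, 4}. \<forall>v\<in>{0, 1, 2, 3, 4}. (u, v) \<in> parcs T5_12 \<longleftrightarrow> (f u, f v) \<in> parcs T"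
    using assms unfolding induces_def pverts_T5_12 by blast
  have "labels_T5_12 (arc_sign T) (f 0) (f 1) (f 2) (f 3) (f 4)"
    using arc by (simp add: parcs_T5_12_iff labels_T5_12_def)
  moreover have "X = {f 0, f 1, f 2, f 3, f 4}" "distinct [f 0, f 1, f 2, f 3, f 4]"
    using f by (auto simp: bij_betw_def inj_on_def)
  ultimately show ?thesis using that by blast
qed

abbreviation sum5 :: "'a set \<Rightarrow> ('a \<Rightarrow> 'a \<Rightarrow> 'a \<Rightarrow> 'a \<Rightarrow> 'a \<Rightarrow> int) \<Rightarrow> int" where
  "sum5 X f \<equiv> \<Sum>xs\<in>distinct_lists 5 X. app5 f xs"

text \<open>A five-set has 120 orders, so that 600, 240 and 120 stand for 5, 2 and 1 per order.
  Likewise 1920 is 16 and 3840 is 32 per order; this is where the denominator 16 of both limits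
  comes from.\<close>

lemma sum5_bounds:
  fixes T :: "'a pair_pre_digraph"
  assumes T: "tournament T" and X: "X \<subseteq> pverts T" "card X = 5"
  defines "e \<equiv> arc_sign T"
  shows "sum5 X (slack7 e) + 15 * sum5 X (star4 e) \<le> 600 - 1920 * of_bool (induces T5_7 T X)"
    and "sum5 X (slack12 e) + 5 * sum5 X (star4 e) \<le> 240 - 3840 * of_bool (induces T5_12 T X)"
    and "loc_trans e X \<Longrightarrow>
      600 - 1920 * of_bool (induces T5_7 T X) \<le> 10 * sum5 X (star_path e) + 15 * sum5 X (star4 e)"
    and "loc_trans e X \<Longrightarrow>
      120 - 1920 * of_bool (induces T5_12 T X) \<le> 10 * sum5 X (star_path e) - 5 * sum5 X (star4 e)"
proof -
  have anti: "e v u = - e u v" for u v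
    unfolding e_def by (rule arc_sign_antisym[OF T])
  have cases: "e u v = 1 \<or> e u v = -1" if "u \<in> X" "v \<in> X" "u \<noteq> v" for u v
    unfolding e_def using that X by (intro arc_sign_cases[OF T]) auto
  obtain p q r s t where eq: "X = {p, q, r, s, t}" and d: "distinct [p, q, r, s, t]"
    and path: "(p, q) \<in> parcs T" "(q, r) \<in> parcs T" "(r, s) \<in> parcs T" "(s, t) \<in> parcs T"
    by (rule five_vertices_path[OF T X])
  have path': "e p q = 1" "e q r = 1" "e r s = 1" "e s t = 1"
    using path by (simp_all add: e_def)
  have arcs: "e p r = 1 \<or> e p r = -1" "e p s = 1 \<or> e p s = -1" "e p t = 1 \<or> e p t = -1"
      "e q s = 1 \<or> e q s = -1" "e q t = 1 \<or> e q t = -1" "e r t = 1 \<or> e r t = -1"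
    by (rule cases; use d in \<open>auto simp: eq\<close>)+
  note main = five_vertices_cases[OF d anti path' arcs, folded eq]
  \<comment> \<open>Every labelling in the case lists permutes the chosen path, so each of them
    would give a copy on X.\<close>
  have perm: "distinct [a, b, c, y, z] \<and> X = {a, b, c, y, z}"
    if "mset [a, b, c, y, z] = mset [p, q, r, s, t]" for a b c y z
    using mset_eq_imp_distinct_iff[OF that] mset_eq_setD[OF that] d by (simp add: eq)
  show "600 - 1920 * of_bool (induces T5_7 T X) \<le> 10 * sum5 X (star_path e) + 15 * sum5 X (star4 e)"
    if lt: "loc_trans e X"
  proof (cases "induces T5_7 T X")
    case False
    have "\<not> labels_T5_7 e a b c y z" if "mset [a, b, c, y, z] = mset [p, q, r, s, t]" for a b c y z
      using induces_T5_7I[OF T, of a b c y z] perm[OF that] False by (auto simp: e_def)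
    then show ?thesis using main(5)[OF lt] False by (simp add: add_mset_commute)
  qed (use main(5)[OF lt] in auto)
  show "120 - 1920 * of_bool (induces T5_12 T X) \<le> 10 * sum5 X (star_path e) - 5 * sum5 X (star4 e)"
    if lt: "loc_trans e X"
  proof (cases "induces T5_12 T X")
    case False
    have "\<not> labels_T5_12 e a b c y z" if "mset [a, b, c, y, z] = mset [p, q, r, s, t]" for a b c y z
      using induces_T5_12I[OF T, of a b c y z] perm[OF that] False by (auto simp: e_def)
    then show ?thesis using main(6)[OF lt] False by (simp add: add_mset_commute)
  qed (use main(6)[OF lt] in auto)
  show "sum5 X (slack7 e) + 15 * sum5 X (star4 e) \<le> 600 - 1920 * of_bool (induces T5_7 T X)"
  proof (cases "induces T5_7 T X")
    case True
    \<comment> \<open>The labelling of the copy is itself a Hamiltonian path; it replaces the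
      arbitrary path chosen above.\<close>
    then obtain p q r s t where *: "X = {p, q, r, s, t}" "distinct [p, q, r, s, t]" "labels_T5_7 e p q r s t"
      unfolding e_def by (rule induces_T5_7E)
    have arcs': "e p r = 1 \<or> e p r = -1" "e p s = 1 \<or> e p s = -1" "e p t = 1 \<or> e p t = -1"
      "e q s = 1 \<or> e q s = -1" "e q t = 1 \<or> e q t = -1" "e r t = 1 \<or> e r t = -1"
      by (rule cases; use *(2) in \<open>auto simp: *(1)\<close>)+
    have path': "e p q = 1" "e q r = 1" "e r s = 1" "e s t = 1"
      using *(3) by (simp_all add: labels_T5_7_def)
    have "sum5 X (slack7 e) + 15 * sum5 X (star4 e) \<le> -1320"
      unfolding *(1) by (rule sum_slack7_le_iso[OF *(2) anti path' arcs' *(3)])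
    then show ?thesis using True by simp
  next
    case False
    then show ?thesis using main(1) by simp
  qed
  show "sum5 X (slack12 e) + 5 * sum5 X (star4 e) \<le> 240 - 3840 * of_bool (induces T5_12 T X)"
  proof (cases "induces T5_12 T X")
    case True
    then obtain p q r s t where *: "X = {p, q, r, s, t}" "distinct [p, q, r, s, t]" "labels_T5_12 e p q r s t"
      unfolding e_def by (rule induces_T5_12E)
    have arcs': "e p r = 1 \<or> e p r = -1" "e p s = 1 \<or> e p s = -1" "e p t = 1 \<or> e p t = -1"
      "e q s = 1 \<or> e q s = -1" "e q t = 1 \<or> e q t = -1" "e r t = 1 \<or> e r t = -1"
      by (rule cases; use *(2) in \<open>auto simp: *(1)\<close>)+
    have path': "e p q = 1" "e q r = 1" "e r s = 1" "e s t = 1"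
      using *(3) by (simp_all add: labels_T5_12_def)
    have "sum5 X (slack12 e) + 5 * sum5 X (star4 e) \<le> -3600"
      unfolding *(1) by (rule sum_slack12_le_iso[OF *(2) anti path' arcs' *(3)])
    then show ?thesis using True by simp
  next
    case False
    then show ?thesis using main(3) by simp
  qed
qed

section \<open>Global counting inequalities\<close>

text \<open>Out-degree minus in-degree.\<close>

definition imbalance :: "'a pair_pre_digraph \<Rightarrow> 'a \<Rightarrow> int" where
  "imbalance T v = (\<Sum>u\<in>pverts T. arc_sign T v u)"

definition domination :: "'a pair_pre_digraph \<Rightarrow> 'a \<Rightarrow> 'a \<Rightarrow> 'a \<Rightarrow> int" where
  "domination T a b c = (if cyc (arc_sign T) a b c then
     \<Sum>x\<in>pverts T. beats (arc_sign T) a b c x + loses (arc_sign T) a b c x else 0)"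

text \<open>Both sums count five-tuples: the first is the free sum of \<open>star4\<close>, the
  second counts the ordered pairs x, y of vertices that dominate or are dominated by the cyclic
  triple a, b, c. Divided by n^5 this is the quantity that extremality forces to 0.\<close>

definition deficit :: "'a pair_pre_digraph \<Rightarrow> int" where
  "deficit T = (\<Sum>v\<in>pverts T. imbalance T v ^ 4)
     + (\<Sum>a\<in>pverts T. \<Sum>b\<in>pverts T. \<Sum>c\<in>pverts T. domination T a b c ^ 2)"

text \<open>The left side is the product of the three signs plus their sum, which is 4 or -4 if the
  signs agree and 0 if they do not. For x on the triple both parts vanish, since one sign is 0 and
  the other two cancel along the cycle.\<close>

lemma imb3_eq_domination_on_cycle:
  assumes T: "tournament T" and cyc: "cyc (arc_sign T) a b c" and x: "x \<in> pverts T"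
  defines "e \<equiv> arc_sign T"
  shows "2 * prod3 e a b c x - imb3 e a b c x = 4 * (loses e a b c x - beats e a b c x)"
proof -
  have anti: "e v u = - e u v" for u v unfolding e_def by (rule arc_sign_antisym[OF T])
  have V: "a \<in> pverts T" "b \<in> pverts T" "c \<in> pverts T"
    using cyc tournament_arc_in[OF T] by (auto simp: cyc_def arc_sign_def split: if_splits)
  have ne: "e a b \<noteq> 0" "e a b = e b c" "e b c = e c a" using cyc by (simp_all add: cyc_def e_def)
  have self: "e u u = 0" for u unfolding e_def by (rule arc_sign_self[OF T])
  show ?thesis
  proof (cases "x \<in> {a, b, c}")
    case True
    then show ?thesis
      using ne anti[of a b] anti[of b c] anti[of c a]
      by (auto simp: prod3_def imb3_def loses_def beats_def self)
  next
    case False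
    have "e a x = 1 \<or> e a x = -1" "e b x = 1 \<or> e b x = -1" "e c x = 1 \<or> e c x = -1"
      unfolding e_def by (rule arc_sign_cases[OF T]; use False V x in auto)+
    then show ?thesis
      by (elim disjE; simp add: prod3_def imb3_def loses_def beats_def anti[of a x] anti[of b x] anti[of c x])
  qed
qed

lemma sum_if_const: "(\<Sum>x\<in>A. if P then f x else 0) = (if P then sum f A else (0::int))"
  by simp

lemma abs_mult_le_1: "\<bar>x\<bar> \<le> 1 \<Longrightarrow> \<bar>y\<bar> \<le> 1 \<Longrightarrow> \<bar>x * y\<bar> \<le> (1::int)"
  by (simp add: abs_mult mult_le_one)

context
  fixes T :: "'a pair_pre_digraph"
  assumes T: "tournament T"
begin

private abbreviation (input) "V \<equiv> pverts T"
private abbreviation (input) "e \<equiv> arc_sign T"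
private abbreviation (input) "n5 \<equiv> int (card (distinct_lists 5 V))"

lemma finV: "finite V" by (rule tournament_finite[OF T])

lemma sum_all_star4: "(\<Sum>a\<in>V. \<Sum>b\<in>V. \<Sum>c\<in>V. \<Sum>x\<in>V. \<Sum>y\<in>V. star4 e a b c x y) = (\<Sum>v\<in>V. imbalance T v ^ 4)"
proof (intro sum.cong refl)
  fix a
  show "(\<Sum>b\<in>V. \<Sum>c\<in>V. \<Sum>x\<in>V. \<Sum>y\<in>V. star4 e a b c x y) = imbalance T a ^ 4"
    by (simp add: star4_def imbalance_def power4_eq_xxxx sum_distrib_left[symmetric] sum_distrib_right[symmetric])
qed

lemma abs_prod3_le: "\<bar>prod3 e a b c x\<bar> \<le> 1"
  by (simp add: prod3_def abs_mult_le_1 abs_arc_sign_le)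

lemma abs_imb3_le: "\<bar>imb3 e a b c x\<bar> \<le> 4"
  using abs_prod3_le[of a b c x] abs_arc_sign_le[of T a x] abs_arc_sign_le[of T b x] abs_arc_sign_le[of T c x]
  by (simp add: imb3_def)

lemma abs_star4_le: "\<bar>star4 e a b c x y\<bar> \<le> 1"
  by (simp add: star4_def abs_mult_le_1 abs_arc_sign_le)

lemma abs_star_path_le: "\<bar>star_path e a b c x y\<bar> \<le> 3"
proof -
  have "\<bar>e c x * e c y\<bar> \<le> 1" "\<bar>e x c * e x y\<bar> \<le> 1" "\<bar>e y c * e y x\<bar> \<le> 1"
    by (simp_all add: abs_mult_le_1 abs_arc_sign_le)
  then have "\<bar>e c x * e c y + e x c * e x y + e y c * e y x\<bar> \<le> 3" by linarith
  then have "\<bar>star_path e a b c x y\<bar> \<le> 1 * 3"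
    unfolding star_path_def abs_mult using abs_star4_le by (intro mult_mono) auto
  then show ?thesis by simp
qed

lemma beats_loses_range: "beats e a b c x \<in> {0, 1}" "loses e a b c x \<in> {0, 1}"
  by (auto simp: beats_def loses_def)

text \<open>330 = 10 + 160 * 2.\<close>

lemma abs_slack7_le: "\<bar>slack7 e a b c x y\<bar> \<le> 330"
proof -
  have "\<bar>prod3 e a b c x * prod3 e a b c y\<bar> \<le> 1" by (simp add: abs_mult_le_1 abs_prod3_le)
  then show ?thesis
    using beats_loses_range[of a b c x] beats_loses_range[of a b c y] by (auto simp: slack7_def)
qed

text \<open>405 = 5 + 15 * 16 + 80 * 2.\<close>

lemma abs_slack12_le: "\<bar>slack12 e a b c x y\<bar> \<le> 405"
proof -
  have "\<bar>prod3 e a b c x * prod3 e a b c y\<bar> \<le> 1" by (simp add: abs_mult_le_1 abs_prod3_le)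
  moreover have "\<bar>imb3 e a b c x * imb3 e a b c y\<bar> \<le> 4 * 4"
    unfolding abs_mult using abs_imb3_le by (intro mult_mono) auto
  ultimately show ?thesis
    using beats_loses_range[of a b c x] beats_loses_range[of a b c y] by (auto simp: slack12_def)
qed

text \<open>For a fixed triple the sum over x and y factors into 10 Q^2 and, on cyclic triples, 160
  (B^2 + L^2); the latter is at least 80 (B + L)^2.\<close>

lemma sum_all_slack7_ge:
  "80 * (\<Sum>a\<in>V. \<Sum>b\<in>V. \<Sum>c\<in>V. domination T a b c ^ 2)
    \<le> (\<Sum>a\<in>V. \<Sum>b\<in>V. \<Sum>c\<in>V. \<Sum>x\<in>V. \<Sum>y\<in>V. slack7 e a b c x y)"
  unfolding sum_distrib_left
proof (intro sum_mono)
  fix a b c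
  define Q B L where "Q = (\<Sum>x\<in>V. prod3 e a b c x)" and "B = (\<Sum>x\<in>V. beats e a b c x)"
    and "L = (\<Sum>x\<in>V. loses e a b c x)"
  have "(\<Sum>x\<in>V. \<Sum>y\<in>V. slack7 e a b c x y) = 10 * Q^2 + (if cyc e a b c then 160 * (B^2 + L^2) else 0)"
    by (simp add: slack7_def Q_def B_def L_def sum.distrib sum_distrib_left[symmetric] sum_distrib_right[symmetric]
        power2_eq_square distrib_left)
  moreover have "80 * (B + L)^2 \<le> 160 * (B^2 + L^2)"
    using zero_le_power2[of "B - L"] by (simp add: power2_eq_square algebra_simps)
  moreover have "domination T a b c = (if cyc e a b c then B + L else 0)"
    by (simp add: domination_def sum.distrib B_def L_def)
  ultimately show "80 * domination T a b c ^ 2 \<le> (\<Sum>x\<in>V. \<Sum>y\<in>V. slack7 e a b c x y)"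
    by (auto intro!: add_increasing split: if_splits)
qed

text \<open>Here the certificate contains B L instead of B^2 + L^2, which says nothing when only one
  of B and L is large. The missing control of L - B comes from the squares of Q and I, since 2 Q - I
  = 4 (L - B) on a cyclic triple.\<close>

lemma sum_all_slack12_ge:
  "10 * (\<Sum>a\<in>V. \<Sum>b\<in>V. \<Sum>c\<in>V. domination T a b c ^ 2)
    \<le> (\<Sum>a\<in>V. \<Sum>b\<in>V. \<Sum>c\<in>V. \<Sum>x\<in>V. \<Sum>y\<in>V. slack12 e a b c x y)"
  unfolding sum_distrib_left
proof (intro sum_mono)
  fix a b c
  define Q I B L where "Q = (\<Sum>x\<in>V. prod3 e a b c x)" and "I = (\<Sum>x\<in>V. imb3 e a b c x)"
    and "B = (\<Sum>x\<in>V. beats e a b c x)" and "L = (\<Sum>x\<in>V. loses e a b c x)"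
  have eq: "(\<Sum>x\<in>V. \<Sum>y\<in>V. slack12 e a b c x y) = 5 * Q^2 + (if cyc e a b c then 15 * I^2 + 160 * (B * L) else 0)"
    by (simp add: slack12_def Q_def I_def B_def L_def sum.distrib sum_distrib_left[symmetric] sum_distrib_right[symmetric]
        power2_eq_square distrib_left)
  show "10 * domination T a b c ^ 2 \<le> (\<Sum>x\<in>V. \<Sum>y\<in>V. slack12 e a b c x y)"
  proof (cases "cyc e a b c")
    case True
    have BL: "B \<ge> 0" "L \<ge> 0" by (simp_all add: B_def L_def beats_def loses_def sum_nonneg)
    have "2 * Q - I = (\<Sum>x\<in>V. 2 * prod3 e a b c x - imb3 e a b c x)"
      by (simp add: Q_def I_def sum_subtractf sum_distrib_left[symmetric])
    also have "\<dots> = (\<Sum>x\<in>V. 4 * (loses e a b c x - beats e a b c x))"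
      by (intro sum.cong refl imb3_eq_domination_on_cycle[OF T True])
    also have "\<dots> = 4 * (L - B)" by (simp add: L_def B_def sum_subtractf sum_distrib_left[symmetric])
    finally have *: "2 * Q - I = 4 * (L - B)" .
    have "16 * (10 * (B + L)^2) = 10 * (4 * (L - B))^2 + 640 * (B * L)"
      by (simp add: power2_eq_square algebra_simps)
    also have "\<dots> = 10 * (2 * Q - I)^2 + 640 * (B * L)" by (simp add: *)
    \<comment> \<open>This is (2 Q - I)^2 <= 2 ((2 Q)^2 + I^2).\<close>
    also have "\<dots> \<le> 80 * Q^2 + 20 * I^2 + 640 * (B * L)"
      using zero_le_power2[of "2 * Q + I"] by (simp add: power2_eq_square algebra_simps)
    also have "\<dots> \<le> 16 * (5 * Q^2 + 15 * I^2 + 160 * (B * L))"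
      using BL by simp
    finally show ?thesis
      using True eq by (simp add: domination_def sum.distrib B_def[symmetric] L_def[symmetric])
  qed (simp add: eq domination_def)
qed

lemma card_distinct_5: "5 \<le> card V \<Longrightarrow> n5 = 120 * int (card V choose 5)"
  using card_distinct_lists[OF finV, of 5] by (simp add: fact_numeral)

lemma sum5_le_of_pointwise:
  assumes "5 \<le> card V" "\<And>X. X \<subseteq> V \<Longrightarrow> card X = 5 \<Longrightarrow> (\<Sum>xs\<in>distinct_lists 5 X. h xs) \<le> 120 * k - m * of_bool (induces S T X)"
  shows "(\<Sum>xs\<in>distinct_lists 5 V. h xs) \<le> k * n5 - m * int (card {X \<in> subsets_of_size 5 V. induces S T X})"
proof -
  have "(\<Sum>xs\<in>distinct_lists 5 V. h xs) \<le> (\<Sum>X\<in>subsets_of_size 5 V. 120 * k - m * of_bool (induces S T X))"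
    unfolding sum_distinct_lists_by_set[OF finV]
    by (intro sum_mono assms(2)) (auto simp: subsets_of_size_def)
  also have "\<dots> = 120 * k * int (card V choose 5) - m * int (card {X \<in> subsets_of_size 5 V. induces S T X})"
    using finV by (simp add: sum_subtractf card_subsets_of_size sum_distrib_left[symmetric] of_bool_def
        sum.If_cases Int_def)
  finally show ?thesis using assms(1) by (simp add: card_distinct_5 algebra_simps)
qed

lemma copies_le_of_pointwise:
  assumes "5 \<le> card V" "\<And>X. X \<subseteq> V \<Longrightarrow> card X = 5 \<Longrightarrow> i * sum5 X f + j * sum5 X g \<le> 120 * k - m * of_bool (induces S T X)"
  shows "i * sum5 V f + j * sum5 V g \<le> k * n5 - m * int (card {X \<in> subsets_of_size 5 V. induces S T X})"
  using sum5_le_of_pointwise[of "\<lambda>xs. i * app5 f xs + j * app5 g xs" k m S] assms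
  by (simp add: sum.distrib sum_distrib_left)

text \<open>With D the sum of fourth powers and O the sum of squared dominations, the left sides 15
  D + 80 O and 5 D + 10 O collect errors of 15 + 330 and 5 + 405 times the number of tuples with a
  repetition. The second inequality is halved; 400 and 2 are convenient common constants.\<close>

lemma copies_upper_bound:
  assumes "5 \<le> card V"
  defines "c \<equiv> \<lambda>S :: nat pair_pre_digraph. int (card {X \<in> subsets_of_size 5 V. induces S T X})"
  shows "1920 * c T5_7 + 2 * deficit T \<le> 5 * n5 + 400 * (int (card V) ^ 5 - n5)"
    and "1920 * c T5_12 + 2 * deficit T \<le> n5 + 400 * (int (card V) ^ 5 - n5)"
proof -
  define \<Delta> where "\<Delta> = int (card V) ^ 5 - n5"
  have "\<bar>(\<Sum>v\<in>V. imbalance T v ^ 4) - sum5 V (star4 e)\<bar> \<le> \<Delta>"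
    using sum_distinct_lists_5[OF finV, of "star4 e" 1] abs_star4_le unfolding sum_all_star4 \<Delta>_def by simp
  then have st: "(\<Sum>v\<in>V. imbalance T v ^ 4) \<le> sum5 V (star4 e) + \<Delta>" and \<Delta>0: "0 \<le> \<Delta>" by linarith+
  have D: "0 \<le> (\<Sum>v\<in>V. imbalance T v ^ 4)" and O: "0 \<le> (\<Sum>a\<in>V. \<Sum>b\<in>V. \<Sum>c\<in>V. domination T a b c ^ 2)"
    by (simp_all add: sum_nonneg)
  have s7: "80 * (\<Sum>a\<in>V. \<Sum>b\<in>V. \<Sum>c\<in>V. domination T a b c ^ 2) \<le> sum5 V (slack7 e) + 330 * \<Delta>"
    using sum_distinct_lists_5[OF finV, of "slack7 e" 330, OF abs_slack7_le] sum_all_slack7_ge unfolding \<Delta>_def by linarith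
  have s12: "10 * (\<Sum>a\<in>V. \<Sum>b\<in>V. \<Sum>c\<in>V. domination T a b c ^ 2) \<le> sum5 V (slack12 e) + 405 * \<Delta>"
    using sum_distinct_lists_5[OF finV, of "slack12 e" 405, OF abs_slack12_le] sum_all_slack12_ge unfolding \<Delta>_def by linarith
  have "1 * sum5 V (slack7 e) + 15 * sum5 V (star4 e) \<le> 5 * n5 - 1920 * c T5_7"
    unfolding c_def using sum5_bounds(1)[OF T] by (intro copies_le_of_pointwise assms(1)) simp
  with \<Delta>0 st s7 D O show "1920 * c T5_7 + 2 * deficit T \<le> 5 * n5 + 400 * (int (card V) ^ 5 - n5)"
    unfolding deficit_def \<Delta>_def[symmetric] by simp
  have "1 * sum5 V (slack12 e) + 5 * sum5 V (star4 e) \<le> 2 * n5 - 3840 * c T5_12"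
    unfolding c_def using sum5_bounds(2)[OF T] by (intro copies_le_of_pointwise assms(1)) simp
  with \<Delta>0 st s12 D O show "1920 * c T5_12 + 2 * deficit T \<le> n5 + 400 * (int (card V) ^ 5 - n5)"
    unfolding deficit_def \<Delta>_def[symmetric] by simp
qed

text \<open>With all imbalances 0 the free sums of \<open>star4\<close> and \<open>star_path\<close>
  vanish, so the injective sums are at most 1 and 3 times the number of tuples with a repetition.
  The first bound needs 10 * 3 + 15 = 45 of these, the second 10 * 3 + 5.\<close>

lemma copies_lower_bound:
  assumes "5 \<le> card V" and lt: "loc_trans e V" and D: "\<And>v. v \<in> V \<Longrightarrow> imbalance T v = 0"
  defines "c \<equiv> \<lambda>S :: nat pair_pre_digraph. int (card {X \<in> subsets_of_size 5 V. induces S T X})"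
  shows "5 * n5 \<le> 1920 * c T5_7 + 45 * (int (card V) ^ 5 - n5)"
    and "n5 \<le> 1920 * c T5_12 + 45 * (int (card V) ^ 5 - n5)"
proof -
  define \<Delta> where "\<Delta> = int (card V) ^ 5 - n5"
  have "(\<Sum>v\<in>V. imbalance T v ^ 4) = 0" using D by simp
  then have "\<bar>sum5 V (star4 e)\<bar> \<le> \<Delta>"
    using sum_distinct_lists_5[OF finV, of "star4 e" 1] abs_star4_le unfolding sum_all_star4 \<Delta>_def by simp
  then have st: "sum5 V (star4 e) \<le> \<Delta>" "- \<Delta> \<le> sum5 V (star4 e)" by linarith+
  have "(\<Sum>a\<in>V. \<Sum>b\<in>V. \<Sum>c\<in>V. \<Sum>x\<in>V. \<Sum>y\<in>V. star_path e a b c x y) = 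
     (\<Sum>a\<in>V. imbalance T a * (\<Sum>c\<in>V. \<Sum>x\<in>V. \<Sum>y\<in>V. e a c * e a x * e a y * (e c x * e c y + e x c * e x y + e y c * e y x)))"
    unfolding imbalance_def sum_distrib_right
    by (simp add: star_path_def star4_def sum_distrib_left mult.assoc)
  also have "\<dots> = 0" using D by simp
  finally have "\<bar>sum5 V (star_path e)\<bar> \<le> 3 * \<Delta>"
    using sum_distinct_lists_5[OF finV, of "star_path e" 3] abs_star_path_le unfolding \<Delta>_def by simp
  then have sp: "sum5 V (star_path e) \<le> 3 * \<Delta>" by linarith
  have lt': "loc_trans e X" if "X \<subseteq> V" for X using lt that unfolding loc_trans_def by blast
  have "(- 10) * sum5 V (star_path e) + (- 15) * sum5 V (star4 e) \<le> (- 5) * n5 + 1920 * c T5_7"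
    unfolding c_def
  \<comment> \<open>A negative m turns the upper bound into a lower bound on the number of
    copies.\<close>
  proof (rule copies_le_of_pointwise[OF assms(1), where m = "- 1920", unfolded mult_minus_left diff_minus_eq_add])
    fix X assume X: "X \<subseteq> V" "card X = 5"
    show "(- 10) * sum5 X (star_path e) + (- 15) * sum5 X (star4 e) \<le> 120 * (- 5) + 1920 * of_bool (induces T5_7 T X)"
      using sum5_bounds(3)[OF T X lt'[OF X(1)]] by linarith
  qed
  then show "5 * n5 \<le> 1920 * c T5_7 + 45 * (int (card V) ^ 5 - n5)"
    unfolding \<Delta>_def[symmetric] using st sp by linarith
  have "(- 10) * sum5 V (star_path e) + 5 * sum5 V (star4 e) \<le> (- 1) * n5 + 1920 * c T5_12"
    unfolding c_def
  proof (rule copies_le_of_pointwise[OF assms(1), where m = "- 1920", unfolded mult_minus_left diff_minus_eq_add])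
    fix X assume X: "X \<subseteq> V" "card X = 5"
    show "(- 10) * sum5 X (star_path e) + 5 * sum5 X (star4 e) \<le> 120 * (- 1) + 1920 * of_bool (induces T5_12 T X)"
      using sum5_bounds(4)[OF T X lt'[OF X(1)]] by linarith
  qed
  then show "n5 \<le> 1920 * c T5_12 + 45 * (int (card V) ^ 5 - n5)"
    unfolding \<Delta>_def[symmetric] using st sp by linarith
qed

end

section \<open>Density bounds\<close>

text \<open>For n >= 5, the ratio of the five-tuples with a repeated entry to those without.\<close>

definition tuple_excess :: "nat \<Rightarrow> real" where
  "tuple_excess n = real n ^ 5 / (120 * real (n choose 5)) - 1"

lemma choose_5: "5 \<le> n \<Longrightarrow> 120 * real (n choose 5) = real n * (real n - 1) * (real n - 2) * (real n - 3) * (real n - 4)"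
  by (simp add: binomial_altdef_of_nat eval_nat_numeral of_nat_diff field_simps)

lemma tuple_excess_tendsto: "tuple_excess \<longlonglongrightarrow> 0"
proof -
  have "(\<lambda>n. real n ^ 5 / (real n * (real n - 1) * (real n - 2) * (real n - 3) * (real n - 4)) - 1) \<longlonglongrightarrow> 0"
    by real_asymp
  then show ?thesis
    by (rule Lim_transform_eventually)
      (auto intro!: eventually_sequentiallyI[of 5] simp: tuple_excess_def choose_5)
qed

lemma tsize_T5: "tsize T5_7 = 5" "tsize T5_12 = 5"
  by (simp_all add: T5_7_def T5_12_def)

definition carousel_max :: "(nat pair_pre_digraph \<times> real) set" where
  "carousel_max = {(T5_7, 5 / 16), (T5_12, 1 / 16)}"

lemma carousel_max_cases:
  assumes "(S, r) \<in> carousel_max"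
  obtains "S = T5_7" "r = 5 / 16" | "S = T5_12" "r = 1 / 16"
  using assms unfolding carousel_max_def by blast

text \<open>The counting inequalities divided by 16 times the number of injective five-tuples: 25 =
  400 / 16, 1 / 8 = 2 / 16, and 3 exceeds 45 / 16. The deficit is nonnegative, so its denominator
  may be enlarged to n^5.\<close>

lemma tdensity_bounds:
  assumes T: "tournament T" and n: "5 \<le> tsize T" and S: "(S, r) \<in> carousel_max"
  shows "tdensity S T \<le> r + 25 * tuple_excess (tsize T) - real_of_int (deficit T) / (8 * real (tsize T) ^ 5)"
    and "loc_trans (arc_sign T) (pverts T) \<Longrightarrow> (\<And>v. v \<in> pverts T \<Longrightarrow> imbalance T v = 0) \<Longrightarrow>
      r - 3 * tuple_excess (tsize T) \<le> tdensity S T"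
proof -
  define n5 where "n5 = 120 * real (tsize T choose 5)"
  define c where "c = card {X \<in> subsets_of_size 5 (pverts T). induces S T X}"
  have fin: "finite (pverts T)" by (rule tournament_finite[OF T])
  have n5: "real_of_int (int (card (distinct_lists 5 (pverts T)))) = n5"
    using card_distinct_5[OF T n] by (simp add: n5_def)
  have pos: "n5 > 0" using n by (simp add: n5_def)
  have le: "n5 \<le> real (tsize T) ^ 5"
  proof -
    have "card (distinct_lists 5 (pverts T)) \<le> card {xs. set xs \<subseteq> pverts T \<and> length xs = 5}"
      using fin by (intro card_mono finite_lists_length_eq) (auto simp: distinct_lists_def)
    then have "real (card (distinct_lists 5 (pverts T))) \<le> real (tsize T ^ 5)"
      using fin by (subst of_nat_le_iff) (simp add: card_lists_length_eq)
    then show ?thesis unfolding of_nat_power n5[symmetric] by simp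
  qed
  have ex: "tuple_excess (tsize T) = (real (tsize T) ^ 5 - n5) / n5"
    using pos by (simp add: tuple_excess_def n5_def field_simps)
  have S': "tournament S" "tsize S = 5"
    using S tournament_T5_7 tournament_T5_12 tsize_T5 by (auto simp: carousel_max_def)
  have "{X \<in> subsets_of_size 5 (pverts T). induces S T X} = subsets_of_size 5 (pverts T) \<inter> {X. induces S T X}"
    by auto
  then have dens: "tdensity S T = 120 * real c / n5"
    using fin by (simp add: tdensity_eq_avg_subsets[OF S'(1) fin] S'(2) avg_subsets_def c_def n5_def
        of_bool_def sum.If_cases)
  have upper: "16 * (120 * real c) + 2 * real_of_int (deficit T) \<le> 16 * r * n5 + 400 * (real (tsize T) ^ 5 - n5)"
  proof (rule carousel_max_cases[OF S])
    show ?thesis if "S = T5_7" "r = 5 / 16"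
      using copies_upper_bound(1)[OF T n, THEN of_int_le_iff[where 'a = real, THEN iffD2]]
      unfolding that c_def of_int_add of_int_mult of_int_diff of_int_power n5 by simp
    show ?thesis if "S = T5_12" "r = 1 / 16"
      using copies_upper_bound(2)[OF T n, THEN of_int_le_iff[where 'a = real, THEN iffD2]]
      unfolding that c_def of_int_add of_int_mult of_int_diff of_int_power n5 by simp
  qed
  have def0: "0 \<le> deficit T" by (simp add: deficit_def sum_nonneg)
  have "tdensity S T \<le> r + 25 * ((real (tsize T) ^ 5 - n5) / n5) - real_of_int (deficit T) / (8 * n5)"
  proof -
    have "(r + 25 * ((real (tsize T) ^ 5 - n5) / n5) - real_of_int (deficit T) / (8 * n5)) * n5
        = r * n5 + 25 * (real (tsize T) ^ 5 - n5) - real_of_int (deficit T) / 8"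
      using pos by (simp add: field_simps)
    then show ?thesis unfolding dens pos_divide_le_eq[OF pos] using upper by simp
  qed
  moreover have "real_of_int (deficit T) / (8 * real (tsize T) ^ 5) \<le> real_of_int (deficit T) / (8 * n5)"
    using def0 pos le by (intro frac_le) auto
  ultimately show "tdensity S T \<le> r + 25 * tuple_excess (tsize T) - real_of_int (deficit T) / (8 * real (tsize T) ^ 5)"
    unfolding ex by linarith
  assume lt: "loc_trans (arc_sign T) (pverts T)" and D: "\<And>v. v \<in> pverts T \<Longrightarrow> imbalance T v = 0"
  have lower: "16 * r * n5 \<le> 16 * (120 * real c) + 45 * (real (tsize T) ^ 5 - n5)"
  proof (rule carousel_max_cases[OF S])
    show ?thesis if "S = T5_7" "r = 5 / 16"
      using copies_lower_bound(1)[OF T n lt D, THEN of_int_le_iff[where 'a = real, THEN iffD2]]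
      unfolding that c_def of_int_add of_int_mult of_int_diff of_int_power n5 by simp
    show ?thesis if "S = T5_12" "r = 1 / 16"
      using copies_lower_bound(2)[OF T n lt D, THEN of_int_le_iff[where 'a = real, THEN iffD2]]
      unfolding that c_def of_int_add of_int_mult of_int_diff of_int_power n5 by simp
  qed
  have "r - 45 / 16 * ((real (tsize T) ^ 5 - n5) / n5) \<le> tdensity S T"
  proof -
    have "(r - 45 / 16 * ((real (tsize T) ^ 5 - n5) / n5)) * n5 = r * n5 - 45 / 16 * (real (tsize T) ^ 5 - n5)"
      using pos by (simp add: field_simps)
    moreover have "r * n5 - 45 / 16 * (real (tsize T) ^ 5 - n5) \<le> 120 * real c"
      using lower by (simp add: field_simps)
    ultimately show ?thesis unfolding dens pos_le_divide_eq[OF pos] by (simp only:)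
  qed
  moreover have "45 / 16 * ((real (tsize T) ^ 5 - n5) / n5) \<le> 3 * ((real (tsize T) ^ 5 - n5) / n5)"
    using pos le by (intro mult_right_mono) auto
  ultimately show "r - 3 * tuple_excess (tsize T) \<le> tdensity S T" unfolding ex by linarith
qed

section \<open>Locally transitive tournaments are close to carousels\<close>

lemma rank_bij:
  assumes fin: "finite A"
    and irr: "\<And>x. x \<in> A \<Longrightarrow> \<not> L x x"
    and tot: "\<And>x y. x \<in> A \<Longrightarrow> y \<in> A \<Longrightarrow> x \<noteq> y \<Longrightarrow> L x y \<or> L y x"
    and trans: "\<And>x y z. x \<in> A \<Longrightarrow> y \<in> A \<Longrightarrow> z \<in> A \<Longrightarrow> L x y \<Longrightarrow> L y z \<Longrightarrow> L x z"
  defines "f \<equiv> \<lambda>y. card {x \<in> A. L x y}"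
  shows "bij_betw f A {0..<card A}" "\<And>x y. x \<in> A \<Longrightarrow> y \<in> A \<Longrightarrow> L x y \<longleftrightarrow> f x < f y"
proof -
  have mono: "f x < f y" if "x \<in> A" "y \<in> A" "L x y" for x y
    unfolding f_def
  proof (rule psubset_card_mono)
    show "{z \<in> A. L z x} \<subset> {z \<in> A. L z y}"
      using that trans irr by blast
  qed (use fin in simp)
  show less: "L x y \<longleftrightarrow> f x < f y" if "x \<in> A" "y \<in> A" for x y
    using mono that tot irr by (metis order_less_asym order_less_irrefl)
  have "inj_on f A"
    using mono tot by (intro inj_onI) (metis order_less_irrefl)
  moreover have "f ` A \<subseteq> {0..<card A}"
  proof
    fix i assume "i \<in> f ` A"
    then obtain y where y: "y \<in> A" "i = f y" by blast
    have "{x \<in> A. L x y} \<subset> A" using y irr by blast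
    then have "f y < card A" unfolding f_def using fin by (rule psubset_card_mono[rotated])
    then show "i \<in> {0..<card A}" using y by simp
  qed
  ultimately have "f ` A = {0..<card A}"
    using fin by (intro card_subset_eq) (auto simp: card_image)
  then show "bij_betw f A {0..<card A}" using \<open>inj_on f A\<close> by (simp add: bij_betw_def)
qed

text \<open>If the successors of u satisfying E form an initial segment of the successors, their
  number alone determines them. Comparing two tournaments at u then means comparing two
  numbers.\<close>

lemma initial_segment_iff:
  assumes f: "bij_betw f A {0..<n :: nat}" and fin: "finite A" and u: "u \<in> A" and w: "w \<in> A" "f u < f w"
    and init: "\<And>x y. x \<in> A \<Longrightarrow> y \<in> A \<Longrightarrow> f u < f x \<Longrightarrow> f x < f y \<Longrightarrow> E y \<Longrightarrow> E x"
  shows "E w \<longleftrightarrow> f w \<le> f u + card {x \<in> A. f u < f x \<and> E x}"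
proof -
  have card: "card {x \<in> A. f u < f x \<and> f x \<le> j} = j - f u" if "j < n" for j
  proof -
    have "f ` {x \<in> A. f u < f x \<and> f x \<le> j} = {f u<..j}"
    proof
      show "{f u<..j} \<subseteq> f ` {x \<in> A. f u < f x \<and> f x \<le> j}"
      proof
        fix i assume i: "i \<in> {f u<..j}"
        then have "i \<in> f ` A" using f that by (auto simp: bij_betw_def)
        then show "i \<in> f ` {x \<in> A. f u < f x \<and> f x \<le> j}" using i by auto
      qed
    qed auto
    moreover have "inj_on f {x \<in> A. f u < f x \<and> f x \<le> j}"
      by (rule inj_on_subset[OF bij_betw_imp_inj_on[OF f]]) auto
    ultimately show ?thesis using card_image[of f "{x \<in> A. f u < f x \<and> f x \<le> j}"] by simp
  qed
  have fw: "f w < n" using f w by (auto simp: bij_betw_def)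
  show ?thesis
  proof
    assume "E w"
    have "{x \<in> A. f u < f x \<and> f x \<le> f w} \<subseteq> {x \<in> A. f u < f x \<and> E x}"
    proof clarify
      fix x assume x: "x \<in> A" "f u < f x" "f x \<le> f w"
      show "E x"
      proof (cases "f x = f w")
        case True
        then have "x = w" using x(1) w(1) by (rule inj_onD[OF bij_betw_imp_inj_on[OF f]])
        then show ?thesis using \<open>E w\<close> by simp
      next
        case False
        then have "f x < f w" using x by simp
        then show ?thesis by (rule init[OF x(1) w(1) x(2) _ \<open>E w\<close>])
      qed
    qed
    then have "f w - f u \<le> card {x \<in> A. f u < f x \<and> E x}"
      unfolding card[OF fw, symmetric] by (rule card_mono[rotated]) (simp add: fin)
    then show "f w \<le> f u + card {x \<in> A. f u < f x \<and> E x}" by simp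
  next
    assume le: "f w \<le> f u + card {x \<in> A. f u < f x \<and> E x}"
    show "E w"
    proof (rule ccontr)
      assume "\<not> E w"
      have "{x \<in> A. f u < f x \<and> E x} \<subseteq> {x \<in> A. f u < f x \<and> f x \<le> f w - 1}"
      proof clarify
        fix x assume x: "x \<in> A" "f u < f x" "E x"
        have "\<not> f w < f x" using init[of w x] x w \<open>\<not> E w\<close> by blast
        moreover have "f w \<noteq> f x" using inj_onD[OF bij_betw_imp_inj_on[OF f], of w x] x w \<open>\<not> E w\<close> by auto
        ultimately show "f x \<le> f w - 1" by simp
      qed
      then have "card {x \<in> A. f u < f x \<and> E x} \<le> f w - 1 - f u"
        unfolding card[OF less_imp_diff_less[OF fw], symmetric] by (rule card_mono[rotated]) (simp add: fin)
      then show False using le w by simp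
    qed
  qed
qed

context
  fixes T :: "'a pair_pre_digraph" and X :: "'a set" and m :: nat
  assumes T: "tournament T" and X: "X \<subseteq> pverts T" "card X = 2 * m + 1"
    and lt: "loc_trans (arc_sign T) X"
begin

private abbreviation (input) E :: "'a \<Rightarrow> 'a \<Rightarrow> bool" where "E u w \<equiv> (u, w) \<in> parcs T"
private abbreviation (input) imb :: "'a \<Rightarrow> int" where "imb u \<equiv> \<Sum>w\<in>X. arc_sign T u w"

private lemma finX: "finite X" using X tournament_finite[OF T] finite_subset by blast

private lemma E_tot: "u \<in> X \<Longrightarrow> w \<in> X \<Longrightarrow> u \<noteq> w \<Longrightarrow> E u w \<or> E w u"
  using tournament_total[OF T] X by blast

private lemma E_asym: "E u w \<Longrightarrow> \<not> E w u"
  by (rule tournament_arc_in(4)[OF T])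

private lemma E_irrefl: "\<not> E u u"
  using tournament_arc_in(3)[OF T, of u u] by blast

private lemma no_dominated_cycle:
  assumes "a \<in> X" "b \<in> X" "c \<in> X" "x \<in> X" "E a b" "E b c" "E c a"
  shows "\<not> (E x a \<and> E x b \<and> E x c)" "\<not> (E a x \<and> E b x \<and> E c x)"
proof -
  have "cyc (arc_sign T) a b c" using assms by (simp add: cyc_def arc_sign_def)
  then have "beats (arc_sign T) a b c x = 0" "loses (arc_sign T) a b c x = 0"
    using lt assms unfolding loc_trans_def by blast+
  then show "\<not> (E x a \<and> E x b \<and> E x c)" "\<not> (E a x \<and> E b x \<and> E c x)"
    by (auto simp: beats_def loses_def arc_sign_eq_m1_iff[OF T])
qed

private lemma imb_eq:
  assumes "u \<in> X"
  shows "imb u = 2 * int (card {w \<in> X. E u w}) - 2 * int m"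
proof -
  \<comment> \<open>The last term corrects the entry w = u, where the sign is 0.\<close>
  have "imb u = (\<Sum>w\<in>X. 2 * of_bool (E u w) - 1 + of_bool (w = u))"
    using assms E_tot[of u] E_asym E_irrefl by (intro sum.cong refl) (auto simp: arc_sign_def)
  also have "\<dots> = 2 * int (card {w \<in> X. E u w}) - int (card X) + 1"
    using finX assms by (simp add: sum.distrib sum_subtractf sum_distrib_left[symmetric] of_bool_def sum.If_cases Int_def)
  finally show ?thesis using X by simp
qed

text \<open>Starting from a vertex \<open>v\<close> of least imbalance makes the two halves \<open>Out\<close> and \<open>In\<close> as equal as
  the imbalance of any other vertex allows.\<close>

lemma carousel_ordering:
  "\<exists>f. bij_betw f X {0..<2 * m + 1} \<and>
     (\<forall>u\<in>X. int (card {w \<in> X. f u < f w \<and> ((u, w) \<in> parcs T \<longleftrightarrow> (f u, f w) \<notin> parcs (carousel m))}) \<le> \<bar>imb u\<bar>)"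
proof -
  have "X \<noteq> {}" using X by auto
  then obtain v where v: "v \<in> X" and vmin: "\<And>u. u \<in> X \<Longrightarrow> \<bar>imb v\<bar> \<le> \<bar>imb u\<bar>"
    using finX ex_min_if_finite[of "(\<lambda>u. \<bar>imb u\<bar>) ` X"] by (auto simp: not_less)
  define Out where "Out = {u \<in> X. E v u}"
  define In where "In = {u \<in> X. E u v}"
  define L where "L x y \<longleftrightarrow> x = v \<and> y \<noteq> v \<or> x \<in> Out \<and> y \<in> In \<or> (x \<in> Out \<and> y \<in> Out \<or> x \<in> In \<and> y \<in> In) \<and> E x y" for x y
  define f where "f y = card {x \<in> X. L x y}" for y
  have part: "u = v \<or> u \<in> Out \<or> u \<in> In" if "u \<in> X" for u
    using E_tot[OF v that] that by (auto simp: Out_def In_def)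
  have disj: "u \<notin> Out \<or> u \<notin> In" "v \<notin> Out" "v \<notin> In" for u
    using E_asym[of u v] E_irrefl[of v] by (auto simp: Out_def In_def)
  \<comment> \<open>A violation would be a cyclic triple dominated by v; dually, in
    \<open>tI\<close>, one that dominates v.\<close>
  have tO: "E x z" if "x \<in> Out" "y \<in> Out" "z \<in> Out" "E x y" "E y z" for x y z
    using that no_dominated_cycle(1)[of x y z v] v E_tot[of x z] E_asym[of x y] E_irrefl[of x] by (auto simp: Out_def)
  have tI: "E x z" if "x \<in> In" "y \<in> In" "z \<in> In" "E x y" "E y z" for x y z
    using that no_dominated_cycle(2)[of x y z v] v E_tot[of x z] E_asym[of x y] E_irrefl[of x] by (auto simp: In_def)
  \<comment> \<open>Otherwise w' would beat all of v, u and w, which form a cycle v -> u -> w -> v.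
    So the in-neighbours of v that are beaten by u form an initial segment of
    \<open>In\<close>.\<close>
  have cross: "E u w'" if "u \<in> Out" "w \<in> In" "w' \<in> In" "E w' w" "E u w" for u w w'
    using that no_dominated_cycle(1)[of v u w w'] v E_tot[of u w'] E_asym[of u v] by (auto simp: Out_def In_def)
  have LX: "\<not> L x x" if "x \<in> X" for x
    using disj(1)[of x] disj(2,3) E_irrefl[of x] unfolding L_def by blast
  have Ltot: "L x y \<or> L y x" if "x \<in> X" "y \<in> X" "x \<noteq> y" for x y
    using part[OF that(1)] part[OF that(2)] that(3) E_tot[OF that] unfolding L_def by blast
  have Ltrans: "L x z" if "x \<in> X" "y \<in> X" "z \<in> X" and xy: "L x y" and yz: "L y z" for x y z
  proof -
    consider "x = v" "y \<noteq> v" | "x \<in> Out" "y \<in> In" | "x \<in> Out" "y \<in> Out" "E x y" | "x \<in> In" "y \<in> In" "E x y"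
      using xy unfolding L_def by blast
    then show ?thesis
    proof cases
      case 1
      then show ?thesis using yz disj(2,3) unfolding L_def by auto
    next
      case 2
      then show ?thesis using yz disj(1)[of y] disj(3) unfolding L_def by auto
    next
      case 3
      then show ?thesis using yz disj(2) tO[of x y z] unfolding L_def by auto
    next
      case 4
      then show ?thesis using yz disj(1)[of y] disj(3) tI[of x y z] unfolding L_def by auto
    qed
  qed
  have f_eq: "f = (\<lambda>y. card {x \<in> X. L x y})" by (rule ext) (rule f_def)
  have f: "bij_betw f X {0..<2 * m + 1}"
    unfolding f_eq X(2)[symmetric] by (rule rank_bij(1)[of X L, OF finX LX Ltot Ltrans])
  have fL: "L x y \<longleftrightarrow> f x < f y" if "x \<in> X" "y \<in> X" for x y
    unfolding f_eq by (rule rank_bij(2)[of X L, OF finX LX Ltot Ltrans that])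
  have fle: "f u \<le> 2 * m" if "u \<in> X" for u using bij_betw_apply[OF f that] by simp
  have init: "E u x" if "u \<in> X" "x \<in> X" "y \<in> X" "f u < f x" "f x < f y" "E u y" for u x y
  proof -
    have "L u x" "L x y" using that fL by auto
    then show ?thesis using that(6) disj(2,3) disj(1)[of u] disj(1)[of x] disj(1)[of y] cross[of u y x] part[OF that(1)]
      unfolding L_def by (auto simp: Out_def In_def)
  qed
  define a where "a = card Out"
  have imb_v: "imb v = 2 * int a - 2 * int m" using imb_eq[OF v] by (simp add: a_def Out_def)
  have fv: "f v = 0" unfolding f_def L_def using disj(2,3) by simp
  have finOut: "finite Out" using finX by (simp add: Out_def)
  have fO: "f u \<le> a" if "u \<in> Out" for u
  proof -
    have "{x \<in> X. L x u} \<subseteq> insert v (Out - {u})"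
      using that disj(1)[of u] disj(2,3) E_irrefl[of u] unfolding L_def by auto
    then have "f u \<le> card (insert v (Out - {u}))"
      unfolding f_def using finOut by (intro card_mono) auto
    also have "\<dots> = card Out"
      using that disj(2) finOut card_Suc_Diff1[OF finOut that] by simp
    finally show ?thesis by (simp add: a_def)
  qed
  have fI: "a < f u" if "u \<in> In" for u
  proof -
    have "insert v Out \<subseteq> {x \<in> X. L x u}"
      using that disj(2,3) v unfolding L_def by (auto simp: Out_def)
    then have "card (insert v Out) \<le> f u"
      unfolding f_def using finX by (intro card_mono) auto
    then show ?thesis using disj(2) finOut by (simp add: a_def)
  qed
  show ?thesis
  proof (intro exI[of _ f] conjI ballI f)
    fix u assume u: "u \<in> X"
    define r where "r = card {x \<in> X. f u < f x \<and> E u x}"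
    have iff: "E u w \<longleftrightarrow> f w \<le> f u + r" if "w \<in> X" "f u < f w" for w
      unfolding r_def using init u that by (intro initial_segment_iff[OF f finX]) auto
    have later: "card {x \<in> X. f u < f x} = 2 * m - f u"
    proof -
      have "f ` {x \<in> X. f u < f x} = {f u<..2 * m}"
      proof
        show "{f u<..2 * m} \<subseteq> f ` {x \<in> X. f u < f x}"
        proof
          fix i assume i: "i \<in> {f u<..2 * m}"
          then have "i \<in> f ` X" using f by (auto simp: bij_betw_def)
          then show "i \<in> f ` {x \<in> X. f u < f x}" using i by auto
        qed
      qed (use fle in auto)
      moreover have "inj_on f {x \<in> X. f u < f x}"
        by (rule inj_on_subset[OF bij_betw_imp_inj_on[OF f]]) auto
      ultimately show ?thesis using card_image[of f "{x \<in> X. f u < f x}"] by simp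
    qed
    have "r \<le> card {x \<in> X. f u < f x}"
      unfolding r_def using finX by (intro card_mono) auto
    then have rle: "f u + r \<le> 2 * m" using later fle[OF u] by simp
    \<comment> \<open>The number of later positions that position \<open>f u\<close> beats in the
      carousel: m of them, unless fewer than m positions follow.\<close>
    define m' where "m' = min m (2 * m - f u)"
    have dist: "\<bar>int r - int m'\<bar> \<le> \<bar>imb u\<bar>"
      using part[OF u]
    proof (elim disjE)
      assume uv: "u = v"
      have "{x \<in> X. f v < f x \<and> E v x} = Out"
        using fL[OF v] E_irrefl[of v] unfolding Out_def L_def by auto
      then have "r = a" by (simp add: r_def uv a_def)
      then show ?thesis using imb_v fv by (simp add: uv m'_def)
    next
      \<comment> \<open>All out-neighbours of u come later, so r - m is half the imbalance of u. If
        m' < m, then m - m' = f u - m <= a - m, half the imbalance of v; by the choice of v both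
        halves together are at most the imbalance of u in absolute value.\<close>
      assume uO: "u \<in> Out"
      have "f u < f w" if "w \<in> X" "E u w" for w
        using fL[OF u that(1)] part[OF that(1)] that uO E_asym[of v u] unfolding L_def by (auto simp: Out_def)
      then have "{x \<in> X. f u < f x \<and> E u x} = {x \<in> X. E u x}" by auto
      then have "imb u = 2 * int r - 2 * int m" using imb_eq[OF u] by (simp add: r_def)
      moreover have "\<bar>2 * int a - 2 * int m\<bar> \<le> \<bar>imb u\<bar>" using vmin[OF u] imb_v by simp
      ultimately show ?thesis using fO[OF uO] fle[OF u] unfolding m'_def min_def by (auto split: if_splits)
    next
      \<comment> \<open>Here u beats everything after it, so r and m' differ only if f u < m, and
        then by m - f u < m - a.\<close>
      assume uI: "u \<in> In"
      have "E u x" if "x \<in> X" "f u < f x" for x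
        using fL[OF u that(1)] that uI disj(1)[of u] disj(3) unfolding L_def by auto
      then have "{x \<in> X. f u < f x \<and> E u x} = {x \<in> X. f u < f x}" by auto
      then have "r = 2 * m - f u" using later by (simp add: r_def)
      moreover have "\<bar>2 * int a - 2 * int m\<bar> \<le> \<bar>imb u\<bar>" using vmin[OF u] imb_v by simp
      ultimately show ?thesis using fI[OF uI] fle[OF u] unfolding m'_def min_def by (auto split: if_splits)
    qed
    let ?D = "{w \<in> X. f u < f w \<and> ((u, w) \<in> parcs T \<longleftrightarrow> (f u, f w) \<notin> parcs (carousel m))}"
    \<comment> \<open>A disagreement lies between the ends of the two initial segments.\<close>
    have "f ` ?D \<subseteq> {f u + min r m'<..f u + max r m'}"
    proof clarify
      fix w assume w: "w \<in> X" "f u < f w" "(u, w) \<in> parcs T \<longleftrightarrow> (f u, f w) \<notin> parcs (carousel m)"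
      have "(f u, f w) \<in> parcs (carousel m) \<longleftrightarrow> f w \<le> f u + m'"
      proof -
        have "(f u, f w) \<in> parcs (carousel m) \<longleftrightarrow> f w \<le> f u + m"
          unfolding carousel_arc_iff using w(2) fle[OF u] fle[OF w(1)] by linarith
        also have "\<dots> \<longleftrightarrow> f w \<le> f u + m'"
          unfolding m'_def min_def using fle[OF u] fle[OF w(1)] by (simp, intro impI, linarith)
        finally show ?thesis .
      qed
      then have "(f w \<le> f u + r) \<noteq> (f w \<le> f u + m')" using iff[OF w(1,2)] w(3) by blast
      then show "f w \<in> {f u + min r m'<..f u + max r m'}" by auto
    qed
    from card_mono[OF finite_greaterThanAtMost this]
    have "card (f ` ?D) \<le> (f u + max r m') - (f u + min r m')"
      unfolding card_greaterThanAtMost .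
    moreover have "card (f ` ?D) = card ?D"
      by (rule card_image, rule inj_on_subset[OF bij_betw_imp_inj_on[OF f]]) (rule Collect_restrict)
    ultimately have "int (card ?D) \<le> \<bar>int r - int m'\<bar>" by (simp add: max_def min_def split: if_splits)
    then show "int (card ?D) \<le> \<bar>imb u\<bar>" using dist by (rule order_trans)
  qed
qed

end

section \<open>Transporting induced copies and averages along a bijection\<close>

lemma induces_transfer1:
  assumes "bij_betw f Y Z" "\<And>u w. u \<in> Y \<Longrightarrow> w \<in> Y \<Longrightarrow> (u, w) \<in> parcs T \<longleftrightarrow> (f u, f w) \<in> parcs T'"
    and "induces S T Y"
  shows "induces S T' Z"
proof -
  obtain g where g: "bij_betw g (pverts S) Y"
    "\<And>u v. u \<in> pverts S \<Longrightarrow> v \<in> pverts S \<Longrightarrow> (u, v) \<in> parcs S \<longleftrightarrow> (g u, g v) \<in> parcs T"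
    using assms(3) by (auto simp: induces_def)
  have "bij_betw (f \<circ> g) (pverts S) Z" using g(1) assms(1) by (rule bij_betw_trans)
  moreover have "(u, v) \<in> parcs S \<longleftrightarrow> ((f \<circ> g) u, (f \<circ> g) v) \<in> parcs T'"
    if "u \<in> pverts S" "v \<in> pverts S" for u v
    using g(2)[OF that] assms(2)[OF bij_betw_apply[OF g(1) that(1)] bij_betw_apply[OF g(1) that(2)]] by simp
  ultimately show ?thesis unfolding induces_def by blast
qed

lemma induces_transfer:
  assumes f: "bij_betw f Y Z"
    and arcs: "\<And>u w. u \<in> Y \<Longrightarrow> w \<in> Y \<Longrightarrow> (u, w) \<in> parcs T \<longleftrightarrow> (f u, f w) \<in> parcs T'"
  shows "induces S T Y \<longleftrightarrow> induces S T' Z"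
proof
  assume "induces S T' Z"
  moreover have "(u, w) \<in> parcs T' \<longleftrightarrow> (the_inv_into Y f u, the_inv_into Y f w) \<in> parcs T"
    if "u \<in> Z" "w \<in> Z" for u w
    using arcs[of "the_inv_into Y f u" "the_inv_into Y f w"] that
      bij_betw_apply[OF bij_betw_the_inv_into[OF f]] f_the_inv_into_f_bij_betw[OF f] by simp
  ultimately show "induces S T Y"
    using induces_transfer1[OF bij_betw_the_inv_into[OF f]] by blast
qed (rule induces_transfer1[OF f arcs])

lemma avg_subsets_reindex:
  assumes f: "bij_betw f X W"
  shows "avg_subsets k g W = avg_subsets k (\<lambda>Y. g (f ` Y)) X"
proof -
  have inj: "inj_on f X" and img: "f ` X = W" using f by (auto simp: bij_betw_def)
  have "bij_betw ((`) f) (subsets_of_size k X) (subsets_of_size k W)"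
    unfolding bij_betw_def
  proof
    show "inj_on ((`) f) (subsets_of_size k X)"
      using inj_on_image_eq_iff[OF inj] by (auto simp: inj_on_def subsets_of_size_def)
    show "(`) f ` subsets_of_size k X = subsets_of_size k W"
    proof
      show "subsets_of_size k W \<subseteq> (`) f ` subsets_of_size k X"
      proof
        fix Z assume Z: "Z \<in> subsets_of_size k W"
        then obtain Y where Y: "Y \<subseteq> X" "Z = f ` Y" using img by (auto simp: subsets_of_size_def subset_image_iff)
        then have "card Y = k" using Z inj by (auto simp: subsets_of_size_def card_image inj_on_subset)
        then show "Z \<in> (`) f ` subsets_of_size k X" using Y by (auto simp: subsets_of_size_def)
      qed
    qed (use img inj in \<open>auto simp: subsets_of_size_def card_image inj_on_subset\<close>)
  qed
  then have "(\<Sum>Y\<in>subsets_of_size k X. g (f ` Y)) = (\<Sum>Z\<in>subsets_of_size k W. g Z)"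
    by (rule sum.reindex_bij_betw)
  then show ?thesis using bij_betw_same_card[OF f] by (simp add: avg_subsets_def)
qed

lemma avg_subsets_sum:
  assumes "finite X" "j \<le> k" "k \<le> card X"
  shows "avg_subsets k (\<lambda>Y. \<Sum>P\<in>subsets_of_size j Y. h P) X = real (k choose j) * avg_subsets j h X"
proof -
  have "avg_subsets k (\<lambda>Y. \<Sum>P\<in>subsets_of_size j Y. h P) X = avg_subsets k (\<lambda>Y. real (k choose j) * avg_subsets j h Y) X"
    using assms(2) by (intro avg_subsets_cong) (simp add: avg_subsets_def)
  then show ?thesis by (simp add: avg_subsets_cmult avg_subsets_chain[OF assms])
qed

lemma pverts_carousel: "pverts (carousel m) = {0..<2 * m + 1}"
  by (simp add: carousel_def)

lemma avg_subsets_nonneg: "(\<And>X. X \<subseteq> V \<Longrightarrow> card X = k \<Longrightarrow> 0 \<le> g X) \<Longrightarrow> 0 \<le> avg_subsets k g V"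
  unfolding avg_subsets_def by (intro divide_nonneg_nonneg sum_nonneg) (auto simp: subsets_of_size_def)

text \<open>A k-set that contains no disagreeing pair induces the same tournament on both sides. The
  expected number of disagreeing pairs in a random k-set is (k choose 2) times their share among all
  m (2 m + 1) pairs, and the sum of the absolute imbalances bounds their number.\<close>

lemma loc_trans_near_carousel:
  assumes S: "tournament S" and T: "tournament T" and X: "X \<subseteq> pverts T" "card X = 2 * m + 1"
    and lt: "loc_trans (arc_sign T) X" and k: "tsize S \<le> 2 * m + 1" and m: "0 < m"
  shows "\<bar>avg_subsets (tsize S) (\<lambda>Y. of_bool (induces S T Y)) X - tdensity S (carousel m)\<bar>
    \<le> real (tsize S choose 2) * (\<Sum>u\<in>X. \<bar>real_of_int (\<Sum>w\<in>X. arc_sign T u w)\<bar>) / (real m * (2 * real m + 1))"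
    (is "?lhs \<le> real (?k choose 2) * ?s / ?d")
proof -
  have finX: "finite X" using X tournament_finite[OF T] finite_subset by blast
  obtain f where f: "bij_betw f X {0..<2 * m + 1}" and
    few: "\<And>u. u \<in> X \<Longrightarrow> int (card {w \<in> X. f u < f w \<and> ((u, w) \<in> parcs T \<longleftrightarrow> (f u, f w) \<notin> parcs (carousel m))})
       \<le> \<bar>\<Sum>w\<in>X. arc_sign T u w\<bar>"
    using carousel_ordering[OF T X lt] by blast
  define D where "D u = {w \<in> X. f u < f w \<and> ((u, w) \<in> parcs T \<longleftrightarrow> (f u, f w) \<notin> parcs (carousel m))}" for u
  define Dis where "Dis = (\<lambda>(u, w). {u, w}) ` (SIGMA u:X. D u)"
  have finD: "finite (D u)" for u using finX by (simp add: D_def)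
  have "card Dis \<le> card (SIGMA u:X. D u)" unfolding Dis_def using finX finD by (intro card_image_le) auto
  also have "\<dots> = (\<Sum>u\<in>X. card (D u))" using finX finD by simp
  finally have "real (card Dis) \<le> real (\<Sum>u\<in>X. card (D u))" by (rule of_nat_mono)
  also have "\<dots> = (\<Sum>u\<in>X. real_of_int (int (card (D u))))" by simp
  also have "\<dots> \<le> (\<Sum>u\<in>X. real_of_int \<bar>\<Sum>w\<in>X. arc_sign T u w\<bar>)"
    using few by (intro sum_mono of_int_le_iff[THEN iffD2]) (simp add: D_def)
  finally have card_Dis: "real (card Dis) \<le> ?s" by simp
  have Dis2: "Dis \<subseteq> subsets_of_size 2 X"
    by (auto simp: Dis_def D_def subsets_of_size_def card_insert_if)
  have agree: "induces S T Y \<longleftrightarrow> induces S (carousel m) (f ` Y)"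
    if Y: "Y \<subseteq> X" "\<not> (\<exists>P\<in>Dis. P \<subseteq> Y)" for Y
  proof (rule induces_transfer)
    show "bij_betw f Y (f ` Y)" using f Y(1) by (metis bij_betw_subset)
    have forward: "(u, w) \<in> parcs T \<longleftrightarrow> (f u, f w) \<in> parcs (carousel m)" if "u \<in> Y" "w \<in> Y" "f u < f w" for u w
    proof (rule ccontr)
      assume "\<not> ?thesis"
      then have "w \<in> D u" using that Y(1) by (auto simp: D_def)
      then have "(u, w) \<in> (SIGMA u:X. D u)" using subsetD[OF Y(1) that(1)] by simp
      from imageI[OF this, of "\<lambda>(u, w). {u, w}"] have "{u, w} \<in> Dis" by (simp add: Dis_def)
      moreover have "{u, w} \<subseteq> Y" using that(1,2) by simp
      ultimately show False using Y(2) by blast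
    qed
    fix u w assume uw: "u \<in> Y" "w \<in> Y"
    have fV: "f u \<in> pverts (carousel m)" "f w \<in> pverts (carousel m)"
      unfolding pverts_carousel using uw Y(1) bij_betw_apply[OF f] by blast+
    consider "f u < f w" | "f w < f u" | "f u = f w" by linarith
    then show "(u, w) \<in> parcs T \<longleftrightarrow> (f u, f w) \<in> parcs (carousel m)"
    proof cases
      case 1 then show ?thesis by (rule forward[OF uw])
    next
      case 2
      then have ne: "u \<noteq> w" by auto
      have "(u, w) \<in> parcs T \<longleftrightarrow> (w, u) \<notin> parcs T"
        using tournament.exactly_one_arc[OF T] uw Y(1) X(1) ne by blast
      also have "\<dots> \<longleftrightarrow> (f w, f u) \<notin> parcs (carousel m)" using forward[OF uw(2,1) 2] by simp
      also have "\<dots> \<longleftrightarrow> (f u, f w) \<in> parcs (carousel m)"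
        using tournament.exactly_one_arc[OF tournament_carousel fV] 2 by auto
      finally show ?thesis .
    next
      case 3
      then have "u = w" using uw Y(1) inj_onD[OF bij_betw_imp_inj_on[OF f]] by blast
      then show ?thesis
        using tournament_arc_in(3)[OF T, of w w] tournament_arc_in(3)[OF tournament_carousel, of "f w" "f w"] by auto
    qed
  qed
  have "tdensity S (carousel m) = avg_subsets ?k (\<lambda>Z. of_bool (induces S (carousel m) Z)) (pverts (carousel m))"
    by (rule tdensity_eq_avg_subsets[OF S]) (simp add: pverts_carousel)
  also have "\<dots> = avg_subsets ?k (\<lambda>Y. of_bool (induces S (carousel m) (f ` Y))) X"
    by (simp only: pverts_carousel avg_subsets_reindex[OF f])
  finally have "?lhs = \<bar>avg_subsets ?k (\<lambda>Y. of_bool (induces S T Y) - of_bool (induces S (carousel m) (f ` Y))) X\<bar>"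
    by (simp add: avg_subsets_diff)
  also have "\<dots> \<le> avg_subsets ?k (\<lambda>Y. \<bar>of_bool (induces S T Y) - of_bool (induces S (carousel m) (f ` Y))\<bar>) X"
    by (rule avg_subsets_abs)
  also have "\<dots> \<le> avg_subsets ?k (\<lambda>Y. \<Sum>P\<in>subsets_of_size 2 Y. of_bool (P \<in> Dis)) X"
  proof (rule avg_subsets_mono)
    fix Y assume Y: "Y \<subseteq> X"
    show "\<bar>of_bool (induces S T Y) - of_bool (induces S (carousel m) (f ` Y))\<bar>
        \<le> (\<Sum>P\<in>subsets_of_size 2 Y. of_bool (P \<in> Dis) :: real)"
    proof (cases "\<exists>P\<in>Dis. P \<subseteq> Y")
      case True
      then obtain P where P: "P \<in> Dis" "P \<in> subsets_of_size 2 Y"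
        using Dis2 by (auto simp: subsets_of_size_def)
      have "(1 :: real) \<le> (\<Sum>P\<in>subsets_of_size 2 Y. of_bool (P \<in> Dis))"
        using P finite_subset[OF Y finX] member_le_sum[of P "subsets_of_size 2 Y" "\<lambda>P. of_bool (P \<in> Dis) :: real"] by simp
      then show ?thesis by (rule order_trans[rotated]) simp
    next
      case False
      then show ?thesis using agree[OF Y] by (simp add: sum_nonneg)
    qed
  qed
  also have "\<dots> \<le> real (?k choose 2) * ?s / ?d"
  proof (cases "2 \<le> ?k")
    case True
    have "subsets_of_size 2 X \<inter> Dis = Dis" using Dis2 by blast
    then have "avg_subsets 2 (\<lambda>P. of_bool (P \<in> Dis)) X = real (card Dis) / real (card X choose 2)"
      using finX by (simp add: avg_subsets_def of_bool_def sum.If_cases)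
    also have "real (card X choose 2) = ?d"
      by (simp add: X(2) choose_two algebra_simps)
    finally have "avg_subsets 2 (\<lambda>P. of_bool (P \<in> Dis)) X \<le> ?s / ?d"
      using card_Dis m by (simp add: divide_right_mono)
    then show ?thesis
      using avg_subsets_sum[OF finX True, of "\<lambda>P. of_bool (P \<in> Dis)"] k X(2)
      by (simp add: mult_left_mono flip: times_divide_eq_right)
  next
    case False
    then have "avg_subsets ?k (\<lambda>Y. \<Sum>P\<in>subsets_of_size 2 Y. of_bool (P \<in> Dis)) X = avg_subsets ?k (\<lambda>Y. 0) X"
    proof (intro avg_subsets_cong sum.neutral ballI)
      fix Y P assume "Y \<subseteq> X" "card Y = ?k" "P \<in> subsets_of_size 2 Y"
      then show "of_bool (P \<in> Dis) = (0 :: real)"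
        using False card_mono[of Y P] finite_subset[OF _ finX] by (auto simp: subsets_of_size_def)
    qed
    also have "\<dots> = 0" by (simp add: avg_subsets_def)
    finally show ?thesis using False by (simp add: sum_nonneg)
  qed
  finally show ?thesis .
qed

section \<open>Averaging over subsets\<close>

text \<open>Expanding the squares, the diagonal terms contribute N (N - 1) and the others form a sum
  over injective triples. The latter is an average over three-subsets and can be pulled through a
  random choice of X.\<close>

lemma sum_imbalance_squares:
  assumes T: "tournament T" and X: "X \<subseteq> pverts T"
  shows "(\<Sum>u\<in>X. (\<Sum>w\<in>X. arc_sign T u w)\<^sup>2)
    = int (card X) * (int (card X) - 1) + (\<Sum>xs\<in>distinct_lists 3 X. arc_sign T (xs ! 0) (xs ! 1) * arc_sign T (xs ! 0) (xs ! 2))"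
proof -
  have fin: "finite X" using X tournament_finite[OF T] finite_subset by blast
  have three: "3 = Suc (Suc (Suc 0))" by simp
  let ?e = "arc_sign T"
  have self: "?e u u = 0" for u by (rule arc_sign_self[OF T])
  have "(\<Sum>xs\<in>distinct_lists 3 X. ?e (xs ! 0) (xs ! 1) * ?e (xs ! 0) (xs ! 2))
      = (\<Sum>a\<in>X. \<Sum>b\<in>X - {a}. \<Sum>c\<in>X - {a} - {b}. ?e a b * ?e a c)"
    unfolding three using fin by (simp add: sum_distinct_lists_Suc)
  also have "\<dots> = (\<Sum>a\<in>X. (\<Sum>w\<in>X. ?e a w)\<^sup>2 - (int (card X) - 1))"
  proof (intro sum.cong refl)
    fix a assume a: "a \<in> X"
    define D where "D = (\<Sum>w\<in>X. ?e a w)"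
    have D: "(\<Sum>w\<in>X - {a}. ?e a w) = D" using fin a by (simp add: D_def sum_diff1 self)
    have "(\<Sum>c\<in>X - {a} - {b}. ?e a b * ?e a c) = ?e a b * D - 1" if b: "b \<in> X - {a}" for b
    proof -
      have "(\<Sum>c\<in>X - {a} - {b}. ?e a c) = D - ?e a b"
        using fin b by (simp add: sum_diff1[of "X - {a}"] D)
      moreover have "?e a b = 1 \<or> ?e a b = -1"
        by (rule arc_sign_cases[OF T]) (use a b X in auto)
      then have "?e a b * ?e a b = 1" by (elim disjE) (simp_all del: arc_sign_eq_1_iff)
      ultimately show ?thesis by (simp add: sum_distrib_left[symmetric] right_diff_distrib)
    qed
    then have "(\<Sum>b\<in>X - {a}. \<Sum>c\<in>X - {a} - {b}. ?e a b * ?e a c) = (\<Sum>b\<in>X - {a}. ?e a b * D - 1)"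
      by (rule sum.cong[OF refl])
    also have "\<dots> = D\<^sup>2 - int (card (X - {a}))"
      by (simp add: sum_subtractf sum_distrib_right[symmetric] D power2_eq_square)
    also have "int (card (X - {a})) = int (card X) - 1"
      using card_Suc_Diff1[OF fin a] by linarith
    finally show "(\<Sum>b\<in>X - {a}. \<Sum>c\<in>X - {a} - {b}. ?e a b * ?e a c) = D\<^sup>2 - (int (card X) - 1)" .
  qed
  also have "\<dots> = (\<Sum>a\<in>X. (\<Sum>w\<in>X. ?e a w)\<^sup>2) - int (card X) * (int (card X) - 1)"
    by (simp add: sum_subtractf)
  finally show ?thesis by simp
qed

text \<open>The term N (N - 1) is the sampling noise that persists however regular T is; the rest is
  inherited from the global imbalances.\<close>

lemma avg_sum_imbalance_squares:
  assumes T: "tournament T" and N: "3 \<le> N" "N \<le> tsize T"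
  shows "avg_subsets N (\<lambda>X. real_of_int (\<Sum>u\<in>X. (\<Sum>w\<in>X. arc_sign T u w)\<^sup>2)) (pverts T)
    \<le> real N * (real N - 1) + real (N choose 3) * (real_of_int (\<Sum>u\<in>pverts T. (imbalance T u)\<^sup>2) / real (tsize T choose 3))"
proof -
  have fin: "finite (pverts T)" by (rule tournament_finite[OF T])
  define h where "h Y = real_of_int (\<Sum>xs\<in>distinct_lists 3 Y. arc_sign T (xs ! 0) (xs ! 1) * arc_sign T (xs ! 0) (xs ! 2))" for Y
  have sq: "real_of_int (\<Sum>u\<in>X. (\<Sum>w\<in>X. arc_sign T u w)\<^sup>2)
      = real (card X) * (real (card X) - 1) + real (card X choose 3) * avg_subsets 3 h X"
    if X: "X \<subseteq> pverts T" "3 \<le> card X" for X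
  proof -
    have finX: "finite X" using X(1) fin finite_subset by blast
    have "real_of_int (\<Sum>xs\<in>distinct_lists 3 X. arc_sign T (xs ! 0) (xs ! 1) * arc_sign T (xs ! 0) (xs ! 2))
        = (\<Sum>Y\<in>subsets_of_size 3 X. h Y)"
      unfolding sum_distinct_lists_by_set[OF finX] h_def by simp
    also have "\<dots> = real (card X choose 3) * avg_subsets 3 h X"
      using X(2) by (simp add: avg_subsets_def)
    finally show ?thesis unfolding sum_imbalance_squares[OF T X(1)] by simp
  qed
  have "avg_subsets N (\<lambda>X. real_of_int (\<Sum>u\<in>X. (\<Sum>w\<in>X. arc_sign T u w)\<^sup>2)) (pverts T)
      = avg_subsets N (\<lambda>X. real N * (real N - 1) + real (N choose 3) * avg_subsets 3 h X) (pverts T)"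
    using N by (intro avg_subsets_cong) (simp add: sq del: of_int_sum)
  also have "\<dots> = real N * (real N - 1) + real (N choose 3) * avg_subsets 3 h (pverts T)"
    using N fin by (simp add: avg_subsets_add avg_subsets_cmult avg_subsets_const avg_subsets_chain[of "pverts T" 3 N h])
  also have "avg_subsets 3 h (pverts T) \<le> real_of_int (\<Sum>u\<in>pverts T. (imbalance T u)\<^sup>2) / real (tsize T choose 3)"
  proof -
    have pos: "0 < real (tsize T choose 3)" using N by simp
    \<comment> \<open>The diagonal contribution for the whole vertex set is nonnegative and may be
      dropped.\<close>
    have "0 \<le> real (tsize T) * (real (tsize T) - 1)" using N by (intro mult_nonneg_nonneg) auto
    then show ?thesis
      unfolding pos_le_divide_eq[OF pos] imbalance_def using sq[of "pverts T"] N by (simp add: mult.commute)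
  qed
  finally show ?thesis by (simp add: mult_left_mono)
qed

text \<open>Since a vertex has sign 0 with itself, x differs from a, b and c, so a failure of local
  transitivity is always visible on exactly four vertices.\<close>

lemma not_loc_trans_witness:
  assumes T: "tournament T" and X: "X \<subseteq> pverts T" "\<not> loc_trans (arc_sign T) X"
  obtains a b c x where "{a, b, c, x} \<subseteq> X" "card {a, b, c, x} = 4" "cyc (arc_sign T) a b c"
    "beats (arc_sign T) a b c x + loses (arc_sign T) a b c x \<ge> 1"
proof -
  obtain a b c x where *: "a \<in> X" "b \<in> X" "c \<in> X" "x \<in> X" "cyc (arc_sign T) a b c"
    and nz: "beats (arc_sign T) a b c x \<noteq> 0 \<or> loses (arc_sign T) a b c x \<noteq> 0"
    using X(2) unfolding loc_trans_def by blast
  have self: "arc_sign T u u = 0" for u by (rule arc_sign_self[OF T])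
  have "a \<noteq> b" "b \<noteq> c" "c \<noteq> a" using *(5) self[of a] self[of b] self[of c] by (auto simp: cyc_def)
  moreover have "x \<noteq> a" "x \<noteq> b" "x \<noteq> c" using nz self[of x] by (auto simp: beats_def loses_def simp del: arc_sign_eq_1_iff)
  ultimately have "card {a, b, c, x} = 4" by auto
  moreover have "beats (arc_sign T) a b c x + loses (arc_sign T) a b c x \<ge> 1"
    using nz by (auto simp: beats_def loses_def)
  ultimately show ?thesis using that[of a b c x] * by auto
qed

text \<open>Union bound over the four-subsets of X.\<close>

lemma not_loc_trans_le:
  assumes T: "tournament T" and X: "X \<subseteq> pverts T" "4 \<le> card X"
  shows "of_bool (\<not> loc_trans (arc_sign T) X)
    \<le> real (card X choose 4) * avg_subsets 4 (\<lambda>Y. of_bool (\<not> loc_trans (arc_sign T) Y)) X"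
proof (cases "loc_trans (arc_sign T) X")
  case False
  have finX: "finite X" using X(1) tournament_finite[OF T] finite_subset by blast
  obtain a b c x where Y: "{a, b, c, x} \<subseteq> X" "card {a, b, c, x} = 4" "cyc (arc_sign T) a b c"
    "beats (arc_sign T) a b c x + loses (arc_sign T) a b c x \<ge> 1"
    by (rule not_loc_trans_witness[OF T X(1) False])
  have "\<not> loc_trans (arc_sign T) {a, b, c, x}"
    using Y(3,4) unfolding loc_trans_def by force
  then have "1 \<le> (\<Sum>Y\<in>subsets_of_size 4 X. of_bool (\<not> loc_trans (arc_sign T) Y) :: real)"
    using Y finX member_le_sum[of "{a, b, c, x}" "subsets_of_size 4 X" "\<lambda>Y. of_bool (\<not> loc_trans (arc_sign T) Y) :: real"]
    by (simp add: subsets_of_size_def)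
  then show ?thesis using False X(2) by (simp add: avg_subsets_def)
qed (simp add: avg_subsets_def sum_nonneg)

text \<open>Each bad four-set is the image of at least one tuple (a, b, c, x) counted by
  \<open>domination\<close>.\<close>

lemma avg_not_loc_trans_le:
  assumes T: "tournament T" and n: "4 \<le> tsize T"
  shows "avg_subsets 4 (\<lambda>Y. of_bool (\<not> loc_trans (arc_sign T) Y)) (pverts T)
    \<le> real_of_int (\<Sum>a\<in>pverts T. \<Sum>b\<in>pverts T. \<Sum>c\<in>pverts T. domination T a b c) / real (tsize T choose 4)"
proof -
  let ?V = "pverts T" and ?e = "arc_sign T"
  have fin: "finite ?V" by (rule tournament_finite[OF T])
  let ?R = "{(a, b, c, x) \<in> ?V \<times> ?V \<times> ?V \<times> ?V. cyc ?e a b c \<and> beats ?e a b c x + loses ?e a b c x \<ge> 1}"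
  have "subsets_of_size 4 ?V \<inter> {Y. \<not> loc_trans ?e Y} \<subseteq> (\<lambda>(a, b, c, x). {a, b, c, x}) ` ?R"
  proof
    fix Y assume "Y \<in> subsets_of_size 4 ?V \<inter> {Y. \<not> loc_trans ?e Y}"
    then have Y: "Y \<subseteq> ?V" "card Y = 4" "\<not> loc_trans ?e Y" by (auto simp: subsets_of_size_def)
    obtain a b c x where *: "{a, b, c, x} \<subseteq> Y" "card {a, b, c, x} = 4" "cyc ?e a b c"
      "beats ?e a b c x + loses ?e a b c x \<ge> 1"
      by (rule not_loc_trans_witness[OF T Y(1,3)])
    then have "Y = {a, b, c, x}"
      using Y(2) card_subset_eq[OF finite_subset[OF Y(1) fin] *(1)] by simp
    moreover have "(a, b, c, x) \<in> ?R" using * Y(1) by auto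
    ultimately show "Y \<in> (\<lambda>(a, b, c, x). {a, b, c, x}) ` ?R" by (intro rev_image_eqI[of "(a, b, c, x)"]) auto
  qed
  moreover have finR: "finite ?R" by (rule finite_subset[of _ "?V \<times> ?V \<times> ?V \<times> ?V"]) (use fin in auto)
  ultimately have "card (subsets_of_size 4 ?V \<inter> {Y. \<not> loc_trans ?e Y}) \<le> card ?R"
    by (meson card_image_le card_mono finite_imageI order_trans)
  then have "int (card (subsets_of_size 4 ?V \<inter> {Y. \<not> loc_trans ?e Y})) \<le> (\<Sum>(a, b, c, x)\<in>?R. 1)"
    by simp
  also have "\<dots> \<le> (\<Sum>(a, b, c, x)\<in>?R. if cyc ?e a b c then beats ?e a b c x + loses ?e a b c x else 0)"
    by (rule sum_mono) auto
  also have "\<dots> \<le> (\<Sum>(a, b, c, x)\<in>?V \<times> ?V \<times> ?V \<times> ?V. if cyc ?e a b c then beats ?e a b c x + loses ?e a b c x else 0)"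
  proof (rule sum_mono2)
    show "finite (?V \<times> ?V \<times> ?V \<times> ?V)" using fin by simp
    show "?R \<subseteq> ?V \<times> ?V \<times> ?V \<times> ?V" by auto
    show "0 \<le> (case t of (a, b, c, x) \<Rightarrow> if cyc ?e a b c then beats ?e a b c x + loses ?e a b c x else 0)" for t
      by (cases t) (simp add: beats_def loses_def)
  qed
  also have "\<dots> = (\<Sum>a\<in>?V. \<Sum>b\<in>?V. \<Sum>c\<in>?V. domination T a b c)"
    by (simp add: sum.cartesian_product[symmetric] domination_def sum_if_const)
  finally have "real_of_int (int (card (subsets_of_size 4 ?V \<inter> {Y. \<not> loc_trans ?e Y})))
      \<le> real_of_int (\<Sum>a\<in>?V. \<Sum>b\<in>?V. \<Sum>c\<in>?V. domination T a b c)" by (rule of_int_le_iff[THEN iffD2])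
  then show ?thesis
    using fin by (simp add: avg_subsets_def of_bool_def sum.If_cases divide_right_mono Collect_neg_eq[symmetric])
qed

section \<open>Approximation by carousels\<close>

lemma avg_subsets_of_bool_bounds:
  assumes "finite V"
  shows "0 \<le> avg_subsets k (\<lambda>X. of_bool (P X)) V" "avg_subsets k (\<lambda>X. of_bool (P X)) V \<le> 1"
proof -
  show "0 \<le> avg_subsets k (\<lambda>X. of_bool (P X)) V" by (rule avg_subsets_nonneg) simp
  have "avg_subsets k (\<lambda>X. of_bool (P X)) V \<le> avg_subsets k (\<lambda>X. 1) V" by (rule avg_subsets_mono) simp
  also have "\<dots> \<le> 1" using assms by (simp add: avg_subsets_def card_subsets_of_size)
  finally show "avg_subsets k (\<lambda>X. of_bool (P X)) V \<le> 1" .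
qed

text \<open>T is replaced by a random set X of 2 m + 1 vertices. The three terms are the constant
  part of the weighted AM-GM bound, its quadratic part, and the probability that X is not locally
  transitive.\<close>

lemma tdensity_near_carousel:
  fixes S :: "'a pair_pre_digraph" and T :: "'b pair_pre_digraph"
  assumes S: "tournament S" and T: "tournament T"
    and m: "tsize S \<le> 2 * m + 1" "4 \<le> 2 * m + 1" "2 * m + 1 \<le> tsize T"
  defines "N \<equiv> real (2 * m + 1)" and "c \<equiv> real (tsize S choose 2) / (real m * (2 * real m + 1))"
  shows "\<bar>tdensity S T - tdensity S (carousel m)\<bar> \<le> c * (N * sqrt N / 2)
     + c / (2 * sqrt N) * (N * (N - 1) + real ((2 * m + 1) choose 3) *
         (real_of_int (\<Sum>u\<in>pverts T. (imbalance T u)\<^sup>2) / real (tsize T choose 3)))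
     + real ((2 * m + 1) choose 4) *
         (real_of_int (\<Sum>a\<in>pverts T. \<Sum>b\<in>pverts T. \<Sum>c\<in>pverts T. domination T a b c) / real (tsize T choose 4))"
proof -
  let ?V = "pverts T" and ?e = "arc_sign T" and ?k = "tsize S" and ?N = "2 * m + 1"
  have finV: "finite ?V" by (rule tournament_finite[OF T])
  have s: "sqrt N > 0" by (simp add: N_def)
  have c: "c \<ge> 0" by (simp add: c_def)
  define p where "p X = avg_subsets ?k (\<lambda>Y. of_bool (induces S T Y)) X" for X
  define SS where "SS X = real_of_int (\<Sum>u\<in>X. (\<Sum>w\<in>X. ?e u w)\<^sup>2)" for X
  define q where "q X = avg_subsets 4 (\<lambda>Y. of_bool (\<not> loc_trans ?e Y)) X" for X
  have pt: "\<bar>p X - tdensity S (carousel m)\<bar>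
      \<le> c * (N * sqrt N / 2) + c / (2 * sqrt N) * SS X + real (?N choose 4) * q X"
    if X: "X \<subseteq> ?V" "card X = ?N" for X
  proof (cases "loc_trans ?e X")
    case True
    have finX: "finite X" using X(1) finV finite_subset by blast
    \<comment> \<open>AM-GM, weighted such that the sum over the $N$ vertices is of order $N^{3/2} = o(N^2)$.\<close>
    have am: "\<bar>x\<bar> \<le> sqrt N / 2 + x\<^sup>2 / (2 * sqrt N)" for x :: real
    proof -
      have "0 \<le> (\<bar>x\<bar> - sqrt N)\<^sup>2" by simp
      then have "2 * \<bar>x\<bar> * sqrt N \<le> sqrt N * sqrt N + x\<^sup>2" by (simp add: power2_eq_square algebra_simps)
      then show ?thesis using s by (simp add: field_simps)
    qed
    have "\<bar>p X - tdensity S (carousel m)\<bar>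
        \<le> real (?k choose 2) * (\<Sum>u\<in>X. \<bar>real_of_int (\<Sum>w\<in>X. ?e u w)\<bar>) / (real m * (2 * real m + 1))"
      unfolding p_def using m by (intro loc_trans_near_carousel[OF S T X True]) auto
    also have "\<dots> = c * (\<Sum>u\<in>X. \<bar>real_of_int (\<Sum>w\<in>X. ?e u w)\<bar>)" by (simp add: c_def)
    also have "\<dots> \<le> c * (\<Sum>u\<in>X. sqrt N / 2 + (real_of_int (\<Sum>w\<in>X. ?e u w))\<^sup>2 / (2 * sqrt N))"
      by (intro mult_left_mono[OF sum_mono[OF am] c])
    also have "\<dots> = c * (N * sqrt N / 2) + c / (2 * sqrt N) * SS X"
      by (simp add: sum.distrib X(2) SS_def N_def sum_divide_distrib[symmetric] distrib_left)
    finally have "\<bar>p X - tdensity S (carousel m)\<bar> \<le> c * (N * sqrt N / 2) + c / (2 * sqrt N) * SS X" .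
    moreover have "0 \<le> q X" unfolding q_def by (rule avg_subsets_of_bool_bounds[OF finX])
    then have "0 \<le> real (?N choose 4) * q X" by (intro mult_nonneg_nonneg) simp_all
    ultimately show ?thesis by linarith
  next
    case False
    have finX: "finite X" using X(1) finV finite_subset by blast
    \<comment> \<open>Both densities lie in [0, 1], and the last term alone already pays for the
      failure.\<close>
    have "\<bar>p X - tdensity S (carousel m)\<bar> \<le> 1"
      using avg_subsets_of_bool_bounds[OF finX, of ?k "induces S T"]
        avg_subsets_of_bool_bounds[of "pverts (carousel m)" ?k "induces S (carousel m)"]
      by (simp add: p_def tdensity_eq_avg_subsets[OF S] pverts_carousel abs_le_iff)
    moreover have "1 \<le> real (?N choose 4) * q X"
      using not_loc_trans_le[OF T X(1)] False X(2) m(2) by (simp add: q_def)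
    moreover have "0 \<le> c * (N * sqrt N / 2)" using c by (simp add: N_def)
    moreover have "0 \<le> SS X" unfolding SS_def by (simp add: sum_nonneg del: of_int_sum)
    then have "0 \<le> c / (2 * sqrt N) * SS X" using c s by simp
    ultimately show ?thesis by linarith
  qed
  have "tdensity S T = avg_subsets ?N p ?V"
    unfolding tdensity_eq_avg_subsets[OF S finV] p_def by (rule avg_subsets_chain[OF finV m(1,3)])
  then have "tdensity S T - tdensity S (carousel m) = avg_subsets ?N (\<lambda>X. p X - tdensity S (carousel m)) ?V"
    using m finV by (simp add: avg_subsets_diff avg_subsets_const)
  then have "\<bar>tdensity S T - tdensity S (carousel m)\<bar> \<le> avg_subsets ?N (\<lambda>X. \<bar>p X - tdensity S (carousel m)\<bar>) ?V"
    by (simp add: avg_subsets_abs)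
  also have "\<dots> \<le> avg_subsets ?N (\<lambda>X. c * (N * sqrt N / 2) + c / (2 * sqrt N) * SS X + real (?N choose 4) * q X) ?V"
    by (rule avg_subsets_mono[OF pt])
  also have "\<dots> = c * (N * sqrt N / 2) + c / (2 * sqrt N) * avg_subsets ?N SS ?V + real (?N choose 4) * avg_subsets ?N q ?V"
    unfolding avg_subsets_add avg_subsets_cmult using m finV by (simp add: avg_subsets_const)
  also have "avg_subsets ?N q ?V = q ?V" unfolding q_def using m by (intro avg_subsets_chain[symmetric] finV) auto
  finally have *: "\<bar>tdensity S T - tdensity S (carousel m)\<bar>
      \<le> c * (N * sqrt N / 2) + c / (2 * sqrt N) * avg_subsets ?N SS ?V + real (?N choose 4) * q ?V" .
  have "avg_subsets ?N SS ?V \<le> N * (N - 1) + real (?N choose 3) *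
         (real_of_int (\<Sum>u\<in>?V. (imbalance T u)\<^sup>2) / real (tsize T choose 3))"
    unfolding SS_def N_def using m by (intro avg_sum_imbalance_squares[OF T]) auto
  moreover have "q ?V \<le> real_of_int (\<Sum>a\<in>?V. \<Sum>b\<in>?V. \<Sum>c\<in>?V. domination T a b c) / real (tsize T choose 4)"
    unfolding q_def using m by (intro avg_not_loc_trans_le[OF T]) auto
  ultimately show ?thesis
    using c s by (intro order_trans[OF *] add_mono order_refl mult_left_mono) auto
qed

text \<open>Writes the right sides of the two Cauchy-Schwarz estimates in
  \<open>deficit_bounds\<close> as squares, ready for taking roots.\<close>

lemma power_split:
  assumes "0 \<le> (d :: real)"
  shows "d * x ^ 5 * x = (sqrt d * x ^ 3)\<^sup>2" "d * x ^ 5 * (x * (x * x)) = (sqrt d * x ^ 4)\<^sup>2"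
  using assms by (simp_all add: power_mult_distrib power2_eq_square numeral_eq_Suc mult_ac)

text \<open>Cauchy-Schwarz passes from fourth powers to squares of imbalances and from squared to
  plain domination counts. The constants 27 = 3^3 and 256 = 4^4 come from (n / k)^k <= n choose
  k.\<close>

lemma deficit_bounds:
  fixes T :: "'a pair_pre_digraph"
  assumes T: "tournament T" and n: "4 \<le> tsize T"
  defines "\<delta> \<equiv> real_of_int (deficit T) / real (tsize T) ^ 5"
  shows "real_of_int (\<Sum>u\<in>pverts T. (imbalance T u)\<^sup>2) / real (tsize T choose 3) \<le> 27 * sqrt \<delta>"
    and "real_of_int (\<Sum>a\<in>pverts T. \<Sum>b\<in>pverts T. \<Sum>c\<in>pverts T. domination T a b c) / real (tsize T choose 4) \<le> 256 * sqrt \<delta>"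
proof -
  let ?V = "pverts T" and ?n = "real (tsize T)"
  have finV: "finite ?V" by (rule tournament_finite[OF T])
  have n0: "?n > 0" using n by simp
  have d: "real_of_int (deficit T) = \<delta> * ?n ^ 5" using n0 by (simp add: \<delta>_def)
  define D2 where "D2 = real_of_int (\<Sum>u\<in>?V. (imbalance T u)\<^sup>2)"
  define Om where "Om = real_of_int (\<Sum>a\<in>?V. \<Sum>b\<in>?V. \<Sum>c\<in>?V. domination T a b c)"
  have dom0: "0 \<le> domination T a b c" for a b c
    by (simp add: domination_def beats_def loses_def sum_nonneg)
  have nonneg: "0 \<le> (\<Sum>v\<in>?V. imbalance T v ^ 4)" "0 \<le> (\<Sum>a\<in>?V. \<Sum>b\<in>?V. \<Sum>c\<in>?V. domination T a b c ^ 2)"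
    by (simp_all add: sum_nonneg)
  have \<delta>0: "\<delta> \<ge> 0" using nonneg by (simp add: \<delta>_def deficit_def del: of_int_sum)
  have sq: "x \<le> sqrt \<delta> * y" if "x\<^sup>2 \<le> (sqrt \<delta> * y)\<^sup>2" "0 \<le> y" for x y :: real
    using that \<delta>0 by (intro power2_le_imp_le[OF that(1)]) simp
  have D4: "(\<Sum>u\<in>?V. (real_of_int ((imbalance T u)\<^sup>2))\<^sup>2) \<le> real_of_int (deficit T)"
  proof -
    have "(\<Sum>u\<in>?V. (real_of_int ((imbalance T u)\<^sup>2))\<^sup>2) = real_of_int (\<Sum>v\<in>?V. imbalance T v ^ 4)"
      by (simp add: power_mult[symmetric])
    then show ?thesis using nonneg by (simp add: deficit_def del: of_int_sum)
  qed
  have "D2\<^sup>2 \<le> (\<Sum>u\<in>?V. (real_of_int ((imbalance T u)\<^sup>2))\<^sup>2) * ?n"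
    unfolding D2_def of_int_sum by (rule sum_squared_le_sum_of_squares)
  also have "\<dots> \<le> real_of_int (deficit T) * ?n" using D4 n0 by (intro mult_right_mono) auto
  also have "\<dots> = (sqrt \<delta> * ?n ^ 3)\<^sup>2" unfolding d by (rule power_split(1)[OF \<delta>0])
  finally have D2: "D2 \<le> sqrt \<delta> * ?n ^ 3" by (rule sq) simp
  let ?V3 = "?V \<times> ?V \<times> ?V" and ?dom = "\<lambda>(a, b, c). real_of_int (domination T a b c)"
  have O2: "(\<Sum>t\<in>?V3. (?dom t)\<^sup>2) \<le> real_of_int (deficit T)"
  proof -
    have "(\<Sum>t\<in>?V3. (?dom t)\<^sup>2) = real_of_int (\<Sum>a\<in>?V. \<Sum>b\<in>?V. \<Sum>c\<in>?V. domination T a b c ^ 2)"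
      by (simp add: sum.cartesian_product split_def)
    then show ?thesis using nonneg by (simp add: deficit_def del: of_int_sum)
  qed
  have Om_eq: "Om = (\<Sum>t\<in>?V3. ?dom t)" by (simp add: Om_def sum.cartesian_product split_def)
  have "Om\<^sup>2 \<le> (\<Sum>t\<in>?V3. (?dom t)\<^sup>2) * real (card ?V3)"
    unfolding Om_eq by (rule sum_squared_le_sum_of_squares)
  also have "\<dots> \<le> real_of_int (deficit T) * real (card ?V3)" using O2 by (intro mult_right_mono) auto
  also have "\<dots> = \<delta> * ?n ^ 5 * (?n * (?n * ?n))" unfolding d by (simp add: card_cartesian_product)
  also have "\<dots> = (sqrt \<delta> * ?n ^ 4)\<^sup>2" by (rule power_split(2)[OF \<delta>0])
  finally have Om: "Om \<le> sqrt \<delta> * ?n ^ 4" by (rule sq) simp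
  have "(?n / 3) ^ 3 \<le> real (tsize T choose 3)"
    using binomial_ge_n_over_k_pow_k[of 3 "tsize T", where 'a = real] n by simp
  then have c3: "?n ^ 3 \<le> 27 * real (tsize T choose 3)" by (simp add: power_divide)
  have "(?n / 4) ^ 4 \<le> real (tsize T choose 4)"
    using binomial_ge_n_over_k_pow_k[of 4 "tsize T", where 'a = real] n by simp
  then have c4: "?n ^ 4 \<le> 256 * real (tsize T choose 4)" by (simp add: power_divide)
  have "D2 \<le> sqrt \<delta> * (27 * real (tsize T choose 3))"
    using D2 mult_left_mono[OF c3, of "sqrt \<delta>"] \<delta>0 by simp
  then have "D2 / real (tsize T choose 3) \<le> 27 * sqrt \<delta>"
    using n by (simp add: pos_divide_le_eq mult_ac)
  then show "real_of_int (\<Sum>u\<in>?V. (imbalance T u)\<^sup>2) / real (tsize T choose 3) \<le> 27 * sqrt \<delta>"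
    unfolding D2_def .
  have "Om \<le> sqrt \<delta> * (256 * real (tsize T choose 4))"
    using Om mult_left_mono[OF c4, of "sqrt \<delta>"] \<delta>0 by simp
  then have "Om / real (tsize T choose 4) \<le> 256 * sqrt \<delta>"
    using n by (simp add: pos_divide_le_eq mult_ac)
  then show "real_of_int (\<Sum>a\<in>?V. \<Sum>b\<in>?V. \<Sum>c\<in>?V. domination T a b c) / real (tsize T choose 4) \<le> 256 * sqrt \<delta>"
    unfolding Om_def .
qed

section \<open>The carousel\<close>

lemma arc_sign_nonzero: "arc_sign T u v \<noteq> 0 \<Longrightarrow> arc_sign T u v = 1 \<or> arc_sign T u v = -1"
  by (simp add: arc_sign_def split: if_splits)

lemma imbalance_eq_out_degree:
  assumes T: "tournament T" and v: "v \<in> pverts T"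
  shows "imbalance T v = 2 * int (card {w \<in> pverts T. (v, w) \<in> parcs T}) - int (tsize T) + 1"
proof -
  have "imbalance T v = (\<Sum>w\<in>pverts T. 2 * of_bool ((v, w) \<in> parcs T) - 1 + of_bool (w = v))"
    unfolding imbalance_def
  proof (intro sum.cong refl)
    fix w assume w: "w \<in> pverts T"
    show "arc_sign T v w = 2 * of_bool ((v, w) \<in> parcs T) - 1 + of_bool (w = v)"
      using tournament.exactly_one_arc[OF T v w] tournament_arc_in(3)[OF T, of v v] by (auto simp: arc_sign_def)
  qed
  then show ?thesis
    using tournament_finite[OF T] v
    by (simp add: sum.distrib sum_subtractf sum_distrib_left[symmetric] of_bool_def sum.If_cases Int_def)
qed

lemma imbalance_carousel:
  assumes v: "v \<in> pverts (carousel m)"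
  shows "imbalance (carousel m) v = 0"
proof -
  have v': "v < 2 * m + 1" using v by (simp add: pverts_carousel)
  have "card {w \<in> pverts (carousel m). (v, w) \<in> parcs (carousel m)} = m"
  proof (cases "v \<le> m")
    case True
    then have "{w \<in> pverts (carousel m). (v, w) \<in> parcs (carousel m)} = {v<..v + m}"
      by (auto simp: pverts_carousel carousel_arc_iff)
    then show ?thesis by simp
  next
    case False
    then have "{w \<in> pverts (carousel m). (v, w) \<in> parcs (carousel m)} = {v<..2 * m} \<union> {..<v - m}"
      using v' by (auto simp: pverts_carousel carousel_arc_iff)
    moreover have "card ({v<..2 * m} \<union> {..<v - m}) = (2 * m - v) + (v - m)"
      by (subst card_Un_disjoint) auto
    ultimately show ?thesis using False v' by simp
  qed
  then show ?thesis
    using imbalance_eq_out_degree[OF tournament_carousel v] by (simp add: pverts_carousel)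
qed

text \<open>The out-neighbours of x are m consecutive residues, on which all arcs follow the cyclic
  order; hence they contain no cycle, and neither do the in-neighbours.\<close>

lemma carousel_no_dominated_cycle:
  assumes "(a, b) \<in> parcs (carousel m)" "(b, c) \<in> parcs (carousel m)" "(c, a) \<in> parcs (carousel m)"
  shows "\<not> ((x, a) \<in> parcs (carousel m) \<and> (x, b) \<in> parcs (carousel m) \<and> (x, c) \<in> parcs (carousel m))"
    and "\<not> ((a, x) \<in> parcs (carousel m) \<and> (b, x) \<in> parcs (carousel m) \<and> (c, x) \<in> parcs (carousel m))"
  using assms unfolding carousel_arc_iff by linarith+

lemma loc_trans_carousel: "loc_trans (arc_sign (carousel m)) (pverts (carousel m))"
proof -
  let ?e = "arc_sign (carousel m)"
  have "beats ?e a b c x = 0 \<and> loses ?e a b c x = 0" if c: "cyc ?e a b c" for a b c x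
  proof -
    have "?e a b = 1 \<or> ?e a b = -1" by (rule arc_sign_nonzero) (use c in \<open>simp add: cyc_def\<close>)
    then show ?thesis
    proof
      assume "?e a b = 1"
      then have "?e b c = 1" "?e c a = 1" using c by (simp_all add: cyc_def del: arc_sign_eq_1_iff)
      with \<open>?e a b = 1\<close> show ?thesis
        using carousel_no_dominated_cycle[of a b m c x]
        by (auto simp: beats_def loses_def arc_sign_eq_m1_iff[OF tournament_carousel])
    next
      \<comment> \<open>Reading the triple backwards as c, b, a gives a directed cycle.\<close>
      assume "?e a b = -1"
      then have "?e b c = -1" "?e c a = -1" using c by (simp_all add: cyc_def del: arc_sign_eq_1_iff)
      with \<open>?e a b = -1\<close> show ?thesis
        using carousel_no_dominated_cycle[of c b m a x]
        by (auto simp: beats_def loses_def arc_sign_eq_m1_iff[OF tournament_carousel])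
    qed
  qed
  then show ?thesis unfolding loc_trans_def by blast
qed

lemma deficit_carousel: "deficit (carousel m) = 0"
proof -
  have "domination (carousel m) a b c = 0"
    if "a \<in> pverts (carousel m)" "b \<in> pverts (carousel m)" "c \<in> pverts (carousel m)" for a b c
    using loc_trans_carousel[of m] that unfolding loc_trans_def by (auto simp: domination_def intro!: sum.neutral)
  then show ?thesis by (simp add: deficit_def imbalance_carousel)
qed

section \<open>Convergence\<close>

definition deficit_density :: "'a pair_pre_digraph \<Rightarrow> real" where
  "deficit_density T = real_of_int (deficit T) / real (tsize T) ^ 5"

lemma deficit_density_nonneg: "0 \<le> deficit_density T"
  by (simp add: deficit_density_def deficit_def sum_nonneg add_nonneg_nonneg del: of_int_sum)

text \<open>A m is of order 1 / sqrt m. B m may be huge, but neither depends on T, so for fixed m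
  only the deficit of T matters.\<close>

lemma tdensity_carousel_approx:
  fixes S :: "'a pair_pre_digraph"
  assumes S: "tournament S"
  obtains A B :: "nat \<Rightarrow> real" where "A \<longlonglongrightarrow> 0"
    "\<And>m (T :: 'b pair_pre_digraph). tournament T \<Longrightarrow> tsize S \<le> 2 * m + 1 \<Longrightarrow> 4 \<le> 2 * m + 1 \<Longrightarrow> 2 * m + 1 \<le> tsize T \<Longrightarrow>
      \<bar>tdensity S T - tdensity S (carousel m)\<bar> \<le> A m + B m * sqrt (deficit_density T)"
proof -
  define c where "c m = real (tsize S choose 2) / (real m * (2 * real m + 1))" for m
  define N where "N m = real (2 * m + 1)" for m
  define u where "u m = c m / (2 * sqrt (N m))" for m
  define A where "A m = c m * (N m * sqrt (N m) / 2) + u m * (N m * (N m - 1))" for m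
  define B where "B m = u m * (real ((2 * m + 1) choose 3) * 27) + real ((2 * m + 1) choose 4) * 256" for m
  define K where "K = real (tsize S choose 2)"
  have "(\<lambda>m. K * (1 / (real m * (2 * real m + 1)) * (real (2 * m + 1) * sqrt (real (2 * m + 1)) / 2))
     + K * (1 / (real m * (2 * real m + 1)) / (2 * sqrt (real (2 * m + 1))) * (real (2 * m + 1) * (real (2 * m + 1) - 1))))
     \<longlonglongrightarrow> K * 0 + K * 0"
    by (intro tendsto_add tendsto_mult[OF tendsto_const]) real_asymp+
  then have A: "A \<longlonglongrightarrow> 0"
    unfolding A_def u_def c_def N_def K_def[symmetric] by (simp del: of_nat_add of_nat_mult of_nat_Suc)
  have "\<bar>tdensity S T - tdensity S (carousel m)\<bar> \<le> A m + B m * sqrt (deficit_density T)"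
    if T: "tournament T" and m: "tsize S \<le> 2 * m + 1" "4 \<le> 2 * m + 1" "2 * m + 1 \<le> tsize T"
    for m and T :: "'b pair_pre_digraph"
  proof -
    define \<delta> where "\<delta> = sqrt (deficit_density T)"
    have n: "4 \<le> tsize T" using m by linarith
    have c0: "u m \<ge> 0" by (simp add: u_def c_def N_def)
    have "\<bar>tdensity S T - tdensity S (carousel m)\<bar> \<le> c m * (N m * sqrt (N m) / 2)
      + u m * (N m * (N m - 1) + real ((2 * m + 1) choose 3) *
         (real_of_int (\<Sum>u\<in>pverts T. (imbalance T u)\<^sup>2) / real (tsize T choose 3)))
      + real ((2 * m + 1) choose 4) *
         (real_of_int (\<Sum>a\<in>pverts T. \<Sum>b\<in>pverts T. \<Sum>c\<in>pverts T. domination T a b c) / real (tsize T choose 4))"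
      unfolding u_def c_def N_def by (rule tdensity_near_carousel[OF S T m])
    also have "\<dots> \<le> c m * (N m * sqrt (N m) / 2)
      + u m * (N m * (N m - 1) + real ((2 * m + 1) choose 3) * (27 * \<delta>))
      + real ((2 * m + 1) choose 4) * (256 * \<delta>)"
      unfolding \<delta>_def deficit_density_def
      by (intro add_mono order_refl mult_left_mono deficit_bounds[OF T n] c0) simp_all
    also have "\<dots> = A m + B m * \<delta>" by (simp add: A_def B_def distrib_left distrib_right mult_ac add_ac)
    finally show ?thesis by (simp add: \<delta>_def)
  qed
  then show ?thesis using that[OF A] by blast
qed

lemma tsize_carousel: "tsize (carousel m) = 2 * m + 1"
  by (simp add: pverts_carousel)

text \<open>Gives meaning to the \<open>lim\<close> in \<open>carousel_hom\<close>: larger carousels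
  have deficit 0, so their densities stay within A m of that of \<open>carousel m\<close>.\<close>

lemma carousel_converges:
  assumes S: "tournament S"
  shows "(\<lambda>m. tdensity S (carousel m)) \<longlonglongrightarrow> carousel_hom S"
proof -
  obtain A B :: "nat \<Rightarrow> real" where A: "A \<longlonglongrightarrow> 0" and
    near: "\<And>m (T :: nat pair_pre_digraph). tournament T \<Longrightarrow> tsize S \<le> 2 * m + 1 \<Longrightarrow> 4 \<le> 2 * m + 1 \<Longrightarrow> 2 * m + 1 \<le> tsize T \<Longrightarrow>
      \<bar>tdensity S T - tdensity S (carousel m)\<bar> \<le> A m + B m * sqrt (deficit_density T)"
    using tdensity_carousel_approx[OF S] by blast
  have close: "\<bar>tdensity S (carousel n) - tdensity S (carousel m)\<bar> \<le> A m" if "tsize S \<le> m" "2 \<le> m" "m \<le> n" for m n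
    using near[of "carousel n" m] that
    by (simp add: tournament_carousel tsize_carousel deficit_density_def deficit_carousel)
  have "Cauchy (\<lambda>m. tdensity S (carousel m))"
  proof (rule metric_CauchyI)
    fix \<epsilon> :: real assume "\<epsilon> > 0"
    then obtain M where M: "\<And>m. m \<ge> M \<Longrightarrow> \<bar>A m\<bar> < \<epsilon>"
      using LIMSEQ_D[OF A] by fastforce
    have less: "\<bar>tdensity S (carousel n) - tdensity S (carousel m)\<bar> < \<epsilon>"
      if "max M (max (tsize S) 2) \<le> m" "m \<le> n" for m n
    proof -
      have "\<bar>tdensity S (carousel n) - tdensity S (carousel m)\<bar> \<le> A m"
        using that by (intro close) auto
      also have "A m < \<epsilon>" using M[of m] that(1) by simp
      finally show ?thesis .
    qed
    have "dist (tdensity S (carousel m)) (tdensity S (carousel n)) < \<epsilon>"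
      if "m \<ge> max M (max (tsize S) 2)" "n \<ge> max M (max (tsize S) 2)" for m n
    proof (cases "m \<le> n")
      case True
      then show ?thesis using less[OF that(1) True] by (simp add: dist_real_def abs_minus_commute)
    next
      case False
      then show ?thesis using less[OF that(2), of m] by (simp add: dist_real_def)
    qed
    then show "\<exists>M. \<forall>m\<ge>M. \<forall>n\<ge>M. dist (tdensity S (carousel m)) (tdensity S (carousel n)) < \<epsilon>" by blast
  qed
  then have "convergent (\<lambda>m. tdensity S (carousel m))" by (rule Cauchy_convergent)
  then show ?thesis unfolding carousel_hom_def by (rule convergent_LIMSEQ_iff[THEN iffD1])
qed

lemma tdensity_tendsto_carousel_hom:
  fixes T :: "nat \<Rightarrow> 'a pair_pre_digraph"
  assumes S: "tournament S" and T: "\<And>n. tournament (T n)"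
    and size: "filterlim (\<lambda>n. tsize (T n)) at_top sequentially"
    and \<delta>: "(\<lambda>n. deficit_density (T n)) \<longlonglongrightarrow> 0"
  shows "(\<lambda>n. tdensity S (T n)) \<longlonglongrightarrow> carousel_hom S"
proof -
  obtain A B :: "nat \<Rightarrow> real" where A: "A \<longlonglongrightarrow> 0" and
    near: "\<And>m (T :: 'a pair_pre_digraph). tournament T \<Longrightarrow> tsize S \<le> 2 * m + 1 \<Longrightarrow> 4 \<le> 2 * m + 1 \<Longrightarrow> 2 * m + 1 \<le> tsize T \<Longrightarrow>
      \<bar>tdensity S T - tdensity S (carousel m)\<bar> \<le> A m + B m * sqrt (deficit_density T)"
    using tdensity_carousel_approx[OF S] by blast
  show ?thesis
  proof (rule tendstoI)
    fix \<epsilon> :: real assume \<epsilon>: "\<epsilon> > 0"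
    have "\<forall>\<^sub>F m in sequentially. \<bar>A m\<bar> < \<epsilon> / 3"
      using tendstoD[OF A, of "\<epsilon> / 3"] \<epsilon> by simp
    moreover have "\<forall>\<^sub>F m in sequentially. dist (tdensity S (carousel m)) (carousel_hom S) < \<epsilon> / 3"
      using \<epsilon> by (intro tendstoD[OF carousel_converges[OF S]]) simp
    moreover have "\<forall>\<^sub>F m in sequentially. m \<ge> max (tsize S) 2" by (rule eventually_ge_at_top)
    ultimately have "\<forall>\<^sub>F m in sequentially. \<bar>A m\<bar> < \<epsilon> / 3 \<and> dist (tdensity S (carousel m)) (carousel_hom S) < \<epsilon> / 3
        \<and> m \<ge> max (tsize S) 2"
      by eventually_elim simp
    from eventually_happens'[OF sequentially_bot this] obtain m where m: "\<bar>A m\<bar> < \<epsilon> / 3" "dist (tdensity S (carousel m)) (carousel_hom S) < \<epsilon> / 3" "m \<ge> max (tsize S) 2"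
      by blast
    \<comment> \<open>m is now fixed, and n alone makes this product small although B m may be
      large.\<close>
    have "(\<lambda>n. B m * sqrt (deficit_density (T n))) \<longlonglongrightarrow> B m * sqrt 0"
      by (intro tendsto_intros \<delta>)
    from tendstoD[OF this, of "\<epsilon> / 3"] have "\<forall>\<^sub>F n in sequentially. \<bar>B m * sqrt (deficit_density (T n))\<bar> < \<epsilon> / 3"
      using \<epsilon> by simp
    moreover have "\<forall>\<^sub>F n in sequentially. tsize (T n) \<ge> 2 * m + 1"
      using size by (simp add: filterlim_at_top)
    ultimately show "\<forall>\<^sub>F n in sequentially. dist (tdensity S (T n)) (carousel_hom S) < \<epsilon>"
    proof eventually_elim
      case (elim n)
      have "\<bar>tdensity S (T n) - tdensity S (carousel m)\<bar> \<le> A m + B m * sqrt (deficit_density (T n))"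
        using m(3) elim(2) by (intro near[OF T]) auto
      then show ?case using m elim unfolding dist_real_def by linarith
    qed
  qed
qed

section \<open>Maximum densities and extremal sequences\<close>

lemma carousel_max_tournament:
  assumes "(S, r) \<in> carousel_max"
  shows "tournament S" "tsize S = 5"
  using assms tournament_T5_7 tournament_T5_12 tsize_T5 by (auto elim!: carousel_max_cases)

lemma tdensity_carousel_tendsto:
  assumes S: "(S, r) \<in> carousel_max"
  shows "(\<lambda>m. tdensity S (carousel m)) \<longlonglongrightarrow> r"
proof (rule tendsto_sandwich)
  have ex: "(\<lambda>m. tuple_excess (2 * m + 1)) \<longlonglongrightarrow> 0"
    by (rule filterlim_compose[OF tuple_excess_tendsto filterlim_subseq]) (simp add: strict_mono_def)
  have "(\<lambda>m. r - 3 * tuple_excess (2 * m + 1)) \<longlonglongrightarrow> r - 3 * 0" by (intro tendsto_intros ex)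
  then show "(\<lambda>m. r - 3 * tuple_excess (2 * m + 1)) \<longlonglongrightarrow> r" by simp
  have "(\<lambda>m. r + 25 * tuple_excess (2 * m + 1)) \<longlonglongrightarrow> r + 25 * 0" by (intro tendsto_intros ex)
  then show "(\<lambda>m. r + 25 * tuple_excess (2 * m + 1)) \<longlonglongrightarrow> r" by simp
  show "\<forall>\<^sub>F m in sequentially. r - 3 * tuple_excess (2 * m + 1) \<le> tdensity S (carousel m)"
    using tdensity_bounds(2)[OF tournament_carousel _ S loc_trans_carousel imbalance_carousel]
    by (auto simp: tsize_carousel intro!: eventually_sequentiallyI[of 2])
  show "\<forall>\<^sub>F m in sequentially. tdensity S (carousel m) \<le> r + 25 * tuple_excess (2 * m + 1)"
    using tdensity_bounds(1)[OF tournament_carousel _ S]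
    by (auto simp: tsize_carousel deficit_carousel intro!: eventually_sequentiallyI[of 2])
qed

text \<open>Some n-subset has at least the average density of S, and it induces a tournament that
  competes in the maximum.\<close>

lemma tdensity_le_max_tdensity:
  fixes T :: "nat pair_pre_digraph"
  assumes S: "tournament S" and T: "tournament T" and n: "tsize S \<le> n" "n \<le> tsize T"
  shows "tdensity S T \<le> max_tdensity S n"
proof -
  have fin: "finite (pverts T)" by (rule tournament_finite[OF T])
  have "tdensity S T = avg_subsets n (avg_subsets (tsize S) (\<lambda>Y. of_bool (induces S T Y))) (pverts T)"
    unfolding tdensity_eq_avg_subsets[OF S fin] by (rule avg_subsets_chain[OF fin n])
  then obtain X where X: "X \<subseteq> pverts T" "card X = n"
    "tdensity S T \<le> avg_subsets (tsize S) (\<lambda>Y. of_bool (induces S T Y)) X"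
    using avg_subsets_le_Max[OF fin n(2)] by metis
  define R where "R = \<lparr>pverts = X, parcs = parcs T \<inter> X \<times> X\<rparr>"
  have finX: "finite X" using X(1) fin finite_subset by blast
  have R: "tournament R" unfolding R_def
  proof (rule tournamentI)
    show "(v, v) \<notin> parcs T \<inter> X \<times> X" for v using tournament_arc_in(3)[OF T, of v v] by blast
    show "(u, v) \<in> parcs T \<inter> X \<times> X \<longleftrightarrow> (v, u) \<notin> parcs T \<inter> X \<times> X" if "u \<in> X" "v \<in> X" "u \<noteq> v" for u v
      using tournament.exactly_one_arc[OF T, of u v] that X(1) by blast
  qed (use finX in auto)
  have "avg_subsets (tsize S) (\<lambda>Y. of_bool (induces S T Y)) X = avg_subsets (tsize S) (\<lambda>Y. of_bool (induces S R Y)) X"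
  proof (rule avg_subsets_cong)
    fix Y assume Y: "Y \<subseteq> X"
    have "induces S T Y \<longleftrightarrow> induces S R Y"
      by (rule induces_transfer[of id]) (use Y in \<open>auto simp: R_def\<close>)
    then show "(of_bool (induces S T Y) :: real) = of_bool (induces S R Y)" by simp
  qed
  also have "\<dots> = tdensity S R" using finX by (simp add: tdensity_eq_avg_subsets[OF S] R_def)
  also have "\<dots> \<le> max_tdensity S n"
    unfolding max_tdensity_def using R X(2) by (intro Max_ge finite_tdensities) (auto simp: R_def)
  finally show ?thesis using X(3) by linarith
qed

lemma max_tdensity_tendsto:
  assumes S: "(S, r) \<in> carousel_max"
  shows "max_tdensity S \<longlonglongrightarrow> r"
proof (rule tendsto_sandwich[OF _ _ tendsto_const])
  have "(\<lambda>n. r + 25 * tuple_excess n) \<longlonglongrightarrow> r + 25 * 0" by (intro tendsto_intros tuple_excess_tendsto)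
  then show "(\<lambda>n. r + 25 * tuple_excess n) \<longlonglongrightarrow> r" by simp
  have "max_tdensity S n \<le> r + 25 * tuple_excess n" if n: "5 \<le> n" for n
    unfolding max_tdensity_def
  proof (rule Max.boundedI[OF finite_tdensities tdensities_nonempty])
    fix d assume "d \<in> {tdensity S T | T :: nat pair_pre_digraph. tournament T \<and> tsize T = n}"
    then obtain T :: "nat pair_pre_digraph" where T: "tournament T" "tsize T = n" "d = tdensity S T" by blast
    then show "d \<le> r + 25 * tuple_excess n"
      using tdensity_bounds(1)[OF T(1) _ S] n deficit_density_nonneg[of T] by (simp add: deficit_density_def)
  qed
  then show "\<forall>\<^sub>F n in sequentially. max_tdensity S n \<le> r + 25 * tuple_excess n"
    by (rule eventually_sequentiallyI)
  \<comment> \<open>Only the limit of the carousel densities is known to be r; letting the carousel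
    grow for fixed n passes that limit to the maximum.\<close>
  have "r \<le> max_tdensity S n" if n: "5 \<le> n" for n
  proof (rule LIMSEQ_le_const2[OF tdensity_carousel_tendsto[OF S]])
    show "\<exists>M. \<forall>m\<ge>M. tdensity S (carousel m) \<le> max_tdensity S n"
      using carousel_max_tournament[OF S] n
      by (intro exI[of _ n] allI impI tdensity_le_max_tdensity tournament_carousel) (auto simp: tsize_carousel)
  qed
  then show "\<forall>\<^sub>F n in sequentially. r \<le> max_tdensity S n" by (rule eventually_sequentiallyI)
qed

lemma extremal_iff_quasi_carousel:
  fixes T :: "nat \<Rightarrow> 'a pair_pre_digraph"
  assumes S: "(S, r) \<in> carousel_max" and T: "\<And>n. tournament (T n)" and inc: "increasing_sizes T"
  shows "extremal S T \<longleftrightarrow> quasi_carousel T"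
proof
  assume "quasi_carousel T"
  then have "(\<lambda>n. tdensity S (T n)) \<longlonglongrightarrow> carousel_hom S"
    using carousel_max_tournament[OF S] by (simp add: quasi_carousel_def)
  moreover have "carousel_hom S = r"
    using LIMSEQ_unique[OF carousel_converges tdensity_carousel_tendsto[OF S]] carousel_max_tournament[OF S] by blast
  ultimately show "extremal S T"
    unfolding extremal_def using max_tdensity_tendsto[OF S] by blast
next
  assume "extremal S T"
  then have lim: "(\<lambda>n. tdensity S (T n)) \<longlonglongrightarrow> r"
    unfolding extremal_def using LIMSEQ_unique[OF max_tdensity_tendsto[OF S]] by blast
  have "strict_mono (\<lambda>n. tsize (T n))"
    using inc by (simp add: increasing_sizes_def strict_mono_Suc_iff)
  then have size: "filterlim (\<lambda>n. tsize (T n)) at_top sequentially"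
    by (rule filterlim_subseq)
  have "(\<lambda>n. deficit_density (T n)) \<longlonglongrightarrow> 0"
  proof (rule tendsto_sandwich[OF _ _ tendsto_const])
    show "\<forall>\<^sub>F n in sequentially. 0 \<le> deficit_density (T n)" by (simp add: deficit_density_nonneg)
    have "\<forall>\<^sub>F n in sequentially. 5 \<le> tsize (T n)" using size by (simp add: filterlim_at_top)
    \<comment> \<open>The upper bound solved for the deficit: it is at most 8 times the gap to the
      maximal density, up to the tuple error.\<close>
    then show "\<forall>\<^sub>F n in sequentially. deficit_density (T n) \<le> 8 * (r + 25 * tuple_excess (tsize (T n)) - tdensity S (T n))"
      by eventually_elim (use tdensity_bounds(1)[OF T _ S] in \<open>force simp: deficit_density_def\<close>)
    have "(\<lambda>n. 8 * (r + 25 * tuple_excess (tsize (T n)) - tdensity S (T n))) \<longlonglongrightarrow> 8 * (r + 25 * 0 - r)"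
      by (intro tendsto_intros lim filterlim_compose[OF tuple_excess_tendsto size])
    then show "(\<lambda>n. 8 * (r + 25 * tuple_excess (tsize (T n)) - tdensity S (T n))) \<longlonglongrightarrow> 0" by simp
  qed
  then show "quasi_carousel T"
    unfolding quasi_carousel_def using tdensity_tendsto_carousel_hom[OF _ T size] by blast
qed

theorem theorem1p2:
  shows "max_tdensity T5_7 \<longlonglongrightarrow> 5 / 16 \<and>
    max_tdensity T5_12 \<longlonglongrightarrow> 1 / 16 \<and>
    (\<forall>S \<in> {T5_7, T5_12}. \<forall>T :: nat \<Rightarrow> 'a pair_pre_digraph.
       (\<forall>n. tournament (T n)) \<and> increasing_sizes T \<longrightarrow>
         (extremal S T \<longleftrightarrow> quasi_carousel T))"
proof -
  have S: "(T5_7, 5 / 16) \<in> carousel_max" "(T5_12, 1 / 16) \<in> carousel_max"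
    by (simp_all add: carousel_max_def)
  then show ?thesis
    using max_tdensity_tendsto extremal_iff_quasi_carousel[where 'a = 'a] by blast
qed

end
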